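(* Let $W$ be a (non-empty) closed subset of $\mathbf{Hilb}_{p(t)}^{n}$. Then the Hilbert polynomial of the ideals $I_{\mathrm{vs}(\mathbf{in}(W))}$ and $I_{\mathrm{vs}(\mathbf{gin}(W))}$ is $p(t)$. If, moreover, $W$ is stable under the action of $\mathrm{GL}$, then $I_{\mathrm{vs}(\mathbf{in}(W))}=I_{\mathrm{vs}(\mathbf{gin}(W))}$ is a point of $W$ (i.e. it defines a point of $W$).
   Context: $K$ is an infinite field, $S=K[x_0,\dots,x_n]$ with the standard grading, $S_m$ is its degree $m$ component, a term is a monic monomial, $\prec$ is a term order on $S$ with $x_0\prec\dots\prec x_n$. $\mathbf{Hilb}_{p(t)}^{n}$ is the Hilbert scheme of closed subschemes of $\mathbb P^n_K$ with Hilbert polynomial $p(t)$; $r$ is the Gotzmann number of $p(t)$ (the smallest integer such that the saturated ideals of all such subschemes are $r$-regular). Fix $m\ge r$, $q=\binom{n+m}{n}-p(m)$. $\mathbf{Hilb}_{p(t)}^{n}$ is regarded as a closed subscheme of the Grassmannian $\mathbf{Gr}_{S_m}^{q}$ of $q$-dimensional subspaces of $S_m$ by sending a subscheme with saturated ideal $I$ to $I_m$; the Grassmannian is embedded in $\mathbb P(\wedge^qS_m)$ by Plücker. For a $K$-point $V\subseteq S_m$ of the Grassmannian, $I_V$ is the ideal of $S$ generated by $V$. The Hilbert polynomial of an ideal $I$ means that of $S/I$. An ideal "is a point" of the Hilbert scheme when it is identified with the point of the subscheme of $\mathbb P^n_K$ it defines. $\mathbf T_{S_m}^{q}$ is the set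 of $\tau_1\wedge\dots\wedge\tau_q$ with $\tau_i$ terms in $S_m$, $\tau_1\succ\dots\succ\tau_q$, totally ordered by: $\tau_1\wedge\dots\wedge\tau_q\prec\sigma_1\wedge\dots\wedge\sigma_q$ iff for some $j$, $\tau_i=\sigma_i$ for $i<j$ and $\tau_j\prec\sigma_j$. For $L=\tau_1\wedge\dots\wedge\tau_q$, $U_L\subseteq\mathbf{Gr}_{S_m}^{q}$ is the open set where the Plücker coordinate $\Delta_L$ is invertible, $\mathrm{vs}(L)=\langle\tau_1,\dots,\tau_q\rangle$. $\mathrm{GL}=\mathrm{GL}_K(n+1)$ acts on $S$ by $g(f)=f(\sum_j g_{0j}x_j,\dots,\sum_j g_{nj}x_j)$ and correspondingly on $\mathbf{Gr}_{S_m}^{q}$; $\mathcal O(W)=\{g(V):V\in W,\ g\in\mathrm{GL}\}$. For a non-empty set $W$ of points, $\mathbf{in}(W):=\max_\prec\{L\in\mathbf T_{S_m}^{q}:U_L\cap W\ne\emptyset\}$ and $\mathbf{gin}(W):=\mathbf{in}(\mathcal O(W))$. $W$ is stable under $\mathrm{GL}$ if $g(W)=W$ for every $g\in\mathrm{GL}$. *)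

theory Defs
  imports
    "HOL-Library.Poly_Mapping"
    "HOL-Computational_Algebra.Polynomial"
    "HOL-Analysis.Cartesian_Space"
    "Jordan_Normal_Form.Determinant"
    "Jordan_Normal_Form.Matrix_Kernel"
begin

section \<open>The polynomial ring\<close>

text \<open>
  The indeterminates are indexed by a finite linearly ordered type, the \<open>n + 1\<close> elements of which
  play the role of \<open>0 < 1 < ... < n\<close>. A term is identified with its exponent function.
\<close>

type_synonym 'v mon = "'v \<Rightarrow>\<^sub>0 nat"
type_synonym ('v, 'a) mpol = "'v mon \<Rightarrow>\<^sub>0 'a"

definition mon_deg :: "('x \<Rightarrow>\<^sub>0 nat) \<Rightarrow> nat" where
  "mon_deg t = (\<Sum>x\<in>Poly_Mapping.keys t. Poly_Mapping.lookup t x)"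

definition monomial :: "'v mon \<Rightarrow> ('v, 'a::zero_neq_one) mpol" where
  "monomial t = Poly_Mapping.single t 1"

definition var_mon :: "'v \<Rightarrow> 'v mon" where
  "var_mon i = Poly_Mapping.single i 1"

definition const :: "'a::zero \<Rightarrow> ('v, 'a) mpol" where
  "const c = Poly_Mapping.single 0 c"

definition forms :: "nat \<Rightarrow> ('v, 'a::zero) mpol set" where
  "forms d = {f. \<forall>t\<in>Poly_Mapping.keys f. mon_deg t = d}"

global_interpretation mpv: vector_space
  "\<lambda>c (f :: ('v, 'a::field) mpol). const c * f"
  by unfold_locales
    (simp_all add: const_def algebra_simps single_add mult_single flip: mult.assoc)

definition mpol_eval ::
  "('a::zero \<Rightarrow> 'r::comm_semiring_1) \<Rightarrow> ('x \<Rightarrow> 'r) \<Rightarrow> (('x \<Rightarrow>\<^sub>0 nat) \<Rightarrow>\<^sub>0 'a) \<Rightarrow> 'r" where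
  "mpol_eval \<phi> x f = (\<Sum>t\<in>Poly_Mapping.keys f. \<phi> (Poly_Mapping.lookup f t) * (\<Prod>i\<in>Poly_Mapping.keys t. x i ^ Poly_Mapping.lookup t i))"


section \<open>Homogeneous ideals and Hilbert polynomials\<close>

definition gen_ideal :: "('v, 'a::field) mpol set \<Rightarrow> ('v, 'a) mpol set" where
  "gen_ideal B = Modules.module.span (*) B"

definition homogeneous_ideal :: "('v, 'a::field) mpol set \<Rightarrow> bool" where
  "homogeneous_ideal I \<longleftrightarrow> (\<exists>B. B \<subseteq> (\<Union>d. forms d) \<and> I = gen_ideal B)"

text \<open>
  For homogeneous \<open>I\<close> the degree \<open>t\<close> component of \<open>S/I\<close> is the quotient of \<open>forms t\<close> by \<open>I \<inter> forms t\<close>.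
\<close>

definition hilbert_function :: "('v::finite, 'a::field) mpol set \<Rightarrow> nat \<Rightarrow> nat" where
  "hilbert_function I t =
     mpv.dim (forms t :: ('v, 'a) mpol set) - mpv.dim (I \<inter> forms t)"

definition has_hilbert_polynomial :: "('v::finite, 'a::field) mpol set \<Rightarrow> rat poly \<Rightarrow> bool" where
  "has_hilbert_polynomial I p \<longleftrightarrow>
     (\<exists>N. \<forall>t\<ge>N. of_nat (hilbert_function I t) = poly p (of_nat t))"

text \<open>The saturation \<open>I : (x\<^sub>0, ..., x\<^sub>n)\<^sup>\<infinity>\<close>; the \<open>k\<close>-th power of the irrelevant ideal is generated by
  \<open>forms k\<close>.\<close>

definition saturation :: "('v, 'a::field) mpol set \<Rightarrow> ('v, 'a) mpol set" where
  "saturation I = {f. \<exists>k. \<forall>g\<in>forms k. g * f \<in> I}"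

text \<open>
  Closed subschemes of projective \<open>n\<close>-space over \<open>'a\<close> correspond bijectively to saturated
  homogeneous ideals; these are the ones with Hilbert polynomial \<open>p\<close>.
\<close>

definition saturated_ideals :: "rat poly \<Rightarrow> ('v::finite, 'a::field) mpol set set" where
  "saturated_ideals p =
     {I. homogeneous_ideal I \<and> saturation I = I \<and> has_hilbert_polynomial I p}"


section \<open>Castelnuovo-Mumford regularity and the Gotzmann number\<close>

text \<open>
  The minimal graded free resolution \<open>0 \<rightarrow> F\<^sub>n \<rightarrow> ... \<rightarrow> F\<^sub>1 \<rightarrow> F\<^sub>0 \<rightarrow> I \<rightarrow> 0\<close> of an ideal in \<open>n + 1\<close>
  variables, where \<open>F\<^sub>i\<close> is the direct sum of the \<open>S(-a i j)\<close> for \<open>j < b i\<close>. The map from \<open>F\<^sub>0\<close> to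
  \<open>I \<subseteq> S\<close> is the one-row matrix \<open>D 0\<close>, and \<open>D (i + 1)\<close> is the matrix of the map from \<open>F\<^sub>i\<^sub>+\<^sub>1\<close> to \<open>F\<^sub>i\<close>;
  matrices act on column vectors. Minimality means that the matrices
  \<open>D 1, D 2, ...\<close> have entries in the irrelevant ideal. By Hilbert's syzygy theorem the
  resolution has length at most \<open>n\<close>, that is, \<open>b i = 0\<close> for \<open>i > n\<close>.
\<close>

definition minimal_graded_free_resolution ::
  "('v::finite, 'a::field) mpol set \<Rightarrow> (nat \<Rightarrow> nat) \<Rightarrow> (nat \<Rightarrow> nat \<Rightarrow> nat)
     \<Rightarrow> (nat \<Rightarrow> ('v, 'a) mpol mat) \<Rightarrow> bool" where
  "minimal_graded_free_resolution I b a D \<longleftrightarrow>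
     D 0 \<in> carrier_mat 1 (b 0) \<and>
     (\<forall>i. D (Suc i) \<in> carrier_mat (b i) (b (Suc i))) \<and>
     (\<forall>i\<ge>CARD('v). b i = 0) \<and>
     (\<forall>j<b 0. D 0 $$ (0, j) \<in> forms (a 0 j)) \<and>
     (\<forall>i. \<forall>k<b i. \<forall>j<b (Suc i). D (Suc i) $$ (k, j) = 0 \<or>
        (a i k \<le> a (Suc i) j \<and> D (Suc i) $$ (k, j) \<in> forms (a (Suc i) j - a i k))) \<and>
     (\<forall>i. \<forall>k<b i. \<forall>j<b (Suc i). Poly_Mapping.lookup (D (Suc i) $$ (k, j)) 0 = 0) \<and>
     I = {vec_index (D 0 *\<^sub>v u) 0 | u. u \<in> carrier_vec (b 0)} \<and>
     (\<forall>i. mat_kernel (D i) = {D (Suc i) *\<^sub>v u | u. u \<in> carrier_vec (b (Suc i))})"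

definition regular :: "nat \<Rightarrow> ('v::finite, 'a::field) mpol set \<Rightarrow> bool" where
  "regular r I \<longleftrightarrow>
     (\<exists>b a D. minimal_graded_free_resolution I b a D \<and> (\<forall>i. \<forall>j<b i. a i j \<le> r + i))"

text \<open>
  To be applied to \<open>saturated_ideals p\<close>. Nonzero ideals of \<open>S\<close> have nonnegative regularity, so the
  restriction to natural numbers only fixes the convention that the zero ideal contributes \<open>0\<close>.
\<close>

definition is_gotzmann_number :: "('v::finite, 'a::field) mpol set set \<Rightarrow> nat \<Rightarrow> bool" where
  "is_gotzmann_number H r \<longleftrightarrow>
     (\<forall>I\<in>H. regular r I) \<and> (\<forall>s. (\<forall>I\<in>H. regular s I) \<longrightarrow> r \<le> s)"


section \<open>Term orders and exterior products of terms\<close>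

definition term_order :: "('v mon \<Rightarrow> 'v mon \<Rightarrow> bool) \<Rightarrow> bool" where
  "term_order lt \<longleftrightarrow> irreflp lt \<and> transp lt \<and> totalp lt \<and>
     (\<forall>t. t \<noteq> 0 \<longrightarrow> lt 0 t) \<and> (\<forall>s t u. lt s t \<longrightarrow> lt (s + u) (t + u))"

text \<open>The exterior product \<open>\<tau>\<^sub>1 \<and> ... \<and> \<tau>\<^sub>q\<close> with \<open>\<tau>\<^sub>1 \<succ> ... \<succ> \<tau>\<^sub>q\<close> is represented by the list of its factors.\<close>

definition wedges :: "('v mon \<Rightarrow> 'v mon \<Rightarrow> bool) \<Rightarrow> nat \<Rightarrow> nat \<Rightarrow> 'v mon list set" where
  "wedges lt q m =
     {L. length L = q \<and> (\<forall>t\<in>set L. mon_deg t = m) \<and> sorted_wrt (\<lambda>s t. lt t s) L}"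

definition wedge_less ::
  "('v mon \<Rightarrow> 'v mon \<Rightarrow> bool) \<Rightarrow> 'v mon list \<Rightarrow> 'v mon list \<Rightarrow> bool" where
  "wedge_less lt L M \<longleftrightarrow>
     (\<exists>j<length L. (\<forall>i<j. L ! i = M ! i) \<and> lt (L ! j) (M ! j))"

definition vs :: "'v mon list \<Rightarrow> ('v, 'a::field) mpol set" where
  "vs L = mpv.span (monomial ` set L)"


section \<open>Grassmannian, Pluecker coordinates and Hilbert scheme\<close>

definition grassmannian :: "nat \<Rightarrow> nat \<Rightarrow> ('v::finite, 'a::field) mpol set set" where
  "grassmannian q m = {V. mpv.subspace V \<and> V \<subseteq> forms m \<and> mpv.dim V = q}"

definition ordered_basis :: "('v, 'a::field) mpol list \<Rightarrow> ('v, 'a) mpol set \<Rightarrow> bool" where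
  "ordered_basis bs V \<longleftrightarrow>
     distinct bs \<and> mpv.independent (set bs) \<and> mpv.span (set bs) = V"

text \<open>The \<open>L\<close>-th Pluecker coordinate of the span of \<open>bs\<close>: up to a common nonzero factor it does not
  depend on the choice of the basis.\<close>

definition pluecker :: "('v, 'a::field) mpol list \<Rightarrow> 'v mon list \<Rightarrow> 'a" where
  "pluecker bs L =
     Determinant.det (Matrix.mat (length L) (length L) (\<lambda>(i, j). Poly_Mapping.lookup (bs ! i) (L ! j)))"

definition chart :: "nat \<Rightarrow> nat \<Rightarrow> 'v mon list \<Rightarrow> ('v::finite, 'a::field) mpol set set" where
  "chart q m L = {V \<in> grassmannian q m. \<exists>bs. ordered_basis bs V \<and> pluecker bs L \<noteq> 0}"

text \<open>The degree \<open>m\<close> component of the saturated ideal of the subscheme defined by \<open>I\<close>.\<close>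

definition hilb_point :: "nat \<Rightarrow> ('v, 'a::field) mpol set \<Rightarrow> ('v, 'a) mpol set" where
  "hilb_point m I = saturation I \<inter> forms m"

text \<open>
  The \<open>'a\<close>-valued points of the Hilbert scheme inside the Grassmannian. For \<open>m\<close> at least the Gotzmann
  number and \<open>q\<close> equal to \<open>dim S\<^sub>m - p(m)\<close>, every \<open>hilb_point m I\<close> below has dimension \<open>q\<close>.
\<close>

definition hilb :: "rat poly \<Rightarrow> nat \<Rightarrow> nat \<Rightarrow> ('v::finite, 'a::field) mpol set set" where
  "hilb p q m = grassmannian q m \<inter> hilb_point m ` saturated_ideals p"

text \<open>
  Let \<open>\<iota>\<close> embed the base field \<open>'k\<close> into a field \<open>'f\<close>. A closed subset of the Hilbert scheme over
  \<open>'k\<close> is represented by the set \<open>W\<close> of its \<open>'f\<close>-valued points, which is cut out by homogeneous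
  polynomials \<open>P\<close> in the Pluecker coordinates with coefficients in \<open>'k\<close>. For \<open>\<iota> = id\<close> these are the
  Zariski closed sets of \<open>'k\<close>-points; if \<open>'f\<close> is an algebraic closure of \<open>'k\<close>, they are in bijection
  with the closed subsets of the underlying topological space of the scheme.
\<close>

definition closed_in_hilb ::
  "('k::field \<Rightarrow> 'f::field) \<Rightarrow> ('v mon \<Rightarrow> 'v mon \<Rightarrow> bool) \<Rightarrow> rat poly \<Rightarrow> nat \<Rightarrow> nat
     \<Rightarrow> ('v::finite, 'f) mpol set set \<Rightarrow> bool" where
  "closed_in_hilb \<iota> lt p q m W \<longleftrightarrow>
     (\<exists>Z :: (('v mon list \<Rightarrow>\<^sub>0 nat) \<Rightarrow>\<^sub>0 'k) set.
        (\<forall>P\<in>Z. (\<exists>d. P \<in> forms d) \<and> (\<forall>s\<in>Poly_Mapping.keys P. Poly_Mapping.keys s \<subseteq> wedges lt q m)) \<and>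
        W = {V \<in> hilb p q m.
               \<forall>P\<in>Z. \<forall>bs. ordered_basis bs V \<longrightarrow> mpol_eval \<iota> (pluecker bs) P = 0})"

text \<open>The subspace of forms over \<open>'f\<close> obtained from one over \<open>'k\<close> by extension of scalars.\<close>

definition base_change ::
  "('k::field \<Rightarrow> 'f::field) \<Rightarrow> ('v, 'k) mpol set \<Rightarrow> ('v, 'f) mpol set" where
  "base_change \<iota> V = mpv.span (Poly_Mapping.map \<iota> ` V)"


section \<open>The action of the general linear group; initial and generic initial\<close>

definition gl_act ::
  "('k::field \<Rightarrow> 'f::field) \<Rightarrow> 'k ^ 'v ^ 'v \<Rightarrow> ('v::finite, 'f) mpol \<Rightarrow> ('v, 'f) mpol" where
  "gl_act \<iota> g f =
     mpol_eval const (\<lambda>i. \<Sum>j\<in>UNIV. const (\<iota> (vec_nth (vec_nth g i) j)) * monomial (var_mon j)) f"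

definition gl_orbit ::
  "('k::field \<Rightarrow> 'f::field) \<Rightarrow> ('v::finite, 'f) mpol set set \<Rightarrow> ('v, 'f) mpol set set" where
  "gl_orbit \<iota> W = {gl_act \<iota> g ` V | g V. invertible g \<and> V \<in> W}"

definition gl_stable ::
  "('k::field \<Rightarrow> 'f::field) \<Rightarrow> ('v::finite, 'f) mpol set set \<Rightarrow> bool" where
  "gl_stable \<iota> W \<longleftrightarrow>
     (\<forall>g :: 'k ^ 'v ^ 'v. invertible g \<longrightarrow> (\<lambda>V. gl_act \<iota> g ` V) ` W = W)"

definition initial ::
  "('v mon \<Rightarrow> 'v mon \<Rightarrow> bool) \<Rightarrow> nat \<Rightarrow> nat \<Rightarrow> ('v::finite, 'f::field) mpol set set
     \<Rightarrow> 'v mon list" where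
  "initial lt q m W =
     (let A = {L \<in> wedges lt q m. chart q m L \<inter> W \<noteq> {}}
      in THE L. L \<in> A \<and> (\<forall>M\<in>A. M \<noteq> L \<longrightarrow> wedge_less lt M L))"

definition generic_initial ::
  "('k::field \<Rightarrow> 'f::field) \<Rightarrow> ('v mon \<Rightarrow> 'v mon \<Rightarrow> bool) \<Rightarrow> nat \<Rightarrow> nat
     \<Rightarrow> ('v::finite, 'f) mpol set set \<Rightarrow> 'v mon list" where
  "generic_initial \<iota> lt q m W = initial lt q m (gl_orbit \<iota> W)"

end

theory Submission
  imports Defs "HOL-Library.Function_Algebras"
begin

text \<open>
  By definition \<open>in(W)\<close> is the list of initial monomials of some point \<open>V = I\<^sub>m\<close> of \<open>W\<close>. The
  saturation \<open>J\<close> of the initial ideal of \<open>I\<close> is a monomial ideal, hence defined over the base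
  field, and has the Hilbert polynomial of \<open>I\<close>; so the Gotzmann number bounds its regularity. Its
  graded free resolution shows that \<open>J\<close> is generated in degrees at most \<open>m\<close> and that its Hilbert
  function agrees with \<open>p\<close> from degree \<open>m\<close> on. Comparing dimensions, the initial monomials of \<open>V\<close>
  are exactly those of \<open>J\<^sub>m\<close>, and they generate the truncation of \<open>J\<close> in degrees at least \<open>m\<close>. For
  the generic initial part, apply this to the orbit of \<open>W\<close>. If \<open>W\<close> is stable, the limit of \<open>V\<close> under
  a suitable one-parameter subgroup of the torus is \<open>vs(in(W))\<close>, and since the base field is
  infinite the equations of \<open>W\<close> pass to this limit.
\<close>

section \<open>Monomials and monomial subspaces\<close>

text \<open>The points of \<open>W\<close> have coordinates in \<open>'f\<close>, whereas the
  Gotzmann number bounds the regularity of saturated ideals over \<open>'k\<close>, so nothing is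
  known about the regularity of the ideal \<open>I\<close> behind a point. Monomials bridge the two
  fields: a monomial ideal is a set of exponents, its Hilbert function does not see the
  coefficients, and it can be read over \<open>'k\<close>. The initial ideal itself need not be
  saturated, hence need not belong to the family bounded by \<open>r\<close>. Its saturation does,
  at the price of possibly being larger in degree \<open>m\<close>; the dimension count shows that
  this price is zero. The limit along the torus is never formed, and the weights are not chosen to
  represent the term order. They only separate exponents of bounded degree. An equation of
  \<open>W\<close>, evaluated along the torus orbit, is a polynomial in the parameter with
  infinitely many zeros, so all its coefficients vanish; the one belonging to the power of the
  initial wedge consists of a single term.\<close>

lemma lookup_const_mult [simp]:
  "Poly_Mapping.lookup (const c * f) t = c * Poly_Mapping.lookup f t"
  for f :: "('v, 'a::field) mpol"
  unfolding const_def mult_map_scale_conv_mult [symmetric]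
  by (simp add: Poly_Mapping.map.rep_eq when_def)

lemma lookup_monomial [simp]: "Poly_Mapping.lookup (monomial s) t = (if s = t then 1 else 0)"
  by (simp add: monomial_def lookup_single when_def)

lemma keys_monomial [simp]: "Poly_Mapping.keys (monomial s) = {s}"
  by (simp add: monomial_def)

lemma inj_monomial: "inj (monomial :: 'v mon \<Rightarrow> ('v, 'a::zero_neq_one) mpol)"
proof (rule injI)
  fix s t :: "'v mon"
  assume "monomial s = (monomial t :: ('v, 'a) mpol)"
  then have "Poly_Mapping.keys (monomial s :: ('v, 'a) mpol) = Poly_Mapping.keys (monomial t :: ('v, 'a) mpol)"
    by simp
  then show "s = t"
    by simp
qed

lemma mpol_expansion:
  fixes f :: "('v, 'a::field) mpol"
  assumes "finite A" "Poly_Mapping.keys f \<subseteq> A"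
  shows "f = (\<Sum>t\<in>A. const (Poly_Mapping.lookup f t) * monomial t)"
proof (rule poly_mapping_eqI)
  fix s
  show "Poly_Mapping.lookup f s =
      Poly_Mapping.lookup (\<Sum>t\<in>A. const (Poly_Mapping.lookup f t) * monomial t) s"
    using assms by (cases "s \<in> A") (auto simp: lookup_sum in_keys_iff if_distrib cong: if_cong)
qed

lemma lookup_monomial_mult [simp]:
  "Poly_Mapping.lookup (monomial u * f) (u + s) = Poly_Mapping.lookup f s"
  for f :: "('v, 'a::field) mpol"
proof -
  have "monomial u * f =
      (\<Sum>t\<in>Poly_Mapping.keys f. const (Poly_Mapping.lookup f t) * monomial (u + t))"
    by (subst mpol_expansion [of "Poly_Mapping.keys f" f])
      (simp_all add: sum_distrib_left const_def monomial_def mult_single)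
  then show ?thesis
    by (auto simp: lookup_sum in_keys_iff if_distrib cong: if_cong)
qed

lemma keys_mult_subset:
  "Poly_Mapping.keys (f * g) \<subseteq> {s + t | s t. s \<in> Poly_Mapping.keys f \<and> t \<in> Poly_Mapping.keys g}"
  using keys_mult [of f g] by blast

lemma keys_monomial_mult: "Poly_Mapping.keys (monomial u * f) = (+) u ` Poly_Mapping.keys f"
  for f :: "('v, 'a::field) mpol"
proof
  show "Poly_Mapping.keys (monomial u * f) \<subseteq> (+) u ` Poly_Mapping.keys f"
    using keys_mult_subset [of "monomial u" f] by auto
  show "(+) u ` Poly_Mapping.keys f \<subseteq> Poly_Mapping.keys (monomial u * f)"
    by (auto simp: in_keys_iff)
qed

lemma mon_deg_superset:
  assumes "finite A" "Poly_Mapping.keys t \<subseteq> A"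
  shows "mon_deg t = (\<Sum>x\<in>A. Poly_Mapping.lookup t x)"
  unfolding mon_deg_def using assms by (intro sum.mono_neutral_left) (auto simp: in_keys_iff)

lemma mon_deg_add [simp]: "mon_deg (s + t) = mon_deg s + mon_deg t"
proof -
  let ?A = "Poly_Mapping.keys s \<union> Poly_Mapping.keys t"
  have "mon_deg (s + t) = (\<Sum>x\<in>?A. Poly_Mapping.lookup (s + t) x)"
    using Poly_Mapping.keys_add [of s t] by (intro mon_deg_superset) auto
  then show ?thesis
    by (simp add: lookup_add sum.distrib mon_deg_superset [of ?A s] mon_deg_superset [of ?A t])
qed

lemma mon_deg_zero [simp]: "mon_deg 0 = 0"
  by (simp add: mon_deg_def)

lemma mon_deg_UNIV: "mon_deg t = (\<Sum>x\<in>UNIV. Poly_Mapping.lookup t x)"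
  for t :: "'v::finite mon"
  by (rule mon_deg_superset) auto

lemma mon_deg_var_mon [simp]: "mon_deg (var_mon i) = 1"
  by (simp add: mon_deg_def var_mon_def)

text \<open>Graded pieces, monomial ideals and the spaces \<open>vs L\<close> all have this shape,
  so that dimensions and intersections reduce to counting exponents, whatever the coefficient
  field.\<close>

definition supported :: "'v mon set \<Rightarrow> ('v, 'a::zero) mpol set" where
  "supported U = {f. Poly_Mapping.keys f \<subseteq> U}"

abbreviation deg_mons :: "nat \<Rightarrow> 'v mon set" where
  "deg_mons d \<equiv> {t. mon_deg t = d}"

lemma forms_eq: "forms d = supported (deg_mons d)"
  by (auto simp: forms_def supported_def)

lemma supported_Int: "supported U \<inter> supported V = supported (U \<inter> V)"
  by (auto simp: supported_def)

lemma subspace_supported: "mpv.subspace (supported U :: ('v, 'a::field) mpol set)"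
  unfolding mpv.subspace_def supported_def mem_Collect_eq
  by (auto simp: subset_iff in_keys_iff lookup_add) (metis add_0)

lemma supported_eq_span: "supported U = mpv.span (monomial ` U)"
  for U :: "'v mon set"
proof
  show "supported U \<subseteq> (mpv.span (monomial ` U) :: ('v, 'a::field) mpol set)"
  proof
    fix f :: "('v, 'a) mpol"
    assume f: "f \<in> supported U"
    have "(\<Sum>t\<in>Poly_Mapping.keys f. const (Poly_Mapping.lookup f t) * monomial t)
        \<in> mpv.span (monomial ` U)"
      by (intro mpv.span_sum mpv.span_scale mpv.span_base) (use f in \<open>auto simp: supported_def\<close>)
    then show "f \<in> mpv.span (monomial ` U)"
      using mpol_expansion [of "Poly_Mapping.keys f" f] by simp
  qed
  show "(mpv.span (monomial ` U) :: ('v, 'a::field) mpol set) \<subseteq> supported U"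
    by (intro mpv.span_minimal subspace_supported) (auto simp: supported_def)
qed

lemma independent_monomials: "mpv.independent (monomial ` U :: ('v, 'a::field) mpol set)"
proof
  assume "mpv.dependent (monomial ` U :: ('v, 'a) mpol set)"
  then obtain u where u: "u \<in> U"
    "monomial u \<in> mpv.span (monomial ` U - {monomial u} :: ('v, 'a) mpol set)"
    unfolding mpv.dependent_def by blast
  have "monomial ` U - {monomial u} = (monomial ` (U - {u}) :: ('v, 'a) mpol set)"
    by (simp add: image_set_diff [OF inj_monomial])
  with u have "monomial u \<in> (supported (U - {u}) :: ('v, 'a) mpol set)"
    by (simp add: supported_eq_span)
  then show False
    by (simp add: supported_def)
qed

text \<open>For infinite \<open>U\<close> both sides are 0, by the conventions for
  \<open>card\<close> and \<open>dim\<close>.\<close>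

lemma dim_supported: "mpv.dim (supported U :: ('v, 'a::field) mpol set) = card U"
proof -
  have "mpv.dim (supported U :: ('v, 'a) mpol set) = card (monomial ` U :: ('v, 'a) mpol set)"
    by (subst supported_eq_span) (rule mpv.dim_span_eq_card_independent [OF independent_monomials])
  also have "\<dots> = card U"
    by (rule card_image) (rule inj_on_subset [OF inj_monomial subset_UNIV])
  finally show ?thesis .
qed

text \<open>Stars and bars: once the variables are enumerated, exponent functions become lists with
  a prescribed length and sum, which \<open>card_length_sum_list\<close> counts.\<close>

lemma bij_betw_lists_deg_mons:
  fixes xs :: "'v::finite list"
  assumes "distinct xs" "set xs = UNIV"
  shows "bij_betw (\<lambda>t. map (Poly_Mapping.lookup t) xs) (deg_mons d)
     {l. length l = CARD('v) \<and> sum_list l = d}"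
proof (rule bij_betwI')
  fix s t :: "'v mon"
  show "(map (Poly_Mapping.lookup s) xs = map (Poly_Mapping.lookup t) xs) = (s = t)"
    using assms by (auto intro: poly_mapping_eqI)
next
  fix t :: "'v mon"
  assume "t \<in> deg_mons d"
  moreover have "length xs = CARD('v)"
    using assms distinct_card by metis
  moreover have "sum_list (map (Poly_Mapping.lookup t) xs) = mon_deg t"
    using assms by (simp add: sum_list_distinct_conv_sum_set mon_deg_UNIV)
  ultimately show "map (Poly_Mapping.lookup t) xs \<in> {l. length l = CARD('v) \<and> sum_list l = d}"
    by simp
next
  fix l :: "nat list"
  assume l: "l \<in> {l. length l = CARD('v) \<and> sum_list l = d}"
  have len: "length xs = CARD('v)"
    using assms distinct_card by metis
  \<comment> \<open>Inverse of the enumeration: the value at a variable is the entry of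
    \<open>l\<close> at the position of that variable in \<open>xs\<close>.\<close>
  define h where "h x = (THE y. (x, y) \<in> set (zip xs l))" for x
  have h: "h (xs ! i) = l ! i" if "i < length xs" for i
    unfolding h_def
  proof (rule the_equality)
    show "(xs ! i, l ! i) \<in> set (zip xs l)"
      using that l len by (auto simp: set_zip)
    show "y = l ! i" if "(xs ! i, y) \<in> set (zip xs l)" for y
      using that \<open>i < length xs\<close> assms(1) by (auto simp: set_zip nth_eq_iff_index_eq)
  qed
  define t where "t = Abs_poly_mapping h"
  have "Poly_Mapping.lookup t = h"
    unfolding t_def by (rule lookup_Abs_poly_mapping) simp
  then have map: "map (Poly_Mapping.lookup t) xs = l"
    using l len h by (intro nth_equalityI) auto
  moreover have "mon_deg t = d"
    using assms l map sum_list_distinct_conv_sum_set [of xs "Poly_Mapping.lookup t"]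
    by (simp add: mon_deg_UNIV)
  ultimately show "\<exists>t\<in>deg_mons d. l = map (Poly_Mapping.lookup t) xs"
    by auto
qed

lemma card_deg_mons: "card (deg_mons d :: 'v::finite mon set) = (d + CARD('v) - 1) choose d"
proof -
  obtain xs :: "'v list" where xs: "set xs = UNIV" "distinct xs"
    using finite_distinct_list [of "UNIV :: 'v set"] by auto
  have "card (deg_mons d :: 'v mon set) = card {l :: nat list. length l = CARD('v) \<and> sum_list l = d}"
    by (rule bij_betw_same_card [OF bij_betw_lists_deg_mons [OF xs(2,1)]])
  then show ?thesis
    by (simp only: card_length_sum_list)
qed

text \<open>The count just obtained is positive, whereas an infinite set has \<open>card\<close>
  0.\<close>

lemma finite_deg_mons [simp]: "finite (deg_mons d :: 'v::finite mon set)"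
proof -
  have "(d + CARD('v) - 1) choose d > 0"
    using zero_less_card_finite [where 'a = 'v] by (intro zero_less_binomial) linarith
  then show ?thesis
    by (metis card_deg_mons card.infinite less_irrefl)
qed

text \<open>Peeling off one variable at a time. This lets a condition on the monomials of one degree
  reach all higher degrees.\<close>

lemma mon_split:
  fixes t :: "'v::finite mon"
  assumes "mon_deg t = a + b"
  obtains u v where "t = u + v" "mon_deg u = a" "mon_deg v = b"
proof -
  have "\<exists>u v. t = u + v \<and> mon_deg u = a \<and> mon_deg v = b" using assms
  proof (induction a arbitrary: t)
    case 0
    then show ?case by (metis add_0 mon_deg_zero)
  next
    case (Suc a)
    then obtain x where x: "Poly_Mapping.lookup t x \<noteq> 0"
      by (metis Zero_not_Suc add_Suc mon_deg_UNIV sum.neutral)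
    define t' where "t' = t - var_mon x"
    have t: "t = var_mon x + t'"
      unfolding t'_def var_mon_def using x
      by (intro poly_mapping_eqI) (auto simp: lookup_add lookup_minus lookup_single when_def)
    with Suc.prems have "mon_deg t' = a + b"
      by simp
    with Suc.IH obtain u v where "t' = u + v" "mon_deg u = a" "mon_deg v = b"
      by blast
    with t show ?case
      by (intro exI [of _ "var_mon x + u"] exI [of _ v]) (simp add: ac_simps)
  qed
  then show thesis using that by blast
qed

section \<open>Dickson's lemma\<close>

lemma dickson_subsequence:
  fixes s :: "nat \<Rightarrow> 'v::finite mon"
  shows "\<exists>f :: nat \<Rightarrow> nat. strict_mono f \<and>
           (\<forall>x\<in>A. mono (\<lambda>i. Poly_Mapping.lookup (s (f i)) x))"
proof (induction A rule: infinite_finite_induct)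
  case (insert x A)
  then obtain f :: "nat \<Rightarrow> nat"
    where f: "strict_mono f" "\<forall>x\<in>A. mono (\<lambda>i. Poly_Mapping.lookup (s (f i)) x)"
    by blast
  have "\<exists>g :: nat \<Rightarrow> nat. strict_mono g \<and> mono (\<lambda>i. Poly_Mapping.lookup (s (f (g i))) x)"
  proof -
    define a where "a i = Poly_Mapping.lookup (s (f i)) x" for i
    \<comment> \<open>\<open>h\<close> is a position after \<open>k\<close> at which
      \<open>a\<close> is smallest among all later positions; iterating this choice produces a
      nondecreasing subsequence.\<close>
    have "\<exists>h. h > k \<and> (\<forall>j>h. a h \<le> a j)" for k
    proof -
      have "arg_min a (\<lambda>i. i > k) > k \<and> (\<forall>j>k. a (arg_min a (\<lambda>i. i > k)) \<le> a j)"
        using arg_min_nat_lemma [of "\<lambda>i. i > k" "Suc k" a] by auto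
      then show ?thesis
        by (intro exI [of _ "arg_min a (\<lambda>i. i > k)"]) auto
    qed
    then obtain h where h: "\<And>k. h k > k" "\<And>k j. j > h k \<Longrightarrow> a (h k) \<le> a j"
      by metis
    define g where "g i = (h ^^ Suc i) 0" for i
    have g: "strict_mono g"
      unfolding g_def by (intro strict_mono_Suc_iff [THEN iffD2]) (simp add: h(1))
    moreover have "a (g i) \<le> a (g (Suc i))" for i
      using h(2) [of "(h ^^ i) 0" "g (Suc i)"] h(1) [of "g i"] by (simp add: g_def)
    ultimately show ?thesis
      unfolding a_def using lift_Suc_mono_le [of "\<lambda>i. a (g i)"]
      by (intro exI [of _ g]) (auto simp: mono_def a_def)
  qed
  then obtain g :: "nat \<Rightarrow> nat"
    where g: "strict_mono g" "mono (\<lambda>i. Poly_Mapping.lookup (s (f (g i))) x)"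
    by blast
  have "mono (\<lambda>i. Poly_Mapping.lookup (s (f (g i))) y)" if "y \<in> A" for y
    using f(2) that g(1) by (auto simp: mono_def strict_mono_less_eq)
  with f g show ?case
    by (intro exI [of _ "f \<circ> g"]) (auto intro: strict_mono_compose simp: strict_mono_o)
qed (auto intro: exI [of _ id] simp: strict_mono_def)

text \<open>\<open>B\<close> consists of the elements that are minimal for divisibility. An infinite
  \<open>B\<close> would contain a sequence of distinct elements, and a subsequence monotone in
  every exponent exhibits one of them dividing another.\<close>

lemma dickson:
  fixes U :: "'v::finite mon set"
  obtains B where "finite B" "B \<subseteq> U" "\<And>u. u \<in> U \<Longrightarrow> \<exists>b\<in>B. \<exists>v. u = b + v"
proof -
  define B where "B = {u \<in> U. \<forall>b\<in>U. \<forall>v. u = b + v \<longrightarrow> b = u}"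
  have "finite B"
  proof (rule ccontr)
    assume "infinite B"
    then obtain s :: "nat \<Rightarrow> 'v mon" where s: "inj s" "range s \<subseteq> B"
      using infinite_countable_subset by blast
    obtain f :: "nat \<Rightarrow> nat"
      where f: "strict_mono f" "\<And>x. mono (\<lambda>i. Poly_Mapping.lookup (s (f i)) x)"
      using dickson_subsequence [of UNIV s] by auto
    have le: "Poly_Mapping.lookup (s (f 0)) x \<le> Poly_Mapping.lookup (s (f 1)) x" for x
      using f(2) [of x] by (simp add: mono_def)
    have "s (f 1) = s (f 0) + (s (f 1) - s (f 0))"
      by (intro poly_mapping_eqI) (use le in \<open>simp add: lookup_add lookup_minus\<close>)
    then have "s (f 0) = s (f 1)"
      using s(2) unfolding B_def by blast
    then have "f 0 = f 1"
      using s(1) by (simp add: inj_eq)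
    then show False
      using f(1) by (metis zero_neq_one strict_mono_eq)
  qed
  moreover have "\<exists>b\<in>B. \<exists>v. u = b + v" if "u \<in> U" for u
    using that
  proof (induction "mon_deg u" arbitrary: u rule: less_induct)
    case less
    show ?case
    proof (cases "u \<in> B")
      case True
      then show ?thesis by (metis add.right_neutral)
    next
      case False
      with less.prems obtain b v where b: "b \<in> U" "u = b + v" "b \<noteq> u"
        unfolding B_def by auto
      \<comment> \<open>A proper divisor has smaller degree, so the induction on the degree reaches
        a minimal one.\<close>
      have "mon_deg v \<noteq> 0"
      proof
        assume "mon_deg v = 0"
        then have "v = 0"
          by (intro poly_mapping_eqI) (simp add: mon_deg_UNIV)
        with b show False by simp
      qed
      with b(2) have "mon_deg b < mon_deg u"
        by simp
      from less.hyps [OF this b(1)] b(2) show ?thesis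
        by (metis add.assoc)
    qed
  qed
  ultimately show thesis
    using that [of B] by (auto simp: B_def)
qed

section \<open>Monomial ideals, saturation and leading monomials\<close>

text \<open>Ideals are the submodules of the ring over itself. In this instance
  \<open>idl.scale_scale\<close> is associativity read from right to left, which would loop with
  \<open>mult.assoc\<close>.\<close>

global_interpretation idl: Modules.module "(*) :: ('v, 'a::field) mpol \<Rightarrow> ('v, 'a) mpol \<Rightarrow> ('v, 'a) mpol"
  by unfold_locales (simp_all add: algebra_simps)

declare idl.scale_scale [simp del]

definition upset :: "'v mon set \<Rightarrow> bool" where
  "upset U \<longleftrightarrow> (\<forall>u\<in>U. \<forall>w. u + w \<in> U)"

definition upclosure :: "'v mon set \<Rightarrow> 'v mon set" where
  "upclosure U = {u + w | u w. u \<in> U}"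

text \<open>Exponents of the saturation of a monomial ideal: the power of the irrelevant ideal is
  tested on monomials only, which \<open>saturation_supported\<close> justifies.\<close>

definition satset :: "'v mon set \<Rightarrow> 'v mon set" where
  "satset U = {s. \<exists>k. \<forall>u. mon_deg u = k \<longrightarrow> u + s \<in> U}"

lemma upset_upclosure: "upset (upclosure U)"
  unfolding upset_def
proof safe
  fix t w assume "t \<in> upclosure U"
  then obtain u v where "u \<in> U" "t = u + v"
    unfolding upclosure_def by blast
  then show "t + w \<in> upclosure U"
    unfolding upclosure_def by (auto simp: add.assoc)
qed

lemma supported_mono: "U \<subseteq> V \<Longrightarrow> supported U \<subseteq> supported V"
  by (auto simp: supported_def)

lemma ideal_supported:
  assumes "upset U"
  shows "idl.subspace (supported U :: ('v, 'a::field) mpol set)"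
proof (rule idl.subspaceI)
  show "0 \<in> (supported U :: ('v, 'a) mpol set)"
    by (simp add: supported_def)
  show "f + g \<in> supported U" if "f \<in> supported U" "g \<in> supported U" for f g :: "('v, 'a) mpol"
    using that by (rule mpv.subspace_add [OF subspace_supported])
  show "c * f \<in> supported U" if f: "f \<in> supported U" for c f :: "('v, 'a) mpol"
    unfolding supported_def
  proof safe
    fix x assume "x \<in> Poly_Mapping.keys (c * f)"
    then obtain s t where "x = s + t" "t \<in> Poly_Mapping.keys f"
      using keys_mult_subset [of c f] by blast
    with f assms show "x \<in> U"
      by (auto simp: supported_def upset_def add.commute [of s])
  qed
qed

lemma ideal_subspace:
  assumes "idl.subspace I"
  shows "mpv.subspace I"
proof (rule mpv.subspaceI)
  show "0 \<in> I"
    by (rule idl.subspace_0 [OF assms])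
  show "f + g \<in> I" if "f \<in> I" "g \<in> I" for f g
    using that by (rule idl.subspace_add [OF assms])
  show "const c * f \<in> I" if "f \<in> I" for c f
    using that by (rule idl.subspace_scale [OF assms])
qed

lemma ideal_gen_ideal: "idl.subspace (gen_ideal B)"
  by (simp add: gen_ideal_def idl.subspace_span)

lemma gen_ideal_superset: "B \<subseteq> gen_ideal B"
  by (simp add: gen_ideal_def idl.span_superset)

lemma gen_ideal_minimal: "B \<subseteq> I \<Longrightarrow> idl.subspace I \<Longrightarrow> gen_ideal B \<subseteq> I"
  by (simp add: gen_ideal_def idl.span_minimal)

lemma gen_ideal_span: "gen_ideal (mpv.span B) = gen_ideal B"
proof
  show "gen_ideal (mpv.span B) \<subseteq> gen_ideal B"
    by (intro gen_ideal_minimal mpv.span_minimal ideal_subspace ideal_gen_ideal gen_ideal_superset)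
  show "gen_ideal B \<subseteq> gen_ideal (mpv.span B)"
    by (intro gen_ideal_minimal ideal_gen_ideal order_trans [OF mpv.span_superset gen_ideal_superset])
qed

lemma gen_ideal_monomials:
  "gen_ideal (monomial ` U) = (supported (upclosure U) :: ('v, 'a::field) mpol set)"
proof
  have "U \<subseteq> upclosure U"
    unfolding upclosure_def by (force intro: add.right_neutral [symmetric])
  then show "gen_ideal (monomial ` U) \<subseteq> (supported (upclosure U) :: ('v, 'a) mpol set)"
    by (intro gen_ideal_minimal ideal_supported upset_upclosure) (auto simp: supported_def)
  have "monomial (u + w) \<in> (gen_ideal (monomial ` U) :: ('v, 'a) mpol set)" if "u \<in> U" for u w
  proof -
    have "monomial w * monomial u \<in> (gen_ideal (monomial ` U) :: ('v, 'a) mpol set)"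
      using that gen_ideal_superset by (intro idl.subspace_scale [OF ideal_gen_ideal]) blast
    then show ?thesis
      by (simp add: monomial_def mult_single add.commute)
  qed
  then show "(supported (upclosure U) :: ('v, 'a) mpol set) \<subseteq> gen_ideal (monomial ` U)"
    unfolding supported_eq_span
    by (intro mpv.span_minimal ideal_subspace ideal_gen_ideal) (auto simp: upclosure_def)
qed

lemma homogeneous_ideal_supported:
  assumes "upset U"
  shows "homogeneous_ideal (supported U :: ('v, 'a::field) mpol set)"
  unfolding homogeneous_ideal_def
proof (intro exI conjI)
  show "monomial ` U \<subseteq> (\<Union>d. forms d :: ('v, 'a) mpol set)"
    by (auto simp: forms_def)
  have "upclosure U = U"
    using assms unfolding upclosure_def upset_def by (force intro: add.right_neutral [symmetric])
  then show "supported U = (gen_ideal (monomial ` U) :: ('v, 'a) mpol set)"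
    by (simp add: gen_ideal_monomials)
qed

text \<open>A monomial of degree at least \<open>k\<close> has a divisor of degree \<open>k\<close>.
  Different saturation exponents can thus be replaced by a common larger one.\<close>

lemma satset_mono_exp:
  fixes U :: "'v::finite mon set"
  assumes "upset U" "\<forall>u. mon_deg u = k \<longrightarrow> u + s \<in> U" "k \<le> mon_deg u"
  shows "u + s \<in> U"
proof -
  obtain v w where "u = v + w" "mon_deg v = k"
    using mon_split [of u k "mon_deg u - k"] assms(3) by auto
  with assms(1,2) have "(v + s) + w \<in> U"
    unfolding upset_def by blast
  with \<open>u = v + w\<close> show ?thesis
    by (simp add: ac_simps)
qed

lemma subset_satset: "U \<subseteq> satset U"
proof
  fix s assume "s \<in> U"
  have "u + s \<in> U" if "mon_deg u = 0" for u :: "'a mon"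
  proof -
    have "u = 0"
      using that by (intro poly_mapping_eqI) (auto simp: mon_deg_def in_keys_iff)
    with \<open>s \<in> U\<close> show ?thesis by simp
  qed
  then show "s \<in> satset U"
    unfolding satset_def by blast
qed

lemma upset_satset:
  assumes "upset U"
  shows "upset (satset U)"
  unfolding upset_def
proof safe
  fix s w assume "s \<in> satset U"
  then obtain k where "\<And>u. mon_deg u = k \<Longrightarrow> u + s \<in> U"
    unfolding satset_def by blast
  with assms have "\<forall>u. mon_deg u = k \<longrightarrow> u + (s + w) \<in> U"
    unfolding upset_def by (simp add: add.assoc [symmetric])
  then show "s + w \<in> satset U"
    unfolding satset_def by blast
qed

lemma satset_idem:
  fixes U :: "'v::finite mon set"
  assumes "upset U"
  shows "satset (satset U) = satset U"
proof
  show "satset (satset U) \<subseteq> satset U"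
  proof
    fix s assume "s \<in> satset (satset U)"
    then obtain k where "\<forall>u. mon_deg u = k \<longrightarrow> u + s \<in> satset U"
      unfolding satset_def by blast
    then have "\<forall>u. \<exists>l. mon_deg u = k \<longrightarrow> (\<forall>v. mon_deg v = l \<longrightarrow> v + (u + s) \<in> U)"
      unfolding satset_def by blast
    then obtain l where l: "\<And>u v. mon_deg u = k \<Longrightarrow> mon_deg v = l u \<Longrightarrow> v + (u + s) \<in> U"
      by metis
    \<comment> \<open>The exponent \<open>l u\<close> depends on \<open>u\<close>, but only finitely
      many monomials have degree \<open>k\<close>, so a maximum serves all of them.\<close>
    define M where "M = Max (l ` deg_mons k)"
    have "w + s \<in> U" if deg: "mon_deg w = M + k" for w
    proof -
      obtain v u where w: "w = v + u" "mon_deg v = M" "mon_deg u = k"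
        using mon_split [OF deg] by blast
      have "l u \<le> M"
        unfolding M_def using w(3) by (intro Max_ge) auto
      then have "v + (u + s) \<in> U"
        using w l by (intro satset_mono_exp [OF assms, of "l u"]) auto
      with w show ?thesis by (simp add: add.assoc)
    qed
    then show "s \<in> satset U"
      unfolding satset_def by blast
  qed
qed (rule subset_satset)

text \<open>Raising the exponent by \<open>m\<close> pushes every product into degree at least
  \<open>m\<close>. This matters because the ideal generated by forms of degree \<open>m\<close>
  will only be a truncation of a saturated ideal.\<close>

lemma satset_upset_Int_deg:
  fixes U :: "'v::finite mon set"
  assumes "upset U"
  shows "satset (U \<inter> {t. m \<le> mon_deg t}) = satset U"
proof
  show "satset (U \<inter> {t. m \<le> mon_deg t}) \<subseteq> satset U"
    unfolding satset_def by blast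
  show "satset U \<subseteq> satset (U \<inter> {t. m \<le> mon_deg t})"
  proof
    fix s assume "s \<in> satset U"
    then obtain k where k: "\<forall>u. mon_deg u = k \<longrightarrow> u + s \<in> U"
      unfolding satset_def by blast
    have "u + s \<in> U \<inter> {t. m \<le> mon_deg t}" if "mon_deg u = k + m" for u
      using that satset_mono_exp [OF assms k, of u] by simp
    then show "s \<in> satset (U \<inter> {t. m \<le> mon_deg t})"
      unfolding satset_def by blast
  qed
qed

text \<open>By Dickson's lemma only finitely many exponents are needed to saturate.\<close>

lemma satset_eventually:
  fixes U :: "'v::finite mon set"
  assumes "upset U"
  obtains N where "\<And>t. t \<ge> N \<Longrightarrow> satset U \<inter> deg_mons t = U \<inter> deg_mons t"
proof -
  obtain B where B: "finite B" "B \<subseteq> satset U" "\<And>u. u \<in> satset U \<Longrightarrow> \<exists>b\<in>B. \<exists>v. u = b + v"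
    by (rule dickson [of "satset U"]) blast
  have "\<forall>b\<in>B. \<exists>k. \<forall>u. mon_deg u = k \<longrightarrow> u + b \<in> U"
    using B(2) unfolding satset_def by blast
  then obtain k where k: "\<And>b. b \<in> B \<Longrightarrow> \<forall>u. mon_deg u = k b \<longrightarrow> u + b \<in> U"
    by metis
  \<comment> \<open>A crude common bound for all \<open>mon_deg b + k b\<close>: in degree at least
    \<open>N\<close> the cofactor of \<open>b\<close> has degree at least
    \<open>k b\<close>.\<close>
  define N where "N = (\<Sum>b\<in>B. mon_deg b + k b)"
  have "s \<in> U" if s: "s \<in> satset U" "mon_deg s \<ge> N" for s
  proof -
    obtain b v where b: "b \<in> B" "s = b + v"
      using B(3) s(1) by blast
    have "mon_deg b + k b \<le> N"
      unfolding N_def using B(1) b(1) by (rule member_le_sum [rotated 2]) auto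
    with s(2) b(2) have "k b \<le> mon_deg v"
      by simp
    then have "v + b \<in> U"
      using satset_mono_exp [OF assms k] b(1) by blast
    with b(2) show ?thesis by (simp add: add.commute)
  qed
  then have "satset U \<inter> deg_mons t = U \<inter> deg_mons t" if "t \<ge> N" for t
    using that subset_satset by auto
  with that show thesis by blast
qed

text \<open>From left to right, multiply by monomials only; conversely, the finitely many terms of
  \<open>f\<close> have a common exponent \<open>N\<close>.\<close>

lemma saturation_supported:
  fixes U :: "'v::finite mon set"
  assumes "upset U"
  shows "saturation (supported U) = (supported (satset U) :: ('v, 'a::field) mpol set)"
proof (intro Set.set_eqI iffI)
  fix f :: "('v, 'a) mpol"
  assume "f \<in> saturation (supported U)"
  then obtain k where k: "\<And>g. g \<in> forms k \<Longrightarrow> g * f \<in> supported U"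
    unfolding saturation_def by blast
  have "u + s \<in> U" if "s \<in> Poly_Mapping.keys f" "mon_deg u = k" for u s
  proof -
    have "monomial u * f \<in> supported U"
      using that(2) by (intro k) (simp add: forms_def)
    then show ?thesis
      using that(1) by (auto simp: supported_def keys_monomial_mult)
  qed
  then show "f \<in> supported (satset U)"
    unfolding supported_def satset_def by blast
next
  fix f :: "('v, 'a) mpol"
  assume "f \<in> supported (satset U)"
  then have "\<forall>s\<in>Poly_Mapping.keys f. \<exists>k. \<forall>u. mon_deg u = k \<longrightarrow> u + s \<in> U"
    unfolding supported_def satset_def by blast
  then obtain k where k: "\<And>s. s \<in> Poly_Mapping.keys f \<Longrightarrow> \<forall>u. mon_deg u = k s \<longrightarrow> u + s \<in> U"
    by metis
  define N where "N = (\<Sum>s\<in>Poly_Mapping.keys f. k s)"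
  have "g * f \<in> supported U" if "g \<in> forms N" for g
    unfolding supported_def
  proof safe
    fix x assume "x \<in> Poly_Mapping.keys (g * f)"
    then obtain u s where us: "x = u + s" "u \<in> Poly_Mapping.keys g" "s \<in> Poly_Mapping.keys f"
      using keys_mult_subset by blast
    have "k s \<le> N"
      unfolding N_def using us(3) by (intro member_le_sum) auto
    moreover have "mon_deg u = N"
      using that us(2) by (auto simp: forms_def)
    ultimately show "x \<in> U"
      using satset_mono_exp [OF assms k [OF us(3)]] us(1) by simp
  qed
  then show "f \<in> saturation (supported U)"
    unfolding saturation_def by blast
qed

lemma dim_forms: "mpv.dim (forms t :: ('v::finite, 'a::field) mpol set) = card (deg_mons t :: 'v mon set)"
  by (simp add: forms_eq dim_supported)

text \<open>The right-hand side does not mention \<open>'a\<close>: a monomial ideal can exchange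
  its coefficient field for another one without changing its Hilbert function.\<close>

lemma hilbert_function_supported:
  "hilbert_function (supported U :: ('v::finite, 'a::field) mpol set) t =
     card (deg_mons t :: 'v mon set) - card (U \<inter> deg_mons t)"
  unfolding hilbert_function_def dim_forms forms_eq supported_Int dim_supported ..

section \<open>Leading monomials and echelon bases\<close>

definition is_lm :: "('v mon \<Rightarrow> 'v mon \<Rightarrow> bool) \<Rightarrow> ('v, 'a::zero) mpol \<Rightarrow> 'v mon \<Rightarrow> bool" where
  "is_lm lt f s \<longleftrightarrow> s \<in> Poly_Mapping.keys f \<and> (\<forall>t\<in>Poly_Mapping.keys f. t \<noteq> s \<longrightarrow> lt t s)"

definition lms :: "('v mon \<Rightarrow> 'v mon \<Rightarrow> bool) \<Rightarrow> ('v, 'a::zero) mpol set \<Rightarrow> 'v mon set" where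
  "lms lt V = {s. \<exists>f\<in>V. is_lm lt f s}"

lemma term_orderD:
  assumes "term_order lt"
  shows term_order_irrefl: "\<not> lt s s"
    and term_order_trans: "lt s t \<Longrightarrow> lt t u \<Longrightarrow> lt s u"
    and term_order_total: "s \<noteq> t \<Longrightarrow> lt s t \<or> lt t s"
    and term_order_asym: "lt s t \<Longrightarrow> \<not> lt t s"
    and term_order_add: "lt s t \<Longrightarrow> lt (s + u) (t + u)"
proof -
  from assms have irr: "irreflp lt" and trans: "transp lt" and total: "totalp lt"
    and add: "\<forall>s t u. lt s t \<longrightarrow> lt (s + u) (t + u)"
    unfolding term_order_def by simp_all
  show "\<not> lt s s"
    using irr by (rule irreflpD)
  show "lt s t \<Longrightarrow> lt t u \<Longrightarrow> lt s u"
    using trans by (rule transpD)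
  show "s \<noteq> t \<Longrightarrow> lt s t \<or> lt t s"
    using total by (rule totalpD)
  show "lt s t \<Longrightarrow> \<not> lt t s"
    using irreflpD [OF irr] transpD [OF trans] by blast
  show "lt s t \<Longrightarrow> lt (s + u) (t + u)"
    using add by simp
qed

lemma term_order_greatest:
  assumes "term_order lt" "finite A" "A \<noteq> {}"
  obtains g where "g \<in> A" "\<And>x. x \<in> A \<Longrightarrow> x \<noteq> g \<Longrightarrow> lt x g"
proof -
  have "transp lt" "totalp lt"
    using assms(1) unfolding term_order_def by simp_all
  note on = transp_on_subset [OF this(1) subset_UNIV] totalp_on_subset [OF this(2) subset_UNIV]
  from Finite_Set.bex_greatest_element [OF assms(2,3) on]
  show thesis
    using that by blast
qed

lemma term_order_least:
  assumes "term_order lt" "finite A" "A \<noteq> {}"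
  obtains g where "g \<in> A" "\<And>x. x \<in> A \<Longrightarrow> x \<noteq> g \<Longrightarrow> lt g x"
proof -
  have "transp lt" "totalp lt"
    using assms(1) unfolding term_order_def by simp_all
  note on = transp_on_subset [OF this(1) subset_UNIV] totalp_on_subset [OF this(2) subset_UNIV]
  from Finite_Set.bex_least_element [OF assms(2,3) on]
  show thesis
    using that by blast
qed

lemma ex_is_lm:
  assumes "term_order lt" "f \<noteq> 0"
  obtains s where "is_lm lt f s"
proof -
  obtain s where "s \<in> Poly_Mapping.keys f" "\<And>t. t \<in> Poly_Mapping.keys f \<Longrightarrow> t \<noteq> s \<Longrightarrow> lt t s"
    by (rule term_order_greatest [OF assms(1), of "Poly_Mapping.keys f"]) (use assms(2) in auto)
  then show thesis
    using that unfolding is_lm_def by blast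
qed

lemma is_lm_unique:
  assumes "term_order lt" "is_lm lt f s" "is_lm lt f t"
  shows "s = t"
proof (rule ccontr)
  assume "s \<noteq> t"
  with assms(2,3) have "lt s t" "lt t s"
    unfolding is_lm_def by auto
  with term_order_asym [OF assms(1)] show False
    by blast
qed

lemma lms_subset: "V \<subseteq> supported A \<Longrightarrow> lms lt V \<subseteq> A"
  by (auto simp: lms_def is_lm_def supported_def)

lemma is_lm_monomial_mult:
  fixes f :: "('v, 'a::field) mpol"
  assumes "term_order lt" "is_lm lt f s"
  shows "is_lm lt (monomial w * f) (s + w)"
  unfolding is_lm_def keys_monomial_mult
proof (intro conjI ballI impI)
  show "s + w \<in> (+) w ` Poly_Mapping.keys f"
    using assms(2) unfolding is_lm_def by (auto simp: add.commute)
  fix t assume t: "t \<in> (+) w ` Poly_Mapping.keys f" "t \<noteq> s + w"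
  then obtain u where u: "u \<in> Poly_Mapping.keys f" "t = u + w"
    by (auto simp: add.commute)
  with t(2) have "u \<noteq> s"
    by auto
  with u(1) assms(2) have "lt u s"
    unfolding is_lm_def by blast
  with u(2) show "lt t (s + w)"
    using term_order_add [OF assms(1)] by blast
qed

text \<open>Gaussian elimination without matrices, with one element \<open>F s\<close> chosen for
  every leading monomial \<open>s\<close>. In a vanishing combination the term at the greatest
  \<open>s\<close> with nonzero coefficient cannot cancel; an element outside the span, with least
  possible leading monomial \<open>s\<close>, could be reduced by \<open>F s\<close>.\<close>

lemma echelon_basis:
  fixes V :: "('v, 'a::field) mpol set"
  assumes lt: "term_order lt" and V: "mpv.subspace V" "V \<subseteq> supported A" and A: "finite A"
    and F: "\<And>s. s \<in> lms lt V \<Longrightarrow> F s \<in> V \<and> is_lm lt (F s) s"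
  shows inj_on_echelon_basis: "inj_on F (lms lt V)"
    and independent_echelon_basis: "mpv.independent (F ` lms lt V)"
    and span_echelon_basis: "mpv.span (F ` lms lt V) = V"
proof -
  have fin: "finite (lms lt V)"
    using finite_subset [OF lms_subset [OF V(2)] A] .
  show inj: "inj_on F (lms lt V)"
    by (rule inj_onI) (metis F is_lm_unique lt)
  show "mpv.independent (F ` lms lt V)"
  proof (rule mpv.independent_if_scalars_zero)
    show "finite (F ` lms lt V)"
      using fin by simp
    fix c x
    assume sum: "(\<Sum>x\<in>F ` lms lt V. const (c x) * x) = 0" and x: "x \<in> F ` lms lt V"
    show "c x = 0"
    proof (rule ccontr)
      define S where "S = {s \<in> lms lt V. c (F s) \<noteq> 0}"
      assume "c x \<noteq> 0"
      then have "S \<noteq> {}" "finite S"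
        using x fin by (auto simp: S_def)
      then obtain g where g: "g \<in> S" "\<And>s. s \<in> S \<Longrightarrow> s \<noteq> g \<Longrightarrow> lt s g"
        using term_order_greatest [OF lt, of S] by blast
      \<comment> \<open>Other indices contribute nothing at \<open>g\<close>: either the coefficient
        is zero, or all terms of \<open>F s\<close> are below \<open>g\<close>.\<close>
      have zero: "c (F s) * Poly_Mapping.lookup (F s) g = 0" if "s \<in> lms lt V" "s \<noteq> g" for s
      proof (cases "s \<in> S")
        case True
        then have "\<not> lt g s"
          using g(2) that(2) term_order_asym [OF lt] by blast
        then have "g \<notin> Poly_Mapping.keys (F s)"
          using F [OF that(1)] that(2) by (auto simp: is_lm_def)
        then show ?thesis by (simp add: in_keys_iff)
      qed (use that S_def in auto)
      have "0 = Poly_Mapping.lookup (\<Sum>x\<in>F ` lms lt V. const (c x) * x) g"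
        by (simp add: sum)
      also have "\<dots> = (\<Sum>s\<in>lms lt V. c (F s) * Poly_Mapping.lookup (F s) g)"
        by (simp add: lookup_sum sum.reindex [OF inj])
      also have "\<dots> = (\<Sum>s\<in>{g}. c (F s) * Poly_Mapping.lookup (F s) g)"
        using g(1) fin zero by (intro sum.mono_neutral_right) (auto simp: S_def)
      finally have "c (F g) * Poly_Mapping.lookup (F g) g = 0"
        by simp
      moreover have "g \<in> Poly_Mapping.keys (F g)" "c (F g) \<noteq> 0"
        using g(1) F [of g] by (auto simp: S_def is_lm_def)
      ultimately show False
        by (simp add: in_keys_iff)
    qed
  qed
  show "mpv.span (F ` lms lt V) = V"
  proof
    show sub: "mpv.span (F ` lms lt V) \<subseteq> V"
      using F by (intro mpv.span_minimal V(1)) blast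
    show "V \<subseteq> mpv.span (F ` lms lt V)"
    proof (rule ccontr)
      define X where "X = {s. \<exists>f\<in>V - mpv.span (F ` lms lt V). is_lm lt f s}"
      assume "\<not> V \<subseteq> mpv.span (F ` lms lt V)"
      then obtain f where f: "f \<in> V - mpv.span (F ` lms lt V)"
        by blast
      then have "f \<noteq> 0"
        using mpv.span_zero by blast
      then have "X \<noteq> {}"
        using ex_is_lm [OF lt] f by (metis (mono_tags, lifting) X_def empty_iff mem_Collect_eq)
      moreover have "finite X"
        by (rule finite_subset [OF _ fin]) (auto simp: X_def lms_def)
      ultimately obtain s where s: "s \<in> X" "\<And>t. t \<in> X \<Longrightarrow> t \<noteq> s \<Longrightarrow> lt s t"
        using term_order_least [OF lt, of X] by blast
      then obtain h where h: "h \<in> V" "h \<notin> mpv.span (F ` lms lt V)" "is_lm lt h s"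
        by (auto simp: X_def)
      have sV: "s \<in> lms lt V"
        using h by (auto simp: lms_def)
      note Fs = F [OF sV]
      \<comment> \<open>Chosen to cancel the leading term of \<open>h\<close>. The remainder is
        still outside the span, but its leading monomial is smaller, against the choice of
        \<open>s\<close>.\<close>
      define k where "k = Poly_Mapping.lookup h s / Poly_Mapping.lookup (F s) s"
      define h' where "h' = h - const k * F s"
      have span: "const k * F s \<in> mpv.span (F ` lms lt V)"
        using sV by (intro mpv.span_scale mpv.span_base) auto
      have "h' \<in> V"
        unfolding h'_def using h(1) Fs by (intro mpv.subspace_diff mpv.subspace_scale V(1)) auto
      moreover have "h' \<notin> mpv.span (F ` lms lt V)"
      proof
        assume "h' \<in> mpv.span (F ` lms lt V)"
        from mpv.span_add [OF this span] h(2) show False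
          by (simp add: h'_def)
      qed
      moreover from this have "h' \<noteq> 0"
        using mpv.span_zero by blast
      then obtain t where t: "is_lm lt h' t"
        using ex_is_lm [OF lt] by blast
      ultimately have "t \<in> X"
        by (auto simp: X_def)
      have "Poly_Mapping.lookup (F s) s \<noteq> 0"
        using Fs by (auto simp: is_lm_def in_keys_iff)
      then have "Poly_Mapping.lookup h' s = 0"
        by (simp add: h'_def lookup_minus k_def)
      with t have "t \<noteq> s"
        by (auto simp: is_lm_def in_keys_iff)
      moreover have "Poly_Mapping.lookup h t \<noteq> 0 \<or> Poly_Mapping.lookup (F s) t \<noteq> 0"
        using t by (auto simp: is_lm_def in_keys_iff h'_def lookup_minus)
      ultimately have "lt t s"
        using h(3) Fs by (auto simp: is_lm_def in_keys_iff)
      with s(2) [OF \<open>t \<in> X\<close> \<open>t \<noteq> s\<close>] show False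
        using term_order_asym [OF lt] by blast
    qed
  qed
qed

text \<open>Applied in every degree, this says that an ideal and its initial ideal have the same
  Hilbert function.\<close>

lemma dim_eq_card_lms:
  fixes V :: "('v, 'a::field) mpol set"
  assumes "term_order lt" "mpv.subspace V" "V \<subseteq> supported A" "finite A"
  shows "mpv.dim V = card (lms lt V)"
proof -
  have "\<forall>s. \<exists>f. s \<in> lms lt V \<longrightarrow> f \<in> V \<and> is_lm lt f s"
    by (auto simp: lms_def)
  then obtain F where F: "\<And>s. s \<in> lms lt V \<Longrightarrow> F s \<in> V \<and> is_lm lt (F s) s"
    by metis
  note b = echelon_basis [OF assms F]
  have "mpv.dim V = card (F ` lms lt V)"
    using mpv.dim_span_eq_card_independent [OF b(2)] b(3) by simp
  with b(1) show ?thesis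
    by (simp add: card_image)
qed

section \<open>Graded free modules\<close>

text \<open>Rank-nullity relative to a subspace of a finitely spanned one, since the free modules it
  is used for have infinite dimension over the field. A basis \<open>B\<close> of the kernel is
  extended to a basis \<open>C\<close> of \<open>A\<close>, and \<open>f\<close> is injective on the
  span of \<open>C - B\<close>.\<close>

lemma (in vector_space_pair) dim_eq_dim_kernel_plus_dim_image:
  assumes f: "Vector_Spaces.linear s1 s2 f" and A: "vs1.subspace A" "A \<subseteq> vs1.span E" "finite E"
  shows "vs1.dim A = vs1.dim {x \<in> A. f x = 0} + vs2.dim (f ` A)"
proof -
  let ?K = "{x \<in> A. f x = 0}"
  interpret f: Vector_Spaces.linear s1 s2 f by (rule f)
  obtain B where B: "B \<subseteq> ?K" "vs1.independent B" "?K \<subseteq> vs1.span B"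
    using vs1.maximal_independent_subset [of ?K] by blast
  obtain C where C: "B \<subseteq> C" "C \<subseteq> A" "vs1.independent C" "A \<subseteq> vs1.span C"
    using vs1.maximal_independent_subset_extend [of B A] B by blast
  have finC: "finite C"
    using vs1.independent_span_bound [OF A(3) C(3)] C(2) A(2) by blast
  then have finB: "finite B"
    using C(1) finite_subset by blast
  have spanK: "vs1.span B \<subseteq> ?K"
  proof (rule vs1.span_minimal [OF B(1)])
    show "vs1.subspace ?K"
      using A(1) by (auto simp: vs1.subspace_def f.add f.scale f.zero)
  qed
  have inj: "inj_on f (vs1.span (C - B))"
  proof (subst f.inj_on_iff_eq_0 [OF vs1.subspace_span], intro ballI impI)
    fix x assume x: "x \<in> vs1.span (C - B)" "f x = 0"
    have "vs1.span (C - B) \<subseteq> A"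
      using C(2) A(1) by (intro vs1.span_minimal) auto
    with x have "x \<in> vs1.span B"
      using B(3) by blast
    \<comment> \<open>Coordinates with respect to \<open>C\<close> that live both on
      \<open>B\<close> and on \<open>C - B\<close> must vanish.\<close>
    then have "vs1.representation C x = vs1.representation B x"
      using vs1.representation_extend [OF C(3) _ C(1)] by blast
    moreover have "vs1.representation C x = vs1.representation (C - B) x"
      using vs1.representation_extend [OF C(3) x(1)] by blast
    ultimately have "vs1.representation C x b = 0" for b
      using vs1.representation_ne_zero [of B x b] vs1.representation_ne_zero [of "C - B" x b] by auto
    moreover have "x \<in> vs1.span C"
      using x(1) vs1.span_mono [of "C - B" C] by blast
    ultimately show "x = 0"
      using vs1.sum_nonzero_representation_eq [OF C(3), of x] by simp
  qed
  have "vs2.independent (f ` (C - B))"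
    using f.independent_inj_on_image [OF vs1.independent_mono [OF C(3)] inj] by blast
  moreover have "f ` A \<subseteq> vs2.span (f ` (C - B))"
  proof -
    have "f ` A \<subseteq> vs2.span (f ` C)"
      using C(4) f.span_image [of C] by blast
    also have "\<dots> \<subseteq> vs2.span (insert 0 (f ` (C - B)))"
      using B(1) by (intro vs2.span_mono) auto
    finally show ?thesis
      by simp
  qed
  moreover have "f ` (C - B) \<subseteq> f ` A"
    using C(2) by blast
  ultimately have "vs2.dim (f ` A) = card (f ` (C - B))"
    using vs2.basis_card_eq_dim by metis
  also have "\<dots> = card (C - B)"
    by (intro card_image inj_on_subset [OF inj vs1.span_superset])
  finally have "vs2.dim (f ` A) = card C - card B"
    using card_Diff_subset [OF finB C(1)] by simp
  moreover have "vs1.dim A = card C"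
    using vs1.basis_card_eq_dim C by metis
  moreover have "vs1.dim ?K = card B"
    using vs1.basis_card_eq_dim B by metis
  ultimately show ?thesis
    using card_mono [OF finC C(1)] by simp
qed

lemma dim_mono_supported:
  fixes V :: "('v, 'a::field) mpol set"
  assumes "V \<subseteq> supported A" "finite A"
  shows "mpv.dim V \<le> card A"
proof -
  have "mpv.dim V \<le> card (monomial ` A :: ('v, 'a) mpol set)"
    using assms by (intro mpv.dim_le_card) (auto simp: supported_eq_span)
  also have "\<dots> \<le> card A"
    using assms by (intro card_image_le)
  finally show ?thesis .
qed

section \<open>Homogeneous components\<close>

definition restr :: "'v mon set \<Rightarrow> ('v, 'a::zero) mpol \<Rightarrow> ('v, 'a) mpol" where
  "restr A f = Abs_poly_mapping (\<lambda>t. Poly_Mapping.lookup f t when t \<in> A)"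

lemma lookup_restr: "Poly_Mapping.lookup (restr A f) t = (if t \<in> A then Poly_Mapping.lookup f t else 0)"
proof -
  have "finite {t. (Poly_Mapping.lookup f t when t \<in> A) \<noteq> 0}"
    by (rule finite_subset [OF _ finite_keys [of f]]) (simp add: Collect_mono_iff keys.rep_eq)
  then show ?thesis
    unfolding restr_def by (simp add: when_def)
qed

lemma keys_restr: "Poly_Mapping.keys (restr A f) = A \<inter> Poly_Mapping.keys f"
  by (simp add: Set.set_eq_iff in_keys_iff lookup_restr)

lemma restr_in_supported: "restr A f \<in> supported A"
  by (simp add: supported_def keys_restr)

lemma restr_ident:
  assumes "f \<in> supported A"
  shows "restr A f = f"
proof (rule poly_mapping_eqI)
  fix t
  have "t \<notin> A \<Longrightarrow> t \<notin> Poly_Mapping.keys f"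
    using assms unfolding supported_def by blast
  then show "Poly_Mapping.lookup (restr A f) t = Poly_Mapping.lookup f t"
    by (simp add: lookup_restr in_keys_iff)
qed

lemma restr_zero:
  assumes "f \<in> supported (- A)"
  shows "restr A f = 0"
proof (rule poly_mapping_eqI)
  fix t
  have "t \<in> A \<Longrightarrow> t \<notin> Poly_Mapping.keys f"
    using assms unfolding supported_def by blast
  then show "Poly_Mapping.lookup (restr A f) t = Poly_Mapping.lookup 0 t"
    by (simp add: lookup_restr in_keys_iff)
qed

lemma restr_0 [simp]: "restr A 0 = 0"
  by (rule poly_mapping_eqI) (simp add: lookup_restr)

lemma restr_add: "restr A (f + g) = restr A f + restr A g"
  for f g :: "('v, 'a::field) mpol"
  by (rule poly_mapping_eqI) (simp add: lookup_restr lookup_add)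

lemma restr_sum: "restr A (sum f B) = (\<Sum>x\<in>B. restr A (f x))"
  for f :: "'b \<Rightarrow> ('v, 'a::field) mpol"
  by (induction B rule: infinite_finite_induct) (simp_all add: restr_add)

text \<open>Monomials in the degree \<open>t\<close> part of S(-a). The additive condition makes the
  set empty for \<open>a > t\<close>, where \<open>t - a\<close> on natural numbers would be
  0.\<close>

abbreviation shifted_mons :: "nat \<Rightarrow> nat \<Rightarrow> 'v mon set" where
  "shifted_mons a t \<equiv> {s. mon_deg s + a = t}"

text \<open>The part of \<open>f\<close> in the matching degree is shifted into the selected degree,
  and every other part lands outside it.\<close>

lemma restr_mult_forms:
  fixes f g :: "('v, 'a::field) mpol"
  assumes "g \<in> forms d"
  shows "restr (shifted_mons a t) (g * f) = g * restr (shifted_mons (d + a) t) f"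
proof -
  let ?B = "shifted_mons (d + a) t :: 'v mon set"
  have f: "f = restr ?B f + restr (- ?B) f"
    by (rule poly_mapping_eqI) (simp add: lookup_restr lookup_add)
  have "g * restr ?B f \<in> supported (shifted_mons a t)"
    unfolding supported_def
  proof safe
    fix x assume "x \<in> Poly_Mapping.keys (g * restr ?B f)"
    then obtain u s where "x = u + s" "u \<in> Poly_Mapping.keys g" "s \<in> Poly_Mapping.keys (restr ?B f)"
      using keys_mult_subset by blast
    with assms restr_in_supported [of ?B f] show "mon_deg x + a = t"
      by (auto simp: forms_def supported_def)
  qed
  then have 1: "restr (shifted_mons a t) (g * restr ?B f) = g * restr ?B f"
    by (rule restr_ident)
  have "g * restr (- ?B) f \<in> supported (- shifted_mons a t)"
    unfolding supported_def mem_Collect_eq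
  proof
    fix x assume "x \<in> Poly_Mapping.keys (g * restr (- ?B) f)"
    then obtain u s where "x = u + s" "u \<in> Poly_Mapping.keys g" "s \<in> Poly_Mapping.keys (restr (- ?B) f)"
      using keys_mult_subset by blast
    with assms restr_in_supported [of "- ?B" f] show "x \<in> - shifted_mons a t"
      by (auto simp: forms_def supported_def)
  qed
  then have 2: "restr (shifted_mons a t) (g * restr (- ?B) f) = 0"
    by (rule restr_zero)
  have "restr (shifted_mons a t) (g * (restr ?B f + restr (- ?B) f)) = g * restr ?B f"
    by (simp add: distrib_left restr_add 1 2)
  then show ?thesis
    by (simp only: f [symmetric])
qed

lemma const_mult_const: "const a * const b = (const (a * b) :: ('v, 'a::field) mpol)"
  by (simp add: const_def mult_single)

text \<open>Free modules of all ranks live in one vector space of sequences of polynomials, being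
  padded with zeros.\<close>

global_interpretation mfv: vector_space
  "\<lambda>c (v :: nat \<Rightarrow> ('v, 'a::field) mpol) j. const c * v j"
  by unfold_locales
    (simp_all add: fun_eq_iff mpv.scale_right_distrib mpv.scale_left_distrib const_mult_const)

definition graded_free :: "nat \<Rightarrow> (nat \<Rightarrow> nat) \<Rightarrow> nat \<Rightarrow> (nat \<Rightarrow> ('v, 'a::field) mpol) set" where
  "graded_free b a t =
     {v. (\<forall>j\<ge>b. v j = 0) \<and> (\<forall>j<b. v j \<in> supported (shifted_mons (a j) t))}"

lemma subspace_graded_free: "mfv.subspace (graded_free b a t)"
proof (rule mfv.subspaceI)
  note S = mpv.subspace_0 [OF subspace_supported] mpv.subspace_add [OF subspace_supported]
    mpv.subspace_scale [OF subspace_supported]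
  show "0 \<in> graded_free b a t"
    by (simp add: graded_free_def S)
  show "v + w \<in> graded_free b a t" if "v \<in> graded_free b a t" "w \<in> graded_free b a t" for v w
    using that by (simp add: graded_free_def S)
  show "(\<lambda>j. const c * v j) \<in> graded_free b a t" if "v \<in> graded_free b a t" for c v
    using that by (simp add: graded_free_def S)
qed

text \<open>The pair \<open>(j, s)\<close> stands for the monomial \<open>s\<close> in the
  \<open>j\<close>-th summand; such elements form a basis of a graded piece.\<close>

definition unit_fn :: "nat \<times> 'v mon \<Rightarrow> nat \<Rightarrow> ('v, 'a::field) mpol" where
  "unit_fn x = (\<lambda>j. if j = fst x then monomial (snd x) else 0)"

lemma finite_shifted_mons: "finite (shifted_mons a t :: 'v::finite mon set)"
  by (rule finite_subset [OF _ finite_deg_mons [of "t - a"]]) auto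

lemma sum_fun_apply: "(sum f A) j = (\<Sum>x\<in>A. f x j)"
  for f :: "'b \<Rightarrow> 'c \<Rightarrow> 'd::comm_monoid_add"
  by (induction A rule: infinite_finite_induct) simp_all

lemma
  fixes a :: "nat \<Rightarrow> nat" and b t :: nat
  defines "X \<equiv> Sigma {..<b} (\<lambda>j. shifted_mons (a j) t) :: (nat \<times> 'v::finite mon) set"
  defines "G \<equiv> graded_free b a t :: (nat \<Rightarrow> ('v, 'a::field) mpol) set"
  shows graded_free_subset_span: "G \<subseteq> mfv.span (unit_fn ` X)"
    and dim_graded_free: "mfv.dim G = (\<Sum>j<b. card (shifted_mons (a j) t :: 'v mon set))"
proof -
  have fin: "finite X"
    unfolding X_def by (intro finite_SigmaI finite_shifted_mons) simp
  show span: "G \<subseteq> mfv.span (unit_fn ` X)"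
  proof
    fix v :: "nat \<Rightarrow> ('v, 'a) mpol"
    assume v: "v \<in> G"
    have "v = (\<Sum>x\<in>X. (\<lambda>j. const (Poly_Mapping.lookup (v (fst x)) (snd x)) * unit_fn x j))"
    proof
      fix k
      have "(\<Sum>x\<in>X. (\<lambda>j. const (Poly_Mapping.lookup (v (fst x)) (snd x)) * unit_fn x j)) k =
          (\<Sum>j<b. \<Sum>s\<in>shifted_mons (a j) t. if k = j then const (Poly_Mapping.lookup (v j) s) * monomial s else 0)"
        unfolding sum_fun_apply X_def
        by (subst sum.Sigma) (auto simp: finite_shifted_mons unit_fn_def intro!: sum.cong)
      also have "\<dots> = (\<Sum>j<b. if k = j then
          (\<Sum>s\<in>shifted_mons (a j) t. const (Poly_Mapping.lookup (v j) s) * monomial s) else 0)"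
        by (intro sum.cong) auto
      also have "\<dots> = v k"
      proof (cases "k < b")
        case True
        then have "v k = (\<Sum>s\<in>shifted_mons (a k) t. const (Poly_Mapping.lookup (v k) s) * monomial s)"
          using v by (intro mpol_expansion finite_shifted_mons)
            (auto simp: G_def graded_free_def supported_def)
        with True show ?thesis by simp
      next
        case False
        then show ?thesis using v by (simp add: G_def graded_free_def)
      qed
      finally show "v k =
          (\<Sum>x\<in>X. (\<lambda>j. const (Poly_Mapping.lookup (v (fst x)) (snd x)) * unit_fn x j)) k" ..
    qed
    also have "\<dots> \<in> mfv.span (unit_fn ` X)"
      by (intro mfv.span_sum mfv.span_scale mfv.span_base) auto
    finally show "v \<in> mfv.span (unit_fn ` X)" .
  qed
  have inj: "inj (unit_fn :: nat \<times> 'v mon \<Rightarrow> nat \<Rightarrow> ('v, 'a) mpol)"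
  proof (rule injI)
    fix x y :: "nat \<times> 'v mon"
    assume "unit_fn x = (unit_fn y :: nat \<Rightarrow> ('v, 'a) mpol)"
    then have "Poly_Mapping.lookup (unit_fn x (fst x) :: ('v, 'a) mpol) (snd x) =
        Poly_Mapping.lookup (unit_fn y (fst x) :: ('v, 'a) mpol) (snd x)"
      by simp
    then show "x = y"
      by (auto simp: unit_fn_def prod_eq_iff split: if_splits)
  qed
  have ind: "mfv.independent (unit_fn ` X :: (nat \<Rightarrow> ('v, 'a) mpol) set)"
  proof (rule mfv.independent_if_scalars_zero)
    show "finite (unit_fn ` X :: (nat \<Rightarrow> ('v, 'a) mpol) set)"
      using fin by simp
    fix c and w :: "nat \<Rightarrow> ('v, 'a) mpol"
    assume sum: "(\<Sum>w\<in>unit_fn ` X. (\<lambda>j. const (c w) * w j)) = (0 :: nat \<Rightarrow> ('v, 'a) mpol)"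
      and "w \<in> unit_fn ` X"
    then obtain y where y: "y \<in> X" "w = unit_fn y"
      by blast
    have "0 = Poly_Mapping.lookup ((\<Sum>w\<in>unit_fn ` X. (\<lambda>j. const (c w) * w j)) (fst y)) (snd y)"
      by (simp add: sum)
    also have "\<dots> = (\<Sum>x\<in>X. c (unit_fn x) * Poly_Mapping.lookup (unit_fn x (fst y)) (snd y))"
      by (simp add: sum_fun_apply lookup_sum sum.reindex inj_on_subset [OF inj])
    also have "\<dots> = (\<Sum>x\<in>X. if x = y then c (unit_fn x) else 0)"
      by (intro sum.cong) (auto simp: unit_fn_def prod_eq_iff)
    also have "\<dots> = c w"
      using fin y by simp
    finally show "c w = 0" ..
  qed
  have sub: "unit_fn ` X \<subseteq> G"
    by (auto simp: X_def G_def graded_free_def unit_fn_def supported_def split: if_splits)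
  have "mfv.dim G = card (unit_fn ` X :: (nat \<Rightarrow> ('v, 'a) mpol) set)"
    using mfv.basis_card_eq_dim [OF sub span ind] by simp
  also have "\<dots> = card X"
    by (intro card_image inj_on_subset [OF inj subset_UNIV])
  also have "\<dots> = (\<Sum>j<b. card (shifted_mons (a j) t :: 'v mon set))"
    unfolding X_def by (simp add: finite_shifted_mons)
  finally show "mfv.dim G = (\<Sum>j<b. card (shifted_mons (a j) t :: 'v mon set))" .
qed

text \<open>The binomial formula survives beyond \<open>a \<le> t\<close>: for
  \<open>t < a \<le> t + n\<close> no monomial is left and the upper entry drops below
  \<open>n\<close>. This extra range of length \<open>n\<close> is what absorbs the summand
  \<open>i\<close> of the bound \<open>r + i\<close> in the definition of regularity.\<close>

lemma card_shifted_mons: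
  assumes "CARD('v::finite) = n + 1" "a \<le> t + n"
  shows "card (shifted_mons a t :: 'v mon set) = (t + n - a) choose n"
proof (cases "a \<le> t")
  case True
  then have "shifted_mons a t = (deg_mons (t - a) :: 'v mon set)"
    by auto
  moreover have "(t - a + n) choose (t - a) = (t - a + n) choose n"
    using binomial_symmetric [of "t - a" "t - a + n"] by simp
  ultimately show ?thesis
    using True assms(1) by (simp add: card_deg_mons)
next
  case False
  then have "shifted_mons a t = ({} :: 'v mon set)"
    by auto
  with False assms(2) show ?thesis
    by simp
qed

text \<open>Unlike in \<open>has_hilbert_polynomial\<close>, the threshold is explicit: what matters
  is that polynomiality starts at the regularity already.\<close>

definition eventually_poly :: "nat \<Rightarrow> (nat \<Rightarrow> nat) \<Rightarrow> bool" where
  "eventually_poly r f \<longleftrightarrow> (\<exists>h :: rat poly. \<forall>t\<ge>r. of_nat (f t) = poly h (of_nat t))"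

lemma eventually_poly_card_shifted_mons:
  assumes "CARD('v::finite) = n + 1" "a \<le> r + n"
  shows "eventually_poly r (\<lambda>t. card (shifted_mons a t :: 'v mon set))"
  unfolding eventually_poly_def
proof (intro exI allI impI)
  fix t assume "r \<le> t"
  with assms(2) have a: "a \<le> t + n"
    by simp
  \<comment> \<open>A generalised binomial coefficient is a polynomial in its upper argument, which
    may be negative here only after \<open>t\<close> is subtracted.\<close>
  have "(of_nat ((t + n - a) choose n) :: rat) = (of_nat t + (of_nat n - of_nat a)) gchoose n"
    using a by (simp add: binomial_gbinomial of_nat_diff algebra_simps)
  also have "\<dots> = poly ([:1 / fact n:] * (\<Prod>i<n. [:of_nat n - of_nat a - of_nat i, 1:])) (of_nat t)"
    by (simp add: gbinomial_prod_rev poly_prod algebra_simps atLeast0LessThan)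
  finally show "of_nat (card (shifted_mons a t :: 'v mon set)) =
      poly ([:1 / fact n:] * (\<Prod>i<n. [:of_nat n - of_nat a - of_nat i, 1 :: rat:])) (of_nat t)"
    by (simp add: card_shifted_mons [OF assms(1) a])
qed

lemma eventually_poly_sum:
  assumes "\<And>i. i \<in> A \<Longrightarrow> eventually_poly r (f i)"
  shows "eventually_poly r (\<lambda>t. \<Sum>i\<in>A. f i t)"
proof -
  have "\<forall>i\<in>A. \<exists>h :: rat poly. \<forall>t\<ge>r. of_nat (f i t) = poly h (of_nat t)"
    using assms unfolding eventually_poly_def by blast
  then obtain h :: "_ \<Rightarrow> rat poly" where h: "\<And>i t. i \<in> A \<Longrightarrow> t \<ge> r \<Longrightarrow> of_nat (f i t) = poly (h i) (of_nat t)"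
    by metis
  show ?thesis
    unfolding eventually_poly_def
    by (rule exI [of _ "\<Sum>i\<in>A. h i"]) (simp add: h poly_sum)
qed

text \<open>The additive form of the hypothesis avoids natural subtraction and fits the dimension
  formulas of exact sequences.\<close>

lemma eventually_poly_diff:
  assumes "eventually_poly r f" "eventually_poly r g" "\<And>t. f t = g t + k t"
  shows "eventually_poly r k"
proof -
  obtain h h' :: "rat poly" where h: "\<And>t. t \<ge> r \<Longrightarrow> of_nat (f t) = poly h (of_nat t)"
    "\<And>t. t \<ge> r \<Longrightarrow> of_nat (g t) = poly h' (of_nat t)"
    using assms(1,2) unfolding eventually_poly_def by blast
  show ?thesis
    unfolding eventually_poly_def
  proof (intro exI allI impI)
    fix t assume "r \<le> t"
    from h [OF this] show "of_nat (k t) = poly (h - h') (of_nat t)"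
      unfolding assms(3) by (simp add: algebra_simps)
  qed
qed

section \<open>Hilbert functions from free resolutions\<close>

text \<open>The action of \<open>M\<close> on zero-padded sequences. Vectors in the sense of
  \<open>carrier_vec\<close> form a vector space only inside a carrier set, whereas these sequences
  form one as a type.\<close>

definition mat_map ::
  "('v, 'a::field) mpol mat \<Rightarrow> (nat \<Rightarrow> ('v, 'a) mpol) \<Rightarrow> nat \<Rightarrow> ('v, 'a) mpol" where
  "mat_map M v = (\<lambda>k. if k < dim_row M then \<Sum>j<dim_col M. M $$ (k, j) * v j else 0)"

lemma mat_map_eq_mult_vec:
  assumes "M \<in> carrier_mat nr nc"
  shows "vec nr (mat_map M v) = M *\<^sub>v vec nc v"
  using assms
  by (intro eq_vecI) (simp_all add: mat_map_def scalar_prod_def atLeast0LessThan)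

lemma linear_mat_map:
  "Vector_Spaces.linear (\<lambda>c v j. const c * v j) (\<lambda>c v j. const c * v j) (mat_map M)"
  unfolding Vector_Spaces.linear_iff
  by (intro conjI allI mfv.vector_space_axioms)
    (simp_all add: mat_map_def fun_eq_iff distrib_left sum.distrib sum_distrib_left mult.left_commute)

locale graded_resolution =
  fixes I :: "('v::finite, 'a::field) mpol set"
    and b :: "nat \<Rightarrow> nat" and a :: "nat \<Rightarrow> nat \<Rightarrow> nat" and D :: "nat \<Rightarrow> ('v, 'a) mpol mat"
  assumes resolution: "minimal_graded_free_resolution I b a D"
begin

definition \<delta> :: "nat \<Rightarrow> (nat \<Rightarrow> ('v, 'a) mpol) \<Rightarrow> nat \<Rightarrow> ('v, 'a) mpol" where
  "\<delta> i = mat_map (D i)"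

definition F :: "nat \<Rightarrow> nat \<Rightarrow> (nat \<Rightarrow> ('v, 'a) mpol) set" where
  "F i t = graded_free (b i) (a i) t"

text \<open>Cycles of the degree \<open>t\<close> strand; for \<open>i = 0\<close> these are the
  relations between the generators of \<open>I\<close>.\<close>

definition Z :: "nat \<Rightarrow> nat \<Rightarrow> (nat \<Rightarrow> ('v, 'a) mpol) set" where
  "Z i t = {v \<in> F i t. \<delta> i v = 0}"

lemma D_carrier: "D 0 \<in> carrier_mat 1 (b 0)" "D (Suc i) \<in> carrier_mat (b i) (b (Suc i))"
  and b_zero: "i \<ge> CARD('v) \<Longrightarrow> b i = 0"
  and D0_forms: "j < b 0 \<Longrightarrow> D 0 $$ (0, j) \<in> forms (a 0 j)"
  and D_Suc_forms: "k < b i \<Longrightarrow> j < b (Suc i) \<Longrightarrow> D (Suc i) $$ (k, j) = 0 \<or>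
        (a i k \<le> a (Suc i) j \<and> D (Suc i) $$ (k, j) \<in> forms (a (Suc i) j - a i k))"
  and I_eq: "I = {vec_index (D 0 *\<^sub>v u) 0 | u. u \<in> carrier_vec (b 0)}"
  and exact: "mat_kernel (D i) = {D (Suc i) *\<^sub>v u | u. u \<in> carrier_vec (b (Suc i))}"
proof -
  have R: "D 0 \<in> carrier_mat 1 (b 0)"
    "\<forall>i. D (Suc i) \<in> carrier_mat (b i) (b (Suc i))"
    "\<forall>i\<ge>CARD('v). b i = 0"
    "\<forall>j<b 0. D 0 $$ (0, j) \<in> forms (a 0 j)"
    "\<forall>i. \<forall>k<b i. \<forall>j<b (Suc i). D (Suc i) $$ (k, j) = 0 \<or>
        (a i k \<le> a (Suc i) j \<and> D (Suc i) $$ (k, j) \<in> forms (a (Suc i) j - a i k))"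
    "I = {vec_index (D 0 *\<^sub>v u) 0 | u. u \<in> carrier_vec (b 0)}"
    "\<forall>i. mat_kernel (D i) = {D (Suc i) *\<^sub>v u | u. u \<in> carrier_vec (b (Suc i))}"
    using resolution unfolding minimal_graded_free_resolution_def by - (elim conjE, assumption)+
  show "D 0 \<in> carrier_mat 1 (b 0)" "D (Suc i) \<in> carrier_mat (b i) (b (Suc i))"
    "i \<ge> CARD('v) \<Longrightarrow> b i = 0"
    "j < b 0 \<Longrightarrow> D 0 $$ (0, j) \<in> forms (a 0 j)"
    "k < b i \<Longrightarrow> j < b (Suc i) \<Longrightarrow> D (Suc i) $$ (k, j) = 0 \<or>
        (a i k \<le> a (Suc i) j \<and> D (Suc i) $$ (k, j) \<in> forms (a (Suc i) j - a i k))"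
    "mat_kernel (D i) = {D (Suc i) *\<^sub>v u | u. u \<in> carrier_vec (b (Suc i))}"
    using R(1-5,7) by simp_all
  show "I = {vec_index (D 0 *\<^sub>v u) 0 | u. u \<in> carrier_vec (b 0)}"
    by (rule R(6))
qed

lemma D_carrier': "\<exists>nr. D i \<in> carrier_mat nr (b i)"
  using D_carrier by (cases i) blast+

lemma delta_eq_0_iff: "\<delta> i v = 0 \<longleftrightarrow> vec (b i) v \<in> mat_kernel (D i)"
proof -
  obtain nr where nr: "D i \<in> carrier_mat nr (b i)"
    using D_carrier' by blast
  have "\<delta> i v = 0 \<longleftrightarrow> vec nr (\<delta> i v) = 0\<^sub>v nr"
  proof
    assume "vec nr (\<delta> i v) = 0\<^sub>v nr"
    then have "\<delta> i v k = 0" if "k < nr" for k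
      using that by (metis index_vec index_zero_vec(1))
    then show "\<delta> i v = 0"
      using nr by (auto simp: \<delta>_def mat_map_def fun_eq_iff)
  next
    assume "\<delta> i v = 0"
    then show "vec nr (\<delta> i v) = 0\<^sub>v nr"
      by (intro eq_vecI) simp_all
  qed
  with nr show ?thesis
    by (simp add: \<delta>_def mat_map_eq_mult_vec mat_kernel_def)
qed

lemma delta_Suc_cong: "vec (b i) (\<delta> (Suc i) v) = D (Suc i) *\<^sub>v vec (b (Suc i)) v"
  unfolding \<delta>_def by (rule mat_map_eq_mult_vec [OF D_carrier(2)])

lemma delta_Suc_zero: "k \<ge> b i \<Longrightarrow> \<delta> (Suc i) v k = 0"
  using D_carrier(2) [of i] by (simp add: \<delta>_def mat_map_def)

lemma delta_Suc_apply: "k < b i \<Longrightarrow> \<delta> (Suc i) v k = (\<Sum>j<b (Suc i). D (Suc i) $$ (k, j) * v j)"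
  using D_carrier(2) [of i] by (simp add: \<delta>_def mat_map_def)

lemma delta_0_apply: "\<delta> 0 v k = (if k = 0 then \<Sum>j<b 0. D 0 $$ (0, j) * v j else 0)"
  using D_carrier(1) by (simp add: \<delta>_def mat_map_def)

text \<open>Since the matrices are homogeneous, passing to a graded component commutes with them; this
  makes the graded strands of the resolution exact.\<close>

definition component :: "nat \<Rightarrow> nat \<Rightarrow> (nat \<Rightarrow> ('v, 'a) mpol) \<Rightarrow> nat \<Rightarrow> ('v, 'a) mpol" where
  "component i t v = (\<lambda>j. if j < b i then restr (shifted_mons (a i j) t) (v j) else 0)"

lemma component_in_F: "component i t v \<in> F i t"
  by (simp add: F_def graded_free_def component_def restr_in_supported)

lemma component_ident: "v \<in> F i t \<Longrightarrow> component i t v = v"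
  by (auto simp: F_def graded_free_def component_def fun_eq_iff restr_ident)

lemma delta_Suc_component: "\<delta> (Suc i) (component (Suc i) t v) = component i t (\<delta> (Suc i) v)"
proof
  fix k
  show "\<delta> (Suc i) (component (Suc i) t v) k = component i t (\<delta> (Suc i) v) k"
  proof (cases "k < b i")
    case True
    have "restr (shifted_mons (a i k) t) (D (Suc i) $$ (k, j) * v j) =
        D (Suc i) $$ (k, j) * restr (shifted_mons (a (Suc i) j) t) (v j)" if "j < b (Suc i)" for j
      using D_Suc_forms [OF True that]
    proof
      assume *: "a i k \<le> a (Suc i) j \<and> D (Suc i) $$ (k, j) \<in> forms (a (Suc i) j - a i k)"
      then show ?thesis
        using restr_mult_forms [of "D (Suc i) $$ (k, j)" "a (Suc i) j - a i k" "a i k" t "v j"] by simp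
    qed simp
    with True show ?thesis
      by (simp add: component_def delta_Suc_apply restr_sum)
  next
    case False
    then show ?thesis
      by (simp add: component_def delta_Suc_zero)
  qed
qed

lemma delta_0_component:
  "\<delta> 0 (component 0 t v) 0 = restr (deg_mons t) (\<delta> 0 v 0)"
proof -
  have "restr (deg_mons t) (D 0 $$ (0, j) * v j) =
      D 0 $$ (0, j) * restr (shifted_mons (a 0 j) t) (v j)" if "j < b 0" for j
    using restr_mult_forms [OF D0_forms [OF that], of 0 t "v j"] by simp
  then show ?thesis
    by (simp add: delta_0_apply component_def restr_sum)
qed

text \<open>Exactness of the resolution provides some preimage of a cycle; its component of degree
  \<open>t\<close> is still a preimage, because the cycle is homogeneous.\<close>

lemma Z_eq_image: "Z i t = \<delta> (Suc i) ` F (Suc i) t"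
proof
  show "Z i t \<subseteq> \<delta> (Suc i) ` F (Suc i) t"
  proof
    fix v assume v: "v \<in> Z i t"
    then have "vec (b i) v \<in> mat_kernel (D i)"
      by (simp add: Z_def delta_eq_0_iff)
    then obtain u where u: "u \<in> carrier_vec (b (Suc i))" "vec (b i) v = D (Suc i) *\<^sub>v u"
      using exact by blast
    have "vec (b (Suc i)) (vec_index u) = u"
      using u(1) by auto
    then have "vec (b i) (\<delta> (Suc i) (vec_index u)) = vec (b i) v"
      by (simp add: delta_Suc_cong u(2))
    then have "\<delta> (Suc i) (vec_index u) k = v k" if "k < b i" for k
      using that by (metis index_vec)
    moreover have "\<delta> (Suc i) (vec_index u) k = v k" if "k \<ge> b i" for k
      using that v by (simp add: delta_Suc_zero Z_def F_def graded_free_def)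
    ultimately have "\<delta> (Suc i) (vec_index u) = v"
      by (metis ext not_less)
    then have "\<delta> (Suc i) (component (Suc i) t (vec_index u)) = v"
      using v by (simp add: delta_Suc_component component_ident Z_def)
    then show "v \<in> \<delta> (Suc i) ` F (Suc i) t"
      using component_in_F by blast
  qed
  show "\<delta> (Suc i) ` F (Suc i) t \<subseteq> Z i t"
  proof
    fix v assume "v \<in> \<delta> (Suc i) ` F (Suc i) t"
    then obtain u where u: "u \<in> F (Suc i) t" "v = \<delta> (Suc i) u"
      by blast
    have "v = component i t v"
      using delta_Suc_component [of i t u] component_ident [OF u(1)] u(2) by simp
    then have "v \<in> F i t"
      using component_in_F by metis
    moreover have "vec (b i) v \<in> mat_kernel (D i)"
      unfolding u(2) delta_Suc_cong exact by (auto intro: vec_carrier)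
    ultimately show "v \<in> Z i t"
      by (simp add: Z_def delta_eq_0_iff)
  qed
qed

lemma I_eq_range: "I = range (\<lambda>v. \<delta> 0 v 0)"
proof
  have *: "(D 0 *\<^sub>v vec (b 0) v) $ 0 = \<delta> 0 v 0" for v
    unfolding mat_map_eq_mult_vec [OF D_carrier(1), symmetric] \<delta>_def by simp
  show "range (\<lambda>v. \<delta> 0 v 0) \<subseteq> I"
    unfolding I_eq using * [symmetric] vec_carrier by blast
  show "I \<subseteq> range (\<lambda>v. \<delta> 0 v 0)"
  proof
    fix f assume "f \<in> I"
    then obtain u where u: "u \<in> carrier_vec (b 0)" "f = (D 0 *\<^sub>v u) $ 0"
      unfolding I_eq by blast
    have "vec (b 0) (vec_index u) = u"
      using u(1) by auto
    with * [of "vec_index u"] u(2) show "f \<in> range (\<lambda>v. \<delta> 0 v 0)"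
      by auto
  qed
qed

lemma I_forms_eq_image: "I \<inter> forms t = (\<lambda>v. \<delta> 0 v 0) ` F 0 t"
proof
  show "I \<inter> forms t \<subseteq> (\<lambda>v. \<delta> 0 v 0) ` F 0 t"
  proof
    fix f assume f: "f \<in> I \<inter> forms t"
    then obtain v where v: "f = \<delta> 0 v 0"
      unfolding I_eq_range by blast
    have "\<delta> 0 (component 0 t v) 0 = f"
      using f unfolding delta_0_component v [symmetric] forms_eq by (simp add: restr_ident)
    then show "f \<in> (\<lambda>v. \<delta> 0 v 0) ` F 0 t"
      using component_in_F by blast
  qed
  show "(\<lambda>v. \<delta> 0 v 0) ` F 0 t \<subseteq> I \<inter> forms t"
  proof safe
    fix v assume "v \<in> F 0 t"
    then have "\<delta> 0 v 0 = restr (deg_mons t) (\<delta> 0 v 0)"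
      using delta_0_component [of t v] component_ident by simp
    then show "\<delta> 0 v 0 \<in> forms t"
      unfolding forms_eq using restr_in_supported by metis
    show "\<delta> 0 v 0 \<in> I"
      unfolding I_eq_range by blast
  qed
qed

lemma F_span: "\<exists>E. finite E \<and> F i t \<subseteq> mfv.span E"
proof -
  have "finite (unit_fn ` Sigma {..<b i} (\<lambda>j. shifted_mons (a i j) t) :: (nat \<Rightarrow> ('v, 'a) mpol) set)"
    by (intro finite_imageI finite_SigmaI finite_shifted_mons) simp
  then show ?thesis
    unfolding F_def using graded_free_subset_span by blast
qed

text \<open>Rank-nullity, with the image identified by exactness as the cycles one step
  below.\<close>

lemma dim_F_Suc: "mfv.dim (F (Suc i) t) = mfv.dim (Z (Suc i) t) + mfv.dim (Z i t)"
proof -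
  interpret pair: vector_space_pair
    "\<lambda>c (v :: nat \<Rightarrow> ('v, 'a) mpol) j. const c * v j" "\<lambda>c (v :: nat \<Rightarrow> ('v, 'a) mpol) j. const c * v j" ..
  obtain E where "finite E" "F (Suc i) t \<subseteq> mfv.span E"
    using F_span by blast
  moreover have "mfv.subspace (F (Suc i) t)"
    unfolding F_def by (rule subspace_graded_free)
  moreover have "Vector_Spaces.linear (\<lambda>c v j. const c * v j) (\<lambda>c v j. const c * v j) (\<delta> (Suc i))"
    unfolding \<delta>_def by (rule linear_mat_map)
  ultimately have "mfv.dim (F (Suc i) t) =
      mfv.dim {v \<in> F (Suc i) t. \<delta> (Suc i) v = 0} + mfv.dim (\<delta> (Suc i) ` F (Suc i) t)"
    using pair.dim_eq_dim_kernel_plus_dim_image by blast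
  then show ?thesis
    by (simp only: Z_eq_image [symmetric]) (simp add: Z_def)
qed

lemma dim_F_0: "mfv.dim (F 0 t) = mfv.dim (Z 0 t) + mpv.dim (I \<inter> forms t)"
proof -
  interpret pair: vector_space_pair
    "\<lambda>c (v :: nat \<Rightarrow> ('v, 'a) mpol) j. const c * v j" "\<lambda>c (f :: ('v, 'a) mpol). const c * f" ..
  obtain E where "finite E" "F 0 t \<subseteq> mfv.span E"
    using F_span by blast
  moreover have "mfv.subspace (F 0 t)"
    unfolding F_def by (rule subspace_graded_free)
  moreover have "Vector_Spaces.linear (\<lambda>c v j. const c * v j) (\<lambda>c f. const c * f) (\<lambda>v. \<delta> 0 v 0)"
    unfolding Vector_Spaces.linear_iff
    by (intro conjI allI mfv.vector_space_axioms mpv.vector_space_axioms)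
      (simp_all add: delta_0_apply distrib_left sum.distrib sum_distrib_left mult.left_commute)
  ultimately have "mfv.dim (F 0 t) =
      mfv.dim {v \<in> F 0 t. \<delta> 0 v 0 = 0} + mpv.dim ((\<lambda>v. \<delta> 0 v 0) ` F 0 t)"
    using pair.dim_eq_dim_kernel_plus_dim_image by blast
  moreover have "{v \<in> F 0 t. \<delta> 0 v 0 = 0} = Z 0 t"
    by (auto simp: Z_def fun_eq_iff delta_0_apply)
  ultimately show ?thesis
    by (simp add: I_forms_eq_image)
qed

section \<open>Consequences of a bound on the degrees in the resolution\<close>

context
  fixes r :: nat
  assumes bound: "\<And>i j. j < b i \<Longrightarrow> a i j \<le> r + i"
begin

lemma eventually_poly_dim_F: "eventually_poly r (\<lambda>t. mfv.dim (F i t))"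
proof -
  have "eventually_poly r (\<lambda>t. card (shifted_mons (a i j) t :: 'v mon set))" if "j < b i" for j
  proof (rule eventually_poly_card_shifted_mons)
    have "CARD('v) > 0"
      by (simp add: card_gt_0_iff)
    then show "CARD('v) = (CARD('v) - 1) + 1"
      by simp
    \<comment> \<open>A nonzero rank forces \<open>i < CARD('v)\<close>, so that
      \<open>r + i\<close> stays within the range where the binomial formula is polynomial.\<close>
    have "i < CARD('v)"
      using that b_zero [of i] by (cases "i < CARD('v)") auto
    with bound [OF that] show "a i j \<le> r + (CARD('v) - 1)"
      by simp
  qed
  then have "eventually_poly r (\<lambda>t. \<Sum>j\<in>{..<b i}. card (shifted_mons (a i j) t :: 'v mon set))"
    by (intro eventually_poly_sum) simp
  then show ?thesis
    by (simp add: F_def dim_graded_free)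
qed

text \<open>Descending induction along the resolution, from \<open>i \<ge> CARD('v)\<close>, where
  the free module is zero.\<close>

lemma eventually_poly_dim_Z: "eventually_poly r (\<lambda>t. mfv.dim (Z i t))"
proof (induction "CARD('v) - i" arbitrary: i)
  case 0
  then have "Z i t \<subseteq> {0}" for t
    using b_zero [of i] by (auto simp: Z_def F_def graded_free_def fun_eq_iff)
  then have "mfv.dim (Z i t) = 0" for t
    using mfv.dim_le_card [of "Z i t" "{}"] by simp
  then show ?case
    by (auto simp: eventually_poly_def intro: exI [of _ 0])
next
  case (Suc d)
  then have "eventually_poly r (\<lambda>t. mfv.dim (Z (Suc i) t))"
    by simp
  then show ?case
    by (rule eventually_poly_diff [OF eventually_poly_dim_F [of "Suc i"] _ dim_F_Suc])
qed

lemma eventually_poly_dim_I: "eventually_poly r (\<lambda>t. mpv.dim (I \<inter> forms t))"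
  by (rule eventually_poly_diff [OF eventually_poly_dim_F eventually_poly_dim_Z dim_F_0])

lemma eventually_poly_hilbert_function: "eventually_poly r (hilbert_function I)"
proof (rule eventually_poly_diff [OF _ eventually_poly_dim_I])
  have "0 < CARD('v)"
    by (simp add: card_gt_0_iff)
  then have "eventually_poly r (\<lambda>t. card (shifted_mons 0 t :: 'v mon set))"
    by (intro eventually_poly_card_shifted_mons [of "CARD('v) - 1"]) simp_all
  then show "eventually_poly r (\<lambda>t. card (deg_mons t :: 'v mon set))"
    by simp
  show "card (deg_mons t :: 'v mon set) = mpv.dim (I \<inter> forms t) + hilbert_function I t" for t
    using dim_mono_supported [of "I \<inter> forms t" "deg_mons t"]
    by (simp add: hilbert_function_def dim_forms) (simp add: forms_eq)
qed

end

lemma D0_in_I: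
  assumes "j < b 0"
  shows "D 0 $$ (0, j) \<in> I"
proof -
  have "\<delta> 0 (\<lambda>k. if k = j then 1 else 0) 0 = D 0 $$ (0, j)"
    using assms by (simp add: delta_0_apply if_distrib cong: if_cong)
  then show ?thesis
    unfolding I_eq_range by (metis rangeI)
qed

end

text \<open>The resolution yields some polynomial that is valid from \<open>r\<close> on; it agrees
  with \<open>p\<close> at infinitely many integers and is therefore equal to
  \<open>p\<close>.\<close>

lemma regular_hilbert_function:
  assumes "regular r I" "has_hilbert_polynomial I p" "t \<ge> r"
  shows "of_nat (hilbert_function I t) = poly p (of_nat t)"
proof -
  obtain b a D where res: "minimal_graded_free_resolution I b a D" and bound: "\<forall>i. \<forall>j<b i. a i j \<le> r + i"
    using assms(1) unfolding regular_def by blast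
  interpret graded_resolution I b a D
    using res by unfold_locales
  obtain h :: "rat poly" where h: "\<And>t. t \<ge> r \<Longrightarrow> of_nat (hilbert_function I t) = poly h (of_nat t)"
    using eventually_poly_hilbert_function [of r] bound unfolding eventually_poly_def by blast
  obtain N where N: "\<And>t. t \<ge> N \<Longrightarrow> of_nat (hilbert_function I t) = poly p (of_nat t)"
    using assms(2) unfolding has_hilbert_polynomial_def by blast
  have "h - p = 0"
  proof (rule ccontr)
    assume "h - p \<noteq> 0"
    then have "finite {x. poly (h - p) x = 0}"
      by (rule poly_roots_finite)
    moreover have "of_nat ` {max r N..} \<subseteq> {x. poly (h - p) x = 0}"
      using h N by auto (metis)
    ultimately have "finite (of_nat ` {max r N..} :: rat set)"
      by (rule rev_finite_subset)
    then have "finite {max r N..}"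
      by (rule finite_imageD) (simp add: inj_on_def)
    then obtain M where M: "\<forall>x\<in>{max r N..}. x < M"
      unfolding finite_nat_set_iff_bounded by blast
    show False
      using bspec [OF M, of "max r N + M"] by simp
  qed
  with h [OF assms(3)] show ?thesis
    by simp
qed

text \<open>The monomial \<open>s\<close> is a combination of the generators
  \<open>D 0 $$ (0, j)\<close>, hence a multiple of a term \<open>x\<close> of one of them. All
  terms of elements of a monomial ideal lie in \<open>U\<close>, and \<open>x\<close> has degree at
  most \<open>r\<close>; padding \<open>x\<close> with a part of the cofactor reaches degree
  \<open>m\<close>.\<close>

lemma regular_supported_generated:
  fixes U :: "'v::finite mon set"
  assumes "regular r (supported U :: ('v, 'a::field) mpol set)" "upset U" "s \<in> U" "r \<le> m" "m \<le> mon_deg s"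
  obtains u w where "u \<in> U" "mon_deg u = m" "s = u + w"
proof -
  obtain b a D where res: "minimal_graded_free_resolution (supported U :: ('v, 'a) mpol set) b a D"
    and bound: "\<forall>i. \<forall>j<b i. a i j \<le> r + i"
    using assms(1) unfolding regular_def by blast
  interpret graded_resolution "supported U :: ('v, 'a) mpol set" b a D
    using res by unfold_locales
  have "(monomial s :: ('v, 'a) mpol) \<in> supported U"
    using assms(3) by (simp add: supported_def)
  then obtain v where "monomial s = \<delta> 0 v 0"
    using I_eq_range by blast
  then have "s \<in> Poly_Mapping.keys (\<Sum>j<b 0. D 0 $$ (0, j) * v j)"
    by (metis delta_0_apply keys_monomial singletonI)
  then obtain j where j: "j < b 0" "s \<in> Poly_Mapping.keys (D 0 $$ (0, j) * v j)"
    using Poly_Mapping.keys_sum [of "\<lambda>j. D 0 $$ (0, j) * v j" "{..<b 0}"] by blast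
  then obtain x y where xy: "s = x + y" "x \<in> Poly_Mapping.keys (D 0 $$ (0, j))"
    using keys_mult_subset by blast
  have x: "x \<in> U"
    using D0_in_I [OF j(1)] xy(2) by (auto simp: supported_def)
  have "mon_deg x = a 0 j"
    using D0_forms [OF j(1)] xy(2) by (auto simp: forms_def)
  with bound j(1) have "mon_deg x \<le> r"
    by fastforce
  with assms(4,5) xy(1) have "mon_deg y = (m - mon_deg x) + (mon_deg s - m)"
    by simp
  then obtain y1 y2 where y: "y = y1 + y2" "mon_deg y1 = m - mon_deg x"
    using mon_split by blast
  show thesis
  proof (rule that)
    show "x + y1 \<in> U"
      using assms(2) x by (simp add: upset_def)
    show "mon_deg (x + y1) = m"
      using \<open>mon_deg x \<le> r\<close> assms(4) y(2) by simp
    show "s = x + y1 + y2"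
      using xy(1) y(1) by (simp add: add.assoc)
  qed
qed

section \<open>Linear changes of coordinates\<close>

lemma mpol_eval_superset:
  assumes "finite A" "Poly_Mapping.keys f \<subseteq> A" "\<phi> 0 = 0"
  shows "mpol_eval \<phi> x f = (\<Sum>t\<in>A. \<phi> (Poly_Mapping.lookup f t) *
      (\<Prod>i\<in>Poly_Mapping.keys t. x i ^ Poly_Mapping.lookup t i))"
  unfolding mpol_eval_def using assms
  by (intro sum.mono_neutral_left) (auto simp: in_keys_iff)

lemma mon_prod_superset:
  fixes x :: "'v \<Rightarrow> 'r::comm_semiring_1"
  assumes "finite A" "Poly_Mapping.keys t \<subseteq> A"
  shows "(\<Prod>i\<in>Poly_Mapping.keys t. x i ^ Poly_Mapping.lookup t i) = (\<Prod>i\<in>A. x i ^ Poly_Mapping.lookup t i)"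
  using assms by (intro prod.mono_neutral_left) (auto simp: in_keys_iff)

definition mon_eval :: "('v \<Rightarrow> 'r::comm_semiring_1) \<Rightarrow> ('v \<Rightarrow>\<^sub>0 nat) \<Rightarrow> 'r" where
  "mon_eval x t = (\<Prod>i\<in>Poly_Mapping.keys t. x i ^ Poly_Mapping.lookup t i)"

lemma mon_eval_add: "mon_eval x (s + t) = mon_eval x s * mon_eval x t"
proof -
  let ?A = "Poly_Mapping.keys s \<union> Poly_Mapping.keys t"
  have "mon_eval x (s + t) = (\<Prod>i\<in>?A. x i ^ Poly_Mapping.lookup (s + t) i)"
    unfolding mon_eval_def using Poly_Mapping.keys_add [of s t] by (intro mon_prod_superset) auto
  also have "\<dots> = (\<Prod>i\<in>?A. x i ^ Poly_Mapping.lookup s i) * (\<Prod>i\<in>?A. x i ^ Poly_Mapping.lookup t i)"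
    by (simp add: lookup_add power_add prod.distrib)
  also have "\<dots> = mon_eval x s * mon_eval x t"
    unfolding mon_eval_def by (subst (1 2) mon_prod_superset [of ?A]) auto
  finally show ?thesis .
qed

lemma mpol_eval_add:
  fixes f g :: "('v, 'a::field) mpol" and x :: "'v \<Rightarrow> 'r::comm_ring_1"
  assumes "\<phi> 0 = 0" "\<And>a b. \<phi> (a + b) = \<phi> a + \<phi> b"
  shows "mpol_eval \<phi> x (f + g) = mpol_eval \<phi> x f + mpol_eval \<phi> x g"
proof -
  let ?A = "Poly_Mapping.keys f \<union> Poly_Mapping.keys g"
  note S = mpol_eval_superset [of ?A _ \<phi>, OF _ _ assms(1)]
  have "Poly_Mapping.keys (f + g) \<subseteq> ?A"
    by (rule Poly_Mapping.keys_add)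
  then show ?thesis
    by (simp add: S lookup_add assms(2) distrib_right sum.distrib)
qed

context
  fixes \<iota> :: "'k::field \<Rightarrow> 'f::field" and g :: "'k ^ 'v ^ ('v::finite)"
begin

definition gl_var :: "'v \<Rightarrow> ('v, 'f) mpol" where
  "gl_var i = (\<Sum>j\<in>UNIV. const (\<iota> (vec_nth (vec_nth g i) j)) * monomial (var_mon j))"

lemma gl_act_eq:
  "gl_act \<iota> g f = (\<Sum>t\<in>Poly_Mapping.keys f. const (Poly_Mapping.lookup f t) * mon_eval gl_var t)"
  by (simp add: gl_act_def mpol_eval_def mon_eval_def gl_var_def [abs_def])

lemma gl_act_add: "gl_act \<iota> g (f + h) = gl_act \<iota> g f + gl_act \<iota> g h"
  unfolding gl_act_def by (rule mpol_eval_add) (simp_all add: const_def single_add)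

lemma gl_act_0 [simp]: "gl_act \<iota> g 0 = 0"
  by (simp add: gl_act_eq)

lemma gl_act_sum: "gl_act \<iota> g (sum F A) = (\<Sum>x\<in>A. gl_act \<iota> g (F x))"
  by (induction A rule: infinite_finite_induct) (simp_all add: gl_act_add)

lemma gl_act_scaled_monomial: "gl_act \<iota> g (const c * monomial t) = const c * mon_eval gl_var t"
proof (cases "c = 0")
  case True
  then show ?thesis by (simp add: const_def)
next
  case False
  then have "Poly_Mapping.keys (const c * monomial t :: ('v, 'f) mpol) = {t}"
    by (auto simp: in_keys_iff split: if_splits)
  then show ?thesis
    by (simp add: gl_act_eq)
qed

text \<open>By bilinearity it is enough to treat products of two scaled monomials, where exponents
  add.\<close>

lemma gl_act_mult: "gl_act \<iota> g (f * h) = gl_act \<iota> g f * gl_act \<iota> g h"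
proof -
  let ?F = "\<lambda>s. const (Poly_Mapping.lookup f s) * monomial s"
  let ?H = "\<lambda>t. const (Poly_Mapping.lookup h t) * monomial t"
  have 0: "?F s * ?H t = const (Poly_Mapping.lookup f s * Poly_Mapping.lookup h t) * monomial (s + t)" for s t
    by (simp add: const_def monomial_def mult_single)
  have 1: "gl_act \<iota> g (?F s * ?H t) = gl_act \<iota> g (?F s) * gl_act \<iota> g (?H t)" for s t
  proof -
    have "gl_act \<iota> g (?F s) * gl_act \<iota> g (?H t) =
        (const (Poly_Mapping.lookup f s) * mon_eval gl_var s) * (const (Poly_Mapping.lookup h t) * mon_eval gl_var t)"
      by (simp only: gl_act_scaled_monomial)
    also have "\<dots> =
        (const (Poly_Mapping.lookup f s) * const (Poly_Mapping.lookup h t)) * (mon_eval gl_var s * mon_eval gl_var t)"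
      by (simp only: mult_ac)
    also have "\<dots> = gl_act \<iota> g (?F s * ?H t)"
      by (simp only: 0 gl_act_scaled_monomial mon_eval_add const_mult_const)
    finally show ?thesis ..
  qed
  have f: "f = (\<Sum>s\<in>Poly_Mapping.keys f. ?F s)" and h: "h = (\<Sum>t\<in>Poly_Mapping.keys h. ?H t)"
    by (simp_all add: mpol_expansion [symmetric])
  have "gl_act \<iota> g ((\<Sum>s\<in>Poly_Mapping.keys f. ?F s) * (\<Sum>t\<in>Poly_Mapping.keys h. ?H t)) =
      gl_act \<iota> g (\<Sum>s\<in>Poly_Mapping.keys f. ?F s) * gl_act \<iota> g (\<Sum>t\<in>Poly_Mapping.keys h. ?H t)"
    unfolding sum_product gl_act_sum 1 ..
  then show ?thesis
    by (simp only: f [symmetric] h [symmetric])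
qed

lemma gl_act_const: "gl_act \<iota> g (const c) = const c"
  using gl_act_scaled_monomial [of c 0] by (simp add: monomial_def mon_eval_def)

lemma gl_act_monomial: "gl_act \<iota> g (monomial t) = mon_eval gl_var t"
  using gl_act_scaled_monomial [of 1 t] by (simp add: const_def)

lemma gl_act_scale: "gl_act \<iota> g (const c * f) = const c * gl_act \<iota> g f"
  by (simp add: gl_act_mult gl_act_const)

lemma gl_act_var: "gl_act \<iota> g (monomial (var_mon i)) = gl_var i"
  by (simp add: gl_act_monomial mon_eval_def var_mon_def)

lemma gl_act_1: "gl_act \<iota> g 1 = 1"
  using gl_act_const [of 1] by (simp add: const_def)

lemma gl_act_power: "gl_act \<iota> g (f ^ k) = gl_act \<iota> g f ^ k"
  by (induction k) (simp_all add: gl_act_1 gl_act_mult)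

lemma gl_act_prod: "gl_act \<iota> g (prod F A) = (\<Prod>x\<in>A. gl_act \<iota> g (F x))"
  by (induction A rule: infinite_finite_induct) (simp_all add: gl_act_mult gl_act_1)

end

lemma forms_mult: "f \<in> forms a \<Longrightarrow> g \<in> forms b \<Longrightarrow> f * g \<in> forms (a + b)"
  unfolding forms_def using keys_mult_subset [of f g] by fastforce

lemma one_in_forms: "(1 :: ('v, 'a::field) mpol) \<in> forms 0"
  by (simp add: forms_def)

lemma forms_power: "f \<in> forms a \<Longrightarrow> f ^ k \<in> forms (k * a)"
  for f :: "('v, 'a::field) mpol"
  by (induction k) (simp_all add: one_in_forms forms_mult)

lemma subspace_forms: "mpv.subspace (forms d :: ('v, 'a::field) mpol set)"
  unfolding forms_eq by (rule subspace_supported)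

lemma mon_eval_in_forms:
  fixes x :: "'v \<Rightarrow> ('w, 'a::field) mpol"
  assumes "\<And>i. x i \<in> forms 1"
  shows "mon_eval x t \<in> forms (mon_deg t)"
proof -
  have "(\<Prod>i\<in>A. x i ^ Poly_Mapping.lookup t i) \<in> forms (\<Sum>i\<in>A. Poly_Mapping.lookup t i)" for A
  proof (induction A rule: infinite_finite_induct)
    case (insert i A)
    then show ?case
      using forms_mult [OF forms_power [OF assms [of i], of "Poly_Mapping.lookup t i"] insert.IH] by simp
  qed (simp_all add: one_in_forms)
  then show ?thesis
    by (simp add: mon_eval_def mon_deg_def)
qed

lemma gl_var_in_forms: "gl_var \<iota> g i \<in> forms 1"
  unfolding gl_var_def
  by (intro mpv.subspace_sum mpv.subspace_scale subspace_forms) (simp add: forms_def)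

lemma gl_act_in_forms:
  assumes "f \<in> forms d"
  shows "gl_act \<iota> g f \<in> forms d"
  unfolding gl_act_eq
proof (intro mpv.subspace_sum mpv.subspace_scale subspace_forms)
  fix t assume "t \<in> Poly_Mapping.keys f"
  with assms have "mon_deg t = d"
    by (simp add: forms_def)
  with mon_eval_in_forms [of "gl_var \<iota> g" t] gl_var_in_forms show "mon_eval (gl_var \<iota> g) t \<in> forms d"
    by blast
qed

lemma mon_eval_vars: "mon_eval (\<lambda>i. monomial (var_mon i)) t = (monomial t :: ('v, 'a::field) mpol)"
proof -
  have pow: "monomial (var_mon i) ^ k = (monomial (Poly_Mapping.single i k) :: ('v, 'a) mpol)" for i k
  proof (induction k)
    case (Suc k)
    then show ?case
      by (simp add: monomial_def mult_single var_mon_def flip: single_add)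
  qed (simp add: monomial_def)
  have "(\<Prod>i\<in>A. monomial (var_mon i) ^ Poly_Mapping.lookup t i) =
      (monomial (\<Sum>i\<in>A. Poly_Mapping.single i (Poly_Mapping.lookup t i)) :: ('v, 'a) mpol)" for A
  proof (induction A rule: infinite_finite_induct)
    case (insert i A)
    then show ?case
      by (simp add: pow) (simp add: monomial_def mult_single)
  qed (simp_all add: monomial_def)
  moreover have "(\<Sum>i\<in>Poly_Mapping.keys t. Poly_Mapping.single i (Poly_Mapping.lookup t i)) = t"
  proof (rule poly_mapping_eqI)
    fix j
    show "Poly_Mapping.lookup (\<Sum>i\<in>Poly_Mapping.keys t. Poly_Mapping.single i (Poly_Mapping.lookup t i)) j =
        Poly_Mapping.lookup t j"
      by (simp add: lookup_sum lookup_single when_def in_keys_iff)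
  qed
  ultimately show ?thesis
    by (simp add: mon_eval_def)
qed

lemma const_sum: "const (sum c A) = (\<Sum>j\<in>A. const (c j) :: ('v, 'a::field) mpol)"
  by (induction A rule: infinite_finite_induct) (simp_all add: const_def single_add)

lemma gl_act_compose_var:
  assumes "field_hom \<iota>"
  shows "gl_act \<iota> g (gl_var \<iota> h i) = gl_var \<iota> (h ** g) i"
proof -
  interpret field_hom \<iota> by (rule assms)
  have "gl_act \<iota> g (gl_var \<iota> h i) =
      (\<Sum>j\<in>UNIV. const (\<iota> (vec_nth (vec_nth h i) j)) * (\<Sum>k\<in>UNIV. const (\<iota> (vec_nth (vec_nth g j) k)) * monomial (var_mon k)))"
    by (simp add: gl_var_def [of \<iota> h] gl_act_sum gl_act_scale gl_act_var gl_var_def)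
  also have "\<dots> = (\<Sum>k\<in>UNIV. \<Sum>j\<in>UNIV. const (\<iota> (vec_nth (vec_nth h i) j) * \<iota> (vec_nth (vec_nth g j) k)) * monomial (var_mon k))"
    by (subst sum.swap) (simp add: sum_distrib_left)
  also have "\<dots> = (\<Sum>k\<in>UNIV. const (\<Sum>j\<in>UNIV. \<iota> (vec_nth (vec_nth h i) j) * \<iota> (vec_nth (vec_nth g j) k)) * monomial (var_mon k))"
    by (simp only: const_sum sum_distrib_right)
  also have "\<dots> = gl_var \<iota> (h ** g) i"
    by (simp add: gl_var_def matrix_matrix_mult_def hom_sum hom_mult)
  finally show ?thesis .
qed

text \<open>Substitution reverses the order: the linear forms given by the rows of \<open>h\<close>
  are rewritten by means of \<open>g\<close>, which produces the rows of
  \<open>h ** g\<close>.\<close>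

lemma gl_act_compose:
  assumes "field_hom \<iota>"
  shows "gl_act \<iota> g (gl_act \<iota> h f) = gl_act \<iota> (h ** g) f"
proof -
  have "gl_act \<iota> g (mon_eval (gl_var \<iota> h) t) = mon_eval (gl_var \<iota> (h ** g)) t" for t
    by (simp add: mon_eval_def gl_act_prod gl_act_power gl_act_compose_var [OF assms])
  then show ?thesis
    by (simp add: gl_act_eq [of \<iota> h] gl_act_eq [of \<iota> "h ** g"] gl_act_sum gl_act_scale)
qed

lemma gl_act_mat_1:
  fixes \<iota> :: "'k::field \<Rightarrow> 'f::field" and f :: "('v::finite, 'f) mpol"
  assumes "field_hom \<iota>"
  shows "gl_act \<iota> (Finite_Cartesian_Product.mat 1) f = f"
proof -
  interpret field_hom \<iota> by (rule assms)
  have "gl_var \<iota> (Finite_Cartesian_Product.mat 1) i = monomial (var_mon i)" for i :: 'v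
  proof -
    have "gl_var \<iota> (Finite_Cartesian_Product.mat 1) i = (\<Sum>j\<in>UNIV. if j = i then monomial (var_mon j) else 0)"
      unfolding gl_var_def by (intro sum.cong) (auto simp: Finite_Cartesian_Product.mat_def const_def)
    then show ?thesis by simp
  qed
  then have "gl_var \<iota> (Finite_Cartesian_Product.mat 1) = (\<lambda>i :: 'v. monomial (var_mon i))"
    by (rule ext)
  then have "mon_eval (gl_var \<iota> (Finite_Cartesian_Product.mat 1)) t = monomial t"
    for t :: "'v mon"
    by (simp only: mon_eval_vars)
  then show ?thesis
    by (simp add: gl_act_eq mpol_expansion [symmetric])
qed

text \<open>Collects what is used of a linear change of coordinates. Carrying the inverse as a
  second parameter turns membership in an image into a condition on \<open>\<psi> f\<close>, and
  lets results about \<open>\<phi>\<close> be applied to \<open>\<psi>\<close>.\<close>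

locale graded_automorphism =
  fixes \<phi> \<psi> :: "('v::finite, 'a::field) mpol \<Rightarrow> ('v, 'a) mpol"
  assumes \<phi>_add: "\<phi> (f + g) = \<phi> f + \<phi> g"
    and \<phi>_mult: "\<phi> (f * g) = \<phi> f * \<phi> g"
    and \<phi>_scale: "\<phi> (const c * f) = const c * \<phi> f"
    and \<phi>_forms: "f \<in> forms d \<Longrightarrow> \<phi> f \<in> forms d"
    and \<psi>_add: "\<psi> (f + g) = \<psi> f + \<psi> g"
    and \<psi>_mult: "\<psi> (f * g) = \<psi> f * \<psi> g"
    and \<psi>_forms: "f \<in> forms d \<Longrightarrow> \<psi> f \<in> forms d"
    and \<phi>\<psi> [simp]: "\<phi> (\<psi> f) = f"
    and \<psi>\<phi> [simp]: "\<psi> (\<phi> f) = f"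
begin

lemma inj_\<phi>: "inj \<phi>"
  by (rule inj_on_inverseI [of _ \<psi>]) simp

lemma linear_\<phi>: "Vector_Spaces.linear (\<lambda>c f. const c * f) (\<lambda>c f. const c * f) \<phi>"
  unfolding Vector_Spaces.linear_iff
  by (intro conjI allI mpv.vector_space_axioms) (simp_all add: \<phi>_add \<phi>_scale)

lemma image_iff_inverse: "f \<in> \<phi> ` X \<longleftrightarrow> \<psi> f \<in> X"
proof
  assume "\<psi> f \<in> X"
  then have "\<phi> (\<psi> f) \<in> \<phi> ` X"
    by (rule imageI)
  then show "f \<in> \<phi> ` X"
    by simp
qed auto

lemma image_Int_forms: "\<phi> ` I \<inter> forms d = \<phi> ` (I \<inter> forms d)"
proof
  show "\<phi> ` I \<inter> forms d \<subseteq> \<phi> ` (I \<inter> forms d)"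
    by (intro subsetI) (simp add: image_iff_inverse \<psi>_forms)
  show "\<phi> ` (I \<inter> forms d) \<subseteq> \<phi> ` I \<inter> forms d"
    using \<phi>_forms by auto
qed

lemma dim_image: "mpv.dim (\<phi> ` V) = mpv.dim V"
proof -
  interpret pair: vector_space_pair
    "\<lambda>c (f :: ('v, 'a) mpol). const c * f" "\<lambda>c (f :: ('v, 'a) mpol). const c * f" ..
  interpret lin: Vector_Spaces.linear
    "\<lambda>c (f :: ('v, 'a) mpol). const c * f" "\<lambda>c (f :: ('v, 'a) mpol). const c * f" \<phi>
    by (rule linear_\<phi>)
  obtain B where B: "B \<subseteq> V" "mpv.independent B" "V \<subseteq> mpv.span B" "card B = mpv.dim V"
    using mpv.basis_exists by blast
  have "mpv.independent (\<phi> ` B)"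
    by (rule lin.independent_inj_image [OF B(2) inj_\<phi>])
  moreover have "\<phi> ` V \<subseteq> mpv.span (\<phi> ` B)"
    using B(3) lin.span_image [of B] by blast
  ultimately have "card (\<phi> ` B) = mpv.dim (\<phi> ` V)"
    using B(1) by (intro mpv.basis_card_eq_dim) auto
  then show ?thesis
    using B(4) by (simp add: card_image inj_on_subset [OF inj_\<phi>])
qed

lemma ideal_image:
  assumes "idl.subspace I"
  shows "idl.subspace (\<phi> ` I)"
proof (rule idl.subspaceI)
  have "\<phi> 0 = 0"
    using \<phi>_add [of 0 0] by simp
  then show "0 \<in> \<phi> ` I"
    using idl.subspace_0 [OF assms] by (metis imageI)
  show "f + g \<in> \<phi> ` I" if "f \<in> \<phi> ` I" "g \<in> \<phi> ` I" for f g
    using that by (simp add: image_iff_inverse \<psi>_add idl.subspace_add [OF assms])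
  show "c * f \<in> \<phi> ` I" if "f \<in> \<phi> ` I" for c f
    using that by (simp add: image_iff_inverse \<psi>_mult idl.subspace_scale [OF assms])
qed

end

lemma graded_automorphism_sym:
  assumes "graded_automorphism \<phi> \<psi>"
  shows "graded_automorphism \<psi> \<phi>"
proof -
  interpret graded_automorphism \<phi> \<psi> by (rule assms)
  have "\<psi> (const c * f) = const c * \<psi> f" for c f
  proof -
    have "\<psi> (\<phi> (const c * \<psi> f)) = \<psi> (const c * f)"
      by (simp only: \<phi>_scale \<phi>\<psi>)
    then show ?thesis by simp
  qed
  then show ?thesis
    by unfold_locales (simp_all add: \<phi>_add \<phi>_mult \<phi>_forms \<psi>_add \<psi>_mult \<psi>_forms)
qed

context graded_automorphism
begin

lemma gen_ideal_image: "\<phi> ` gen_ideal B = gen_ideal (\<phi> ` B)"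
proof
  interpret inv: graded_automorphism \<psi> \<phi>
    by (rule graded_automorphism_sym) unfold_locales
  show "gen_ideal (\<phi> ` B) \<subseteq> \<phi> ` gen_ideal B"
    by (intro gen_ideal_minimal ideal_image ideal_gen_ideal image_mono gen_ideal_superset)
  have "B \<subseteq> \<psi> ` gen_ideal (\<phi> ` B)"
    using gen_ideal_superset [of "\<phi> ` B"] by (auto simp: inv.image_iff_inverse)
  then have sub: "gen_ideal B \<subseteq> \<psi> ` gen_ideal (\<phi> ` B)"
    by (intro gen_ideal_minimal inv.ideal_image ideal_gen_ideal)
  show "\<phi> ` gen_ideal B \<subseteq> gen_ideal (\<phi> ` B)"
  proof safe
    fix f assume "f \<in> gen_ideal B"
    with sub show "\<phi> f \<in> gen_ideal (\<phi> ` B)"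
      using inv.image_iff_inverse by blast
  qed
qed

text \<open>Both maps preserve \<open>forms k\<close>, so the condition on all multipliers of degree
  \<open>k\<close> can be transported.\<close>

lemma saturation_image: "saturation (\<phi> ` I) = \<phi> ` saturation I"
proof (intro Set.set_eqI)
  fix f
  have "(\<forall>g\<in>forms k. g * f \<in> \<phi> ` I) \<longleftrightarrow> (\<forall>g\<in>forms k. g * \<psi> f \<in> I)" for k
  proof
    assume *: "\<forall>g\<in>forms k. g * f \<in> \<phi> ` I"
    show "\<forall>g\<in>forms k. g * \<psi> f \<in> I"
    proof
      fix g :: "('v, 'a) mpol" assume "g \<in> forms k"
      then have "\<phi> g * f \<in> \<phi> ` I"
        using * \<phi>_forms by blast
      then show "g * \<psi> f \<in> I"
        by (simp add: image_iff_inverse \<psi>_mult)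
    qed
  next
    assume *: "\<forall>g\<in>forms k. g * \<psi> f \<in> I"
    show "\<forall>g\<in>forms k. g * f \<in> \<phi> ` I"
      using * \<psi>_forms by (simp add: image_iff_inverse \<psi>_mult)
  qed
  then show "f \<in> saturation (\<phi> ` I) \<longleftrightarrow> f \<in> \<phi> ` saturation I"
    by (simp add: image_iff_inverse saturation_def)
qed

lemma saturated_ideals_image:
  assumes "I \<in> saturated_ideals p"
  shows "\<phi> ` I \<in> saturated_ideals p"
proof -
  obtain B where B: "B \<subseteq> (\<Union>d. forms d)" "I = gen_ideal B"
    using assms unfolding saturated_ideals_def homogeneous_ideal_def by blast
  have "homogeneous_ideal (\<phi> ` I)"
    unfolding homogeneous_ideal_def B(2) gen_ideal_image
    using B(1) \<phi>_forms by (intro exI [of _ "\<phi> ` B"]) blast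
  moreover have "saturation (\<phi> ` I) = \<phi> ` I"
    using assms by (simp add: saturation_image saturated_ideals_def)
  moreover have "has_hilbert_polynomial (\<phi> ` I) p"
    using assms
    by (simp add: saturated_ideals_def has_hilbert_polynomial_def hilbert_function_def
        image_Int_forms dim_image)
  ultimately show ?thesis
    by (simp add: saturated_ideals_def)
qed

text \<open>Dimension, saturation and Hilbert function are invariant under a graded automorphism.
  This keeps the orbit of \<open>W\<close> inside the Hilbert scheme.\<close>

lemma hilb_image:
  assumes "V \<in> hilb p q m"
  shows "\<phi> ` V \<in> hilb p q m"
proof -
  obtain I where I: "V \<in> grassmannian q m" "I \<in> saturated_ideals p" "V = hilb_point m I"
    using assms unfolding hilb_def by blast
  interpret lin: Vector_Spaces.linear
    "\<lambda>c (f :: ('v, 'a) mpol). const c * f" "\<lambda>c (f :: ('v, 'a) mpol). const c * f" \<phi>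
    by (rule linear_\<phi>)
  have "\<phi> ` V \<in> grassmannian q m"
    using I(1) \<phi>_forms lin.subspace_image by (auto simp: grassmannian_def dim_image)
  moreover have "\<phi> ` V = hilb_point m (\<phi> ` I)"
    unfolding I(3) hilb_point_def saturation_image image_Int_forms ..
  ultimately show ?thesis
    using saturated_ideals_image [OF I(2)] unfolding hilb_def by blast
qed

end

lemma graded_automorphism_gl_act:
  assumes "field_hom \<iota>" "g ** h = Finite_Cartesian_Product.mat 1" "h ** g = Finite_Cartesian_Product.mat 1"
  shows "graded_automorphism (gl_act \<iota> g) (gl_act \<iota> h)"
  by unfold_locales
    (simp_all add: gl_act_add gl_act_mult gl_act_const gl_act_in_forms gl_act_compose assms gl_act_mat_1)

lemma gl_act_hilb:
  fixes g :: "'k::field ^ 'v ^ ('v::finite)"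
  assumes "field_hom \<iota>" "invertible g" "V \<in> hilb p q m"
  shows "gl_act \<iota> g ` V \<in> hilb p q m"
proof -
  obtain h where h: "g ** h = Finite_Cartesian_Product.mat 1" "h ** g = Finite_Cartesian_Product.mat 1"
    using assms(2) unfolding invertible_def by blast
  interpret graded_automorphism "gl_act \<iota> g" "gl_act \<iota> h"
    by (rule graded_automorphism_gl_act [OF assms(1) h])
  show ?thesis
    by (rule hilb_image [OF assms(3)])
qed

section \<open>Initial exterior products\<close>

lemma wedgesD:
  assumes "L \<in> wedges lt q m"
  shows "length L = q" "t \<in> set L \<Longrightarrow> mon_deg t = m" "sorted_wrt (\<lambda>s t. lt t s) L"
  using assms by (simp_all add: wedges_def)

lemma distinct_wedge:
  assumes "term_order lt" "L \<in> wedges lt q m"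
  shows "distinct L"
proof -
  have "sorted_wrt (\<noteq>) L"
    using wedgesD(3) [OF assms(2)]
    by (rule sorted_wrt_mono_rel [rotated]) (use term_order_irrefl [OF assms(1)] in auto)
  then show ?thesis
    by (simp add: distinct_conv_nth sorted_wrt_iff_nth_less linorder_neq_iff) metis
qed

lemma finite_wedges: "finite (wedges lt q m :: 'v::finite mon list set)"
proof (rule finite_subset)
  show "wedges lt q m \<subseteq> {L. set L \<subseteq> deg_mons m \<and> length L = q}"
    by (auto simp: wedges_def)
  show "finite {L. set L \<subseteq> (deg_mons m :: 'v mon set) \<and> length L = q}"
    by (rule finite_lists_length_eq) simp
qed

lemma wedge_less_asym:
  assumes "term_order lt" "length L = length M" "wedge_less lt L M"
  shows "\<not> wedge_less lt M L"
proof
  assume "wedge_less lt M L"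
  then obtain i where i: "\<forall>k<i. M ! k = L ! k" "lt (M ! i) (L ! i)"
    unfolding wedge_less_def by blast
  obtain j where j: "\<forall>k<j. L ! k = M ! k" "lt (L ! j) (M ! j)"
    using assms(3) unfolding wedge_less_def by blast
  consider "i < j" | "i = j" | "j < i"
    by linarith
  then show False
    using i j term_order_irrefl [OF assms(1)] term_order_asym [OF assms(1)] by cases auto
qed

lemma wedge_less_trans:
  assumes "term_order lt" "length L = length M" "wedge_less lt L M" "wedge_less lt M N"
  shows "wedge_less lt L N"
proof -
  obtain i where i: "i < length L" "\<forall>k<i. L ! k = M ! k" "lt (L ! i) (M ! i)"
    using assms(3) unfolding wedge_less_def by blast
  obtain j where j: "j < length M" "\<forall>k<j. M ! k = N ! k" "lt (M ! j) (N ! j)"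
    using assms(4) unfolding wedge_less_def by blast
  have "lt (L ! min i j) (N ! min i j)"
  proof (cases i j rule: linorder_cases)
    case equal
    then show ?thesis
      using term_order_trans [OF assms(1) i(3)] j(3) by simp
  qed (use i j in \<open>simp_all add: min_def\<close>)
  then show ?thesis
    unfolding wedge_less_def using i j by (intro exI [of _ "min i j"]) auto
qed

lemma wedge_less_total:
  assumes "term_order lt" "length L = length M" "L \<noteq> M"
  shows "wedge_less lt L M \<or> wedge_less lt M L"
proof -
  define j where "j = (LEAST j. j < length L \<and> L ! j \<noteq> M ! j)"
  have "\<exists>j. j < length L \<and> L ! j \<noteq> M ! j"
    using assms(2,3) nth_equalityI by blast
  then have j: "j < length L" "L ! j \<noteq> M ! j"
    unfolding j_def by (rule LeastI2_ex, simp)+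
  have "L ! k = M ! k" if "k < j" for k
    using not_less_Least [of k "\<lambda>j. j < length L \<and> L ! j \<noteq> M ! j"] that j(1) unfolding j_def by auto
  with j term_order_total [OF assms(1) j(2)] assms(2) show ?thesis
    unfolding wedge_less_def by auto
qed

text \<open>\<open>W\<close> may be infinite, but there are only finitely many wedges, so a greatest
  one exists; asymmetry of the order makes it unique, as the definite description requires.\<close>

lemma initial_greatest:
  fixes W :: "('v::finite, 'a::field) mpol set set"
  assumes lt: "term_order lt"
    and ex: "L0 \<in> wedges lt q m" "chart q m L0 \<inter> W \<noteq> {}"
  shows "initial lt q m W \<in> wedges lt q m" "chart q m (initial lt q m W) \<inter> W \<noteq> {}"
    "\<And>M. M \<in> wedges lt q m \<Longrightarrow> chart q m M \<inter> W \<noteq> {} \<Longrightarrow> M \<noteq> initial lt q m W \<Longrightarrow>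
       wedge_less lt M (initial lt q m W)"
proof -
  define A where "A = {L \<in> wedges lt q m. chart q m L \<inter> W \<noteq> {}}"
  have len: "length L = q" if "L \<in> A" for L
    using that by (simp add: A_def wedges_def)
  have "finite A"
    by (rule finite_subset [OF _ finite_wedges [of lt q m]]) (auto simp: A_def)
  moreover have "A \<noteq> {}"
    using ex by (auto simp: A_def)
  moreover have "transp_on A (wedge_less lt)"
    by (intro transp_onI) (metis len lt wedge_less_trans)
  moreover have "totalp_on A (wedge_less lt)"
    by (intro totalp_onI) (metis len lt wedge_less_total)
  ultimately obtain G where G: "G \<in> A" "\<forall>M\<in>A. M \<noteq> G \<longrightarrow> wedge_less lt M G"
    using Finite_Set.bex_greatest_element [of A "wedge_less lt"] by blast
  have "initial lt q m W = G"
    unfolding initial_def Let_def A_def [symmetric]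
  proof (rule the_equality)
    fix L assume L: "L \<in> A \<and> (\<forall>M\<in>A. M \<noteq> L \<longrightarrow> wedge_less lt M L)"
    show "L = G"
    proof (rule ccontr)
      assume "L \<noteq> G"
      with L G have "wedge_less lt L G" "wedge_less lt G L"
        by auto
      moreover have "length L = length G"
        using L G(1) len by simp
      ultimately show False
        using wedge_less_asym [OF lt] by blast
    qed
  qed (use G in simp)
  with G show "initial lt q m W \<in> wedges lt q m" "chart q m (initial lt q m W) \<inter> W \<noteq> {}"
    "\<And>M. M \<in> wedges lt q m \<Longrightarrow> chart q m M \<inter> W \<noteq> {} \<Longrightarrow> M \<noteq> initial lt q m W \<Longrightarrow>
       wedge_less lt M (initial lt q m W)"
    by (auto simp: A_def)
qed

lemma ex_wedge_of_set:
  assumes "term_order lt" "finite E" "\<And>t. t \<in> E \<Longrightarrow> mon_deg t = m"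
  shows "\<exists>L\<in>wedges lt (card E) m. set L = E"
  using assms(2,3)
proof (induction "card E" arbitrary: E)
  case 0
  then show ?case
    by (intro bexI [of _ "[]"]) (auto simp: wedges_def)
next
  case (Suc c)
  then have "E \<noteq> {}"
    by auto
  then obtain g where g: "g \<in> E" "\<And>x. x \<in> E \<Longrightarrow> x \<noteq> g \<Longrightarrow> lt x g"
    using term_order_greatest [OF assms(1) Suc.prems(1)] by blast
  have c: "c = card (E - {g})"
    using Suc.hyps(2) g(1) Suc.prems(1) by simp
  obtain L where L: "L \<in> wedges lt (card (E - {g})) m" "set L = E - {g}"
    using Suc.hyps(1) [OF c] Suc.prems by blast
  have "g # L \<in> wedges lt (card E) m"
    using L g Suc.prems(2) c Suc.hyps(2) by (auto simp: wedges_def)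
  moreover have "set (g # L) = E"
    using L(2) g(1) by auto
  ultimately show ?case
    by blast
qed

text \<open>Pigeonhole. If \<open>L\<close> were smaller, there would be a place \<open>j\<close>
  with \<open>L ! j\<close> below \<open>M ! j\<close>. The \<open>j + 1\<close> entries of
  \<open>M\<close> up to place \<open>j\<close> are then above \<open>L ! j\<close>, and so are the
  entries of \<open>L\<close> that dominate them; but only \<open>j\<close> entries of
  \<open>L\<close> are above \<open>L ! j\<close>.\<close>

lemma wedge_less_if_dominated:
  assumes lt: "term_order lt" and L: "L \<in> wedges lt q m" and M: "M \<in> wedges lt q m"
    and \<pi>: "\<pi> permutes {0..<q}"
    and le: "\<And>i. i < q \<Longrightarrow> M ! \<pi> i = L ! i \<or> lt (M ! \<pi> i) (L ! i)"
    and "M \<noteq> L"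
  shows "wedge_less lt M L"
proof (rule ccontr)
  note lenL = wedgesD(1) [OF L] and lenM = wedgesD(1) [OF M]
  assume "\<not> wedge_less lt M L"
  then have "wedge_less lt L M"
    using wedge_less_total [OF lt, of M L] lenL lenM \<open>M \<noteq> L\<close> by simp
  then obtain j where j: "j < q" "lt (L ! j) (M ! j)"
    unfolding wedge_less_def using lenL by blast
  have "inv_into UNIV \<pi> k < j" if "k \<le> j" for k
  proof -
    have k: "k < q"
      using that j(1) by simp
    define i where "i = inv_into UNIV \<pi> k"
    have i: "i < q" "\<pi> i = k"
      using k permutes_in_image [OF permutes_inv [OF \<pi>], of k] permutes_inverses(1) [OF \<pi>]
      by (simp_all add: i_def)
    have "lt (L ! j) (M ! k)"
    proof (cases "k = j")
      case False
      then have "lt (M ! j) (M ! k)"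
        using sorted_wrt_nth_less [OF wedgesD(3) [OF M], of k j] that j(1) lenM by simp
      then show ?thesis
        using term_order_trans [OF lt j(2)] by blast
    qed (use j in simp)
    then have "lt (L ! j) (L ! i)"
      using le [OF i(1)] i(2) term_order_trans [OF lt] by metis
    moreover have "lt (L ! i) (L ! j)" if "j < i"
      using sorted_wrt_nth_less [OF wedgesD(3) [OF L] that] i(1) lenL by simp
    ultimately have "\<not> j < i" "i \<noteq> j"
      using term_order_asym [OF lt] term_order_irrefl [OF lt] by metis+
    then show ?thesis
      by (simp add: i_def)
  qed
  then have "inv_into UNIV \<pi> ` {..j} \<subseteq> {..<j}"
    by auto
  then have "card (inv_into UNIV \<pi> ` {..j}) \<le> j"
    using card_mono [of "{..<j}" "inv_into UNIV \<pi> ` {..j}"] by simp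
  moreover have "inj_on (inv_into UNIV \<pi>) {..j}"
    using permutes_inj [OF permutes_inv [OF \<pi>]] by (rule inj_on_subset) simp
  ultimately show False
    by (simp add: card_image)
qed

text \<open>Equality gives domination in both directions, so distinct lists would each be smaller
  than the other.\<close>

lemma wedge_eq_if_permuted:
  assumes lt: "term_order lt" and L: "L \<in> wedges lt q m" and M: "M \<in> wedges lt q m"
    and \<pi>: "\<pi> permutes {0..<q}" and eq: "\<And>i. i < q \<Longrightarrow> M ! \<pi> i = L ! i"
  shows "M = L"
proof (rule ccontr)
  assume "M \<noteq> L"
  have "wedge_less lt M L"
    by (rule wedge_less_if_dominated [OF lt L M \<pi> _ \<open>M \<noteq> L\<close>]) (use eq in blast)
  moreover have "wedge_less lt L M"
  proof (rule wedge_less_if_dominated [OF lt M L permutes_inv [OF \<pi>]])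
    fix i assume "i < q"
    then have "inv_into UNIV \<pi> i < q"
      using permutes_in_image [OF permutes_inv [OF \<pi>], of i] by simp
    from eq [OF this] show "L ! inv_into UNIV \<pi> i = M ! i \<or> lt (L ! inv_into UNIV \<pi> i) (M ! i)"
      using permutes_inverses(1) [OF \<pi>] by simp
  qed (use \<open>M \<noteq> L\<close> in simp)
  ultimately show False
    using wedge_less_asym [OF lt, of M L] wedgesD(1) [OF L] wedgesD(1) [OF M] by simp
qed

section \<open>Pluecker coordinates and leading monomials\<close>

lemma pluecker_det:
  "pluecker bs L = (\<Sum>\<pi> | \<pi> permutes {0..<length L}. signof \<pi> *
     (\<Prod>i = 0..<length L. Poly_Mapping.lookup (bs ! i) (L ! \<pi> i)))"
proof -
  have "\<pi> i < length L" if "\<pi> permutes {0..<length L}" "i < length L" for \<pi> i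
    using permutes_in_image [OF that(1), of i] that(2) by simp
  then show ?thesis
    by (simp add: pluecker_def Determinant.det_def)
qed

lemma pluecker_nonzero_permutation:
  assumes "pluecker bs L \<noteq> 0"
  obtains \<pi> where "\<pi> permutes {0..<length L}"
    "\<And>i. i < length L \<Longrightarrow> L ! \<pi> i \<in> Poly_Mapping.keys (bs ! i)"
proof -
  obtain \<pi> where \<pi>: "\<pi> permutes {0..<length L}"
    "signof \<pi> * (\<Prod>i = 0..<length L. Poly_Mapping.lookup (bs ! i) (L ! \<pi> i)) \<noteq> 0"
    using assms unfolding pluecker_det by (metis (mono_tags, lifting) mem_Collect_eq sum.neutral)
  then have "(\<Prod>i = 0..<length L. Poly_Mapping.lookup (bs ! i) (L ! \<pi> i)) \<noteq> 0"
    by auto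
  then have nz: "\<forall>i\<in>{0..<length L}. Poly_Mapping.lookup (bs ! i) (L ! \<pi> i) \<noteq> 0"
    by simp
  show thesis
  proof (rule that [OF \<pi>(1)])
    show "L ! \<pi> i \<in> Poly_Mapping.keys (bs ! i)" if "i < length L" for i
      using bspec [OF nz, of i] that by (simp add: in_keys_iff)
  qed
qed

lemma length_ordered_basis:
  assumes "ordered_basis bs V"
  shows "length bs = mpv.dim V"
  using assms mpv.dim_span_eq_card_independent [of "set bs"] distinct_card [of bs]
  by (auto simp: ordered_basis_def)

text \<open>The factor is the determinant of the change of basis. All that is used later is that a
  coordinate vanishing for one basis vanishes for the other.\<close>

lemma pluecker_change_basis:
  assumes bs: "ordered_basis bs V" and cs: "ordered_basis cs V" and L: "length L = mpv.dim V"
  obtains c where "pluecker cs L = c * pluecker bs L"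
proof -
  define q where "q = mpv.dim V"
  have len: "length bs = q" "length cs = q" "length L = q"
    using length_ordered_basis [OF bs] length_ordered_basis [OF cs] L by (simp_all add: q_def)
  have "\<exists>u. cs ! i = (\<Sum>k<q. const (u k) * bs ! k)" if "i < q" for i
  proof -
    have "cs ! i \<in> set cs"
      using that len by simp
    then have "cs ! i \<in> mpv.span (set cs)"
      by (rule mpv.span_base)
    also have "mpv.span (set cs) = mpv.span (set bs)"
      using bs cs by (simp add: ordered_basis_def)
    finally obtain u where u: "cs ! i = (\<Sum>v\<in>set bs. const (u v) * v)"
      unfolding mpv.span_finite [OF finite_set] by blast
    have "bij_betw ((!) bs) {..<q} (set bs)"
      using bs len by (intro bij_betw_nth) (simp_all add: ordered_basis_def)
    from sum.reindex_bij_betw [OF this, of "\<lambda>v. const (u v) * v"] u show ?thesis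
      by (intro exI [of _ "\<lambda>k. u (bs ! k)"]) simp
  qed
  then obtain u where u: "\<And>i. i < q \<Longrightarrow> cs ! i = (\<Sum>k<q. const (u i k) * bs ! k)"
    by metis
  define A where "A = Matrix.mat q q (\<lambda>(i, k). u i k)"
  let ?P = "\<lambda>bs. Matrix.mat q q (\<lambda>(i, j). Poly_Mapping.lookup (bs ! i) (L ! j))"
  have "?P cs = A * ?P bs"
    by (intro eq_matI) (auto simp: A_def u lookup_sum scalar_prod_def atLeast0LessThan)
  then have "Determinant.det (?P cs) = Determinant.det A * Determinant.det (?P bs)"
    by (simp add: A_def det_mult [of _ q])
  then show thesis
    by (intro that [of "Determinant.det A"]) (simp add: pluecker_def len)
qed

lemma ordered_basis_lms:
  fixes V :: "('v::finite, 'a::field) mpol set"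
  assumes lt: "term_order lt" and V: "V \<in> grassmannian q m"
  obtains L bs where "L \<in> wedges lt q m" "set L = lms lt V" "ordered_basis bs V"
    "\<And>i. i < q \<Longrightarrow> is_lm lt (bs ! i) (L ! i)"
proof -
  have V': "mpv.subspace V" "V \<subseteq> supported (deg_mons m)" "mpv.dim V = q"
    using V by (auto simp: grassmannian_def forms_eq)
  have card: "card (lms lt V) = q"
    using dim_eq_card_lms [OF lt V'(1,2) finite_deg_mons] V'(3) by simp
  have "finite (lms lt V)"
    using finite_subset [OF lms_subset [OF V'(2)] finite_deg_mons] .
  then obtain L where L: "L \<in> wedges lt q m" "set L = lms lt V"
    using ex_wedge_of_set [OF lt, of "lms lt V" m] card lms_subset [OF V'(2)] by blast
  have "\<forall>s. \<exists>f. s \<in> lms lt V \<longrightarrow> f \<in> V \<and> is_lm lt f s"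
    by (auto simp: lms_def)
  then obtain F where F: "\<And>s. s \<in> lms lt V \<Longrightarrow> F s \<in> V \<and> is_lm lt (F s) s"
    by metis
  note b = echelon_basis [OF lt V'(1,2) finite_deg_mons F]
  have "ordered_basis (map F L) V"
    using b L distinct_wedge [OF lt L(1)] by (simp add: ordered_basis_def distinct_map)
  moreover have "is_lm lt (map F L ! i) (L ! i)" if "i < q" for i
    using that F [of "L ! i"] L(2) wedgesD(1) [OF L(1)] nth_mem [of i L] by simp
  ultimately show thesis
    using that L by blast
qed

text \<open>The coordinate matrix is triangular: a column \<open>L ! j\<close> with
  \<open>j < i\<close> is above the leading monomial of row \<open>i\<close>. The diagonal consists
  of leading coefficients.\<close>

lemma pluecker_lms_nonzero:
  assumes lt: "term_order lt" and L: "L \<in> wedges lt q m"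
    and bs: "\<And>i. i < q \<Longrightarrow> is_lm lt (bs ! i) (L ! i)"
  shows "pluecker bs L \<noteq> 0"
proof -
  note len = wedgesD(1) [OF L]
  let ?A = "Matrix.mat q q (\<lambda>(i, j). Poly_Mapping.lookup (bs ! i) (L ! j))"
  have zero: "Poly_Mapping.lookup (bs ! i) (L ! j) = 0" if "j < i" "i < q" for i j
  proof -
    have "lt (L ! i) (L ! j)"
      using sorted_wrt_nth_less [OF wedgesD(3) [OF L] that(1)] that(2) len by simp
    then have "L ! j \<noteq> L ! i" "\<not> lt (L ! j) (L ! i)"
      using term_order_irrefl [OF lt] term_order_asym [OF lt] by metis+
    then have "L ! j \<notin> Poly_Mapping.keys (bs ! i)"
      using bs [OF that(2)] unfolding is_lm_def by blast
    then show ?thesis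
      by (simp add: in_keys_iff)
  qed
  have "Determinant.det ?A = prod_list (diag_mat ?A)"
    by (rule det_upper_triangular [of _ q]) (auto simp: upper_triangular_def zero)
  moreover have "Poly_Mapping.lookup (bs ! i) (L ! i) \<noteq> 0" if "i < q" for i
    using bs [OF that] by (simp add: is_lm_def in_keys_iff)
  ultimately show ?thesis
    by (auto simp: pluecker_def len diag_mat_def prod_list_zero_iff)
qed

text \<open>A nonzero product in the Leibniz expansion picks a term of every \<open>bs ! i\<close>,
  and such a term cannot exceed the leading monomial \<open>L ! i\<close>.\<close>

lemma pluecker_nonzero_dominated:
  assumes lt: "term_order lt" and M: "M \<in> wedges lt q m"
    and bs: "\<And>i. i < q \<Longrightarrow> is_lm lt (bs ! i) (L ! i)"
    and "pluecker bs M \<noteq> 0"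
  obtains \<pi> where "\<pi> permutes {0..<q}" "\<And>i. i < q \<Longrightarrow> M ! \<pi> i = L ! i \<or> lt (M ! \<pi> i) (L ! i)"
proof -
  obtain \<pi> where \<pi>: "\<pi> permutes {0..<length M}"
    "\<And>i. i < length M \<Longrightarrow> M ! \<pi> i \<in> Poly_Mapping.keys (bs ! i)"
    using pluecker_nonzero_permutation [OF assms(4)] by blast
  show thesis
  proof (rule that)
    show "\<pi> permutes {0..<q}"
      using \<pi>(1) wedgesD(1) [OF M] by simp
    show "M ! \<pi> i = L ! i \<or> lt (M ! \<pi> i) (L ! i)" if "i < q" for i
      using bs [OF that] \<pi>(2) [of i] that wedgesD(1) [OF M] unfolding is_lm_def by blast
  qed
qed

text \<open>Take a point \<open>V\<close> witnessing the maximum, and the wedge \<open>L\<close> of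
  its own initial monomials. \<open>V\<close> lies in the chart of \<open>L\<close>, so
  \<open>L\<close> is at most the maximum; a wedge with nonzero coordinate at \<open>V\<close> is
  dominated by \<open>L\<close>, so the maximum is at most \<open>L\<close>.\<close>

lemma initial_eq_lms:
  fixes W :: "('v::finite, 'a::field) mpol set set"
  assumes lt: "term_order lt" and W: "W \<subseteq> grassmannian q m" "W \<noteq> {}"
  obtains V bs where "V \<in> W" "ordered_basis bs V" "initial lt q m W \<in> wedges lt q m"
    "set (initial lt q m W) = lms lt V" "\<And>i. i < q \<Longrightarrow> is_lm lt (bs ! i) (initial lt q m W ! i)"
proof -
  have lead: "\<exists>L bs. L \<in> wedges lt q m \<and> set L = lms lt V \<and> ordered_basis bs V \<and>
      (\<forall>i<q. is_lm lt (bs ! i) (L ! i)) \<and> V \<in> chart q m L" if V: "V \<in> W" for V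
  proof -
    have VG: "V \<in> grassmannian q m"
      using V W(1) by blast
    obtain L bs where *: "L \<in> wedges lt q m" "set L = lms lt V" "ordered_basis bs V"
      "\<And>i. i < q \<Longrightarrow> is_lm lt (bs ! i) (L ! i)"
      using ordered_basis_lms [OF lt VG] by blast
    have "pluecker bs L \<noteq> 0"
      by (rule pluecker_lms_nonzero [OF lt *(1,4)])
    then have "V \<in> chart q m L"
      using VG *(3) unfolding chart_def by blast
    with * show ?thesis by blast
  qed
  let ?L0 = "initial lt q m W"
  obtain V0 L0 where "V0 \<in> W" "L0 \<in> wedges lt q m" "V0 \<in> chart q m L0"
    using W(2) lead by blast
  then have ex: "L0 \<in> wedges lt q m" "chart q m L0 \<inter> W \<noteq> {}"
    by auto
  note I = initial_greatest [OF lt ex]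
  obtain V cs where V: "V \<in> W" "ordered_basis cs V" "pluecker cs ?L0 \<noteq> 0"
    using I(2) unfolding chart_def by blast
  obtain L bs where L: "L \<in> wedges lt q m" "set L = lms lt V" "ordered_basis bs V"
    "\<And>i. i < q \<Longrightarrow> is_lm lt (bs ! i) (L ! i)" "V \<in> chart q m L"
    using lead [OF V(1)] by blast
  have "mpv.dim V = q"
    using V(1) W(1) by (auto simp: grassmannian_def)
  \<comment> \<open>The basis \<open>cs\<close> witnessing the chart need not be in echelon form, so
    nonvanishing is moved to \<open>bs\<close>.\<close>
  then obtain c where "pluecker cs ?L0 = c * pluecker bs ?L0"
    using pluecker_change_basis [OF L(3) V(2), of ?L0] wedgesD(1) [OF I(1)] by auto
  with V(3) have nz: "pluecker bs ?L0 \<noteq> 0"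
    by auto
  obtain \<pi> where \<pi>: "\<pi> permutes {0..<q}" "\<And>i. i < q \<Longrightarrow> ?L0 ! \<pi> i = L ! i \<or> lt (?L0 ! \<pi> i) (L ! i)"
    using pluecker_nonzero_dominated [OF lt I(1) L(4) nz] by blast
  have "L = ?L0"
  proof (rule ccontr)
    assume "L \<noteq> ?L0"
    then have "wedge_less lt L ?L0"
      using I(3) [OF L(1)] L(5) V(1) by blast
    moreover have "wedge_less lt ?L0 L"
      using wedge_less_if_dominated [OF lt L(1) I(1) \<pi>] \<open>L \<noteq> ?L0\<close> by blast
    ultimately show False
      using wedge_less_asym [OF lt, of L ?L0] wedgesD(1) [OF L(1)] wedgesD(1) [OF I(1)] by simp
  qed
  with that V(1) L I(1) show thesis
    by blast
qed

section \<open>Degeneration along one-parameter subgroups\<close>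

text \<open>The equality case is kept explicit, because a later comparison of total exponents has to
  identify each single factor.\<close>

lemma term_order_sum:
  assumes lt: "term_order lt" and "finite A"
    and "\<And>x. x \<in> A \<Longrightarrow> f x = g x \<or> lt (f x) (g x)"
  shows "((\<Sum>x\<in>A. f x) = (\<Sum>x\<in>A. g x) \<and> (\<forall>x\<in>A. f x = g x)) \<or> lt (\<Sum>x\<in>A. f x) (\<Sum>x\<in>A. g x)"
  using assms(2,3)
proof (induction A rule: finite_induct)
  case (insert a A)
  let ?F = "\<Sum>x\<in>A. f x" and ?G = "\<Sum>x\<in>A. g x"
  have mono: "lt (f a + ?F) (g a + ?F)" if "lt (f a) (g a)"
    using term_order_add [OF lt that] .
  have mono': "lt (g a + ?F) (g a + ?G)" if "lt ?F ?G"
    using term_order_add [OF lt that, of "g a"] by (simp add: add.commute)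
  have IH: "(?F = ?G \<and> (\<forall>x\<in>A. f x = g x)) \<or> lt ?F ?G"
    using insert.IH insert.prems by blast
  have a: "f a = g a \<or> lt (f a) (g a)"
    using insert.prems by blast
  have "(f a + ?F = g a + ?G \<and> f a = g a \<and> (\<forall>x\<in>A. f x = g x)) \<or> lt (f a + ?F) (g a + ?G)"
  proof (cases "lt (f a) (g a)")
    case True
    then show ?thesis
      using IH mono mono' term_order_trans [OF lt] by metis
  next
    case False
    then have "f a = g a"
      using a by blast
    then show ?thesis
      using IH mono' by auto
  qed
  then show ?case
    using insert.hyps by simp
qed simp

text \<open>\<open>sum_list M\<close> is the character by which the diagonal torus acts on the
  coordinate \<open>M\<close>, see \<open>pluecker_torus\<close>. Domination bounds it by that of
  \<open>L\<close>, strictly because equality of all entries would force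
  \<open>M = L\<close>.\<close>

lemma permuted_sum_less:
  assumes lt: "term_order lt" and L: "L \<in> wedges lt q m" and M: "M \<in> wedges lt q m"
    and \<pi>: "\<pi> permutes {0..<q}"
    and le: "\<And>i. i < q \<Longrightarrow> M ! \<pi> i = L ! i \<or> lt (M ! \<pi> i) (L ! i)"
    and "M \<noteq> L"
  shows "lt (sum_list M) (sum_list L)"
proof -
  have "sum_list M = (\<Sum>i\<in>{0..<q}. M ! \<pi> i)"
    using sum.permute [OF \<pi>, of "(!) M"] wedgesD(1) [OF M] by (simp add: sum_list_sum_nth o_def)
  moreover have "sum_list L = (\<Sum>i\<in>{0..<q}. L ! i)"
    using wedgesD(1) [OF L] by (simp add: sum_list_sum_nth)
  moreover have "\<not> (\<forall>i\<in>{0..<q}. M ! \<pi> i = L ! i)"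
  proof
    assume "\<forall>i\<in>{0..<q}. M ! \<pi> i = L ! i"
    then have "M = L"
      by (intro wedge_eq_if_permuted [OF lt L M \<pi>]) simp
    with \<open>M \<noteq> L\<close> show False ..
  qed
  ultimately show ?thesis
    using term_order_sum [OF lt, of "{0..<q}" "\<lambda>i. M ! \<pi> i" "(!) L"] le by auto
qed

lemma digits_unique:
  fixes a b :: "nat \<Rightarrow> nat"
  assumes "\<And>k. k < K \<Longrightarrow> a k < N" "\<And>k. k < K \<Longrightarrow> b k < N"
    "(\<Sum>k<K. a k * N ^ k) = (\<Sum>k<K. b k * N ^ k)" "j < K"
  shows "a j = b j"
  using assms
proof (induction K arbitrary: a b j)
  case (Suc K)
  have split: "(\<Sum>k<Suc K. c k * N ^ k) = c 0 + N * (\<Sum>k<K. c (Suc k) * N ^ k)" for c :: "nat \<Rightarrow> nat"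
    by (simp only: sum.lessThan_Suc_shift) (simp add: sum_distrib_left mult_ac)
  have eq: "a 0 + N * (\<Sum>k<K. a (Suc k) * N ^ k) = b 0 + N * (\<Sum>k<K. b (Suc k) * N ^ k)"
    using Suc.prems(3) by (simp only: split)
  have less: "a 0 < N" "b 0 < N"
    using Suc.prems(1,2) by simp_all
  have "a 0 = (a 0 + N * (\<Sum>k<K. a (Suc k) * N ^ k)) mod N"
    using less by simp
  also have "\<dots> = b 0"
    unfolding eq using less by simp
  finally have 0: "a 0 = b 0" .
  with eq less have "(\<Sum>k<K. a (Suc k) * N ^ k) = (\<Sum>k<K. b (Suc k) * N ^ k)"
    by simp
  then have IH: "a (Suc i) = b (Suc i)" if "i < K" for i
    using Suc.IH [of "\<lambda>k. a (Suc k)" "\<lambda>k. b (Suc k)" i] Suc.prems(1,2) that by simp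
  show ?case
    using 0 IH Suc.prems(4) by (cases j) auto
qed simp

section \<open>Weights and the diagonal torus\<close>

definition weight :: "('v::finite \<Rightarrow> nat) \<Rightarrow> 'v mon \<Rightarrow> nat" where
  "weight \<omega> t = (\<Sum>i\<in>UNIV. \<omega> i * Poly_Mapping.lookup t i)"

lemma weight_add: "weight \<omega> (s + t) = weight \<omega> s + weight \<omega> t"
  by (simp add: weight_def lookup_add distrib_left sum.distrib)

lemma weight_0: "weight \<omega> 0 = 0"
  by (simp add: weight_def)

lemma weight_sum: "weight \<omega> (\<Sum>x\<in>A. f x) = (\<Sum>x\<in>A. weight \<omega> (f x))"
  by (induction A rule: infinite_finite_induct) (simp_all add: weight_add weight_0)

lemma weight_sum_list: "weight \<omega> (sum_list ts) = (\<Sum>t\<leftarrow>ts. weight \<omega> t)"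
  by (induction ts) (simp_all add: weight_add weight_0)

lemma mon_deg_sum: "mon_deg (\<Sum>x\<in>A. f x) = (\<Sum>x\<in>A. mon_deg (f x))"
  by (induction A rule: infinite_finite_induct) simp_all

lemma mon_deg_sum_list: "mon_deg (sum_list ts) = (\<Sum>t\<leftarrow>ts. mon_deg t)"
  by (induction ts) simp_all

text \<open>The weights are 1, \<open>N\<close>, \<open>N ^ 2\<close> and so on. Exponents are below
  \<open>N\<close> by the degree bound, so the weight is an expansion in base \<open>N\<close> and
  determines its digits.\<close>

lemma injective_weight:
  obtains \<omega> :: "'v::finite \<Rightarrow> nat" where
    "\<And>s t. mon_deg s < N \<Longrightarrow> mon_deg t < N \<Longrightarrow> weight \<omega> s = weight \<omega> t \<Longrightarrow> s = t"
proof -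
  obtain e :: "nat \<Rightarrow> 'v" where e: "bij_betw e {..<CARD('v)} UNIV"
    using ex_bij_betw_nat_finite [of "UNIV :: 'v set"] by (auto simp: atLeast0LessThan)
  define d where "d = inv_into {..<CARD('v)} e"
  have d: "d (e k) = k" if "k < CARD('v)" for k
    using that e unfolding d_def by (intro inv_into_f_f) (auto simp: bij_betw_def)
  define \<omega> where "\<omega> i = N ^ d i" for i
  have wt: "weight \<omega> s = (\<Sum>k<CARD('v). Poly_Mapping.lookup s (e k) * N ^ k)" for s
  proof -
    have "weight \<omega> s = (\<Sum>k<CARD('v). \<omega> (e k) * Poly_Mapping.lookup s (e k))"
      unfolding weight_def by (rule sum.reindex_bij_betw [OF e, symmetric])
    also have "\<dots> = (\<Sum>k<CARD('v). Poly_Mapping.lookup s (e k) * N ^ k)"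
      by (intro sum.cong) (auto simp: \<omega>_def d)
    finally show ?thesis .
  qed
  have bound: "Poly_Mapping.lookup s i < N" if "mon_deg s < N" for s :: "'v mon" and i
  proof -
    have "Poly_Mapping.lookup s i \<le> mon_deg s"
      unfolding mon_deg_UNIV by (rule member_le_sum) auto
    with that show ?thesis by simp
  qed
  show thesis
  proof (rule that)
    fix s t :: "'v mon"
    assume st: "mon_deg s < N" "mon_deg t < N" "weight \<omega> s = weight \<omega> t"
    show "s = t"
    proof (rule poly_mapping_eqI)
      fix i
      obtain k where k: "k < CARD('v)" "i = e k"
        using bij_betw_imp_surj_on [OF e] by (metis UNIV_I imageE lessThan_iff)
      show "Poly_Mapping.lookup s i = Poly_Mapping.lookup t i"
        unfolding k(2)
      proof (rule digits_unique [of "CARD('v)" "\<lambda>k. Poly_Mapping.lookup s (e k)" N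
            "\<lambda>k. Poly_Mapping.lookup t (e k)" k])
      qed (use st bound wt k in auto)
    qed
  qed
qed

definition torus :: "('v::finite \<Rightarrow> nat) \<Rightarrow> 'k::field \<Rightarrow> 'k ^ 'v ^ 'v" where
  "torus \<omega> c = (\<chi> i j. if i = j then c ^ \<omega> i else 0)"

lemma invertible_torus:
  fixes c :: "'k::field"
  assumes "c \<noteq> 0"
  shows "invertible (torus \<omega> c)"
  unfolding invertible_def
proof (intro exI conjI)
  have *: "torus \<omega> a ** torus \<omega> b = Finite_Cartesian_Product.mat 1" if "a * b = 1" for a b :: 'k
  proof -
    have "a ^ k * b ^ k = 1" for k
      using that by (simp flip: power_mult_distrib)
    then show ?thesis
      by (simp add: torus_def matrix_matrix_mult_def Finite_Cartesian_Product.mat_def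
          Finite_Cartesian_Product.vec_eq_iff if_distrib [of "\<lambda>x. x * _"] if_distrib [of "\<lambda>x. _ * x"]
          cong: if_cong)
  qed
  show "torus \<omega> c ** torus \<omega> (inverse c) = Finite_Cartesian_Product.mat 1"
    "torus \<omega> (inverse c) ** torus \<omega> c = Finite_Cartesian_Product.mat 1"
    using assms by (simp_all add: *)
qed

lemma lookup_gl_act_torus:
  assumes "field_hom \<iota>"
  shows "Poly_Mapping.lookup (gl_act \<iota> (torus \<omega> c) f) t =
    \<iota> c ^ weight \<omega> t * Poly_Mapping.lookup f t"
proof -
  interpret field_hom \<iota> by (rule assms)
  have var: "gl_var \<iota> (torus \<omega> c) i = const (\<iota> c ^ \<omega> i) * monomial (var_mon i)" for i
  proof -
    have "gl_var \<iota> (torus \<omega> c) i =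
        (\<Sum>j\<in>UNIV. if i = j then const (\<iota> c ^ \<omega> i) * monomial (var_mon j) else 0)"
      unfolding gl_var_def torus_def by (intro sum.cong) (auto simp: hom_power const_def)
    then show ?thesis by simp
  qed
  have cpow: "const a ^ k = const (a ^ k)" for a :: 'b and k
    by (induction k) (simp_all add: const_mult_const, simp add: const_def)
  have cprod: "(\<Prod>i\<in>A. const (h i)) = const (\<Prod>i\<in>A. h i)" for h :: "'c \<Rightarrow> 'b" and A
    by (induction A rule: infinite_finite_induct) (simp_all add: const_mult_const, simp_all add: const_def)
  have "mon_eval (gl_var \<iota> (torus \<omega> c)) s = const (\<iota> c ^ weight \<omega> s) * monomial s" for s
  proof -
    have "mon_eval (gl_var \<iota> (torus \<omega> c)) s =
        (\<Prod>i\<in>Poly_Mapping.keys s. const (\<iota> c ^ (\<omega> i * Poly_Mapping.lookup s i)) *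
          monomial (var_mon i) ^ Poly_Mapping.lookup s i)"
      unfolding mon_eval_def var power_mult_distrib cpow power_mult ..
    also have "\<dots> = const (\<Prod>i\<in>Poly_Mapping.keys s. \<iota> c ^ (\<omega> i * Poly_Mapping.lookup s i)) *
        mon_eval (\<lambda>i. monomial (var_mon i)) s"
      by (simp only: prod.distrib cprod mon_eval_def)
    also have "(\<Prod>i\<in>Poly_Mapping.keys s. \<iota> c ^ (\<omega> i * Poly_Mapping.lookup s i)) = \<iota> c ^ weight \<omega> s"
    proof -
      have "weight \<omega> s = (\<Sum>i\<in>Poly_Mapping.keys s. \<omega> i * Poly_Mapping.lookup s i)"
        unfolding weight_def by (intro sum.mono_neutral_right) (auto simp: in_keys_iff)
      then show ?thesis
        by (simp add: power_sum)
    qed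
    finally show ?thesis
      by (simp only: mon_eval_vars)
  qed
  then have "gl_act \<iota> (torus \<omega> c) f =
      (\<Sum>s\<in>Poly_Mapping.keys f. const (Poly_Mapping.lookup f s) * (const (\<iota> c ^ weight \<omega> s) * monomial s))"
    by (simp only: gl_act_eq)
  then have "Poly_Mapping.lookup (gl_act \<iota> (torus \<omega> c) f) t =
      (\<Sum>s\<in>Poly_Mapping.keys f. Poly_Mapping.lookup f s * \<iota> c ^ weight \<omega> s * (if s = t then 1 else 0))"
    by (simp add: lookup_sum)
  also have "\<dots> =
      (\<Sum>s\<in>Poly_Mapping.keys f. if s = t then \<iota> c ^ weight \<omega> t * Poly_Mapping.lookup f t else 0)"
    by (intro sum.cong) auto
  also have "\<dots> = \<iota> c ^ weight \<omega> t * Poly_Mapping.lookup f t"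
    by (simp add: in_keys_iff)
  finally show ?thesis .
qed

text \<open>Every permutation uses each entry of \<open>M\<close> once, so all products in the
  Leibniz expansion are scaled by the same power.\<close>

lemma pluecker_torus:
  assumes "field_hom \<iota>" and len: "length bs = length M"
  shows "pluecker (map (gl_act \<iota> (torus \<omega> c)) bs) M = \<iota> c ^ weight \<omega> (sum_list M) * pluecker bs M"
proof -
  let ?n = "length M"
  have "(\<Prod>i = 0..<?n. Poly_Mapping.lookup (map (gl_act \<iota> (torus \<omega> c)) bs ! i) (M ! \<pi> i)) =
      \<iota> c ^ weight \<omega> (sum_list M) * (\<Prod>i = 0..<?n. Poly_Mapping.lookup (bs ! i) (M ! \<pi> i))"
    if \<pi>: "\<pi> permutes {0..<?n}" for \<pi>
  proof -
    have "weight \<omega> (sum_list M) = (\<Sum>i = 0..<?n. weight \<omega> (M ! i))"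
      unfolding weight_sum_list by (simp add: sum_list_sum_nth)
    also have "\<dots> = (\<Sum>i = 0..<?n. weight \<omega> (M ! \<pi> i))"
      using sum.permute [OF \<pi>, of "\<lambda>i. weight \<omega> (M ! i)"] by (simp add: o_def)
    finally show ?thesis
      by (simp add: len lookup_gl_act_torus [OF assms(1)] prod.distrib power_sum)
  qed
  then show ?thesis
    unfolding pluecker_det sum_distrib_left by (intro sum.cong refl) (simp add: mult_ac)
qed

lemma ordered_basis_image:
  assumes "graded_automorphism \<phi> \<psi>" "ordered_basis bs V"
  shows "ordered_basis (map \<phi> bs) (\<phi> ` V)"
proof -
  interpret graded_automorphism \<phi> \<psi> by (rule assms)
  interpret lin: Vector_Spaces.linear
    "\<lambda>c (f :: ('a, 'b) mpol). const c * f" "\<lambda>c (f :: ('a, 'b) mpol). const c * f" \<phi>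
    by (rule linear_\<phi>)
  have "mpv.independent (\<phi> ` set bs)"
    using assms(2) by (intro lin.independent_inj_image inj_\<phi>) (simp add: ordered_basis_def)
  moreover have "inj_on \<phi> (set bs)"
    by (rule inj_on_subset [OF inj_\<phi> subset_UNIV])
  ultimately show ?thesis
    using assms(2) by (simp add: ordered_basis_def distinct_map lin.span_image [of "set bs"])
qed

lemma ordered_basis_vs:
  assumes "distinct L"
  shows "ordered_basis (map monomial L) (vs L :: ('v, 'a::field) mpol set)"
proof -
  have "inj_on (monomial :: 'v mon \<Rightarrow> ('v, 'a) mpol) (set L)"
    by (rule inj_on_subset [OF inj_monomial subset_UNIV])
  then show ?thesis
    using assms independent_monomials by (simp add: ordered_basis_def vs_def distinct_map)
qed

lemma vs_eq_supported: "vs L = supported (set L)"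
  by (simp add: vs_def supported_eq_span)

text \<open>With the monomials as basis, a nonzero coordinate \<open>M\<close> would be a
  rearrangement of \<open>L\<close>. Thus \<open>vs L\<close> is a coordinate point of the Pluecker
  embedding.\<close>

lemma pluecker_vs_zero:
  assumes lt: "term_order lt" and L: "L \<in> wedges lt q m" and M: "M \<in> wedges lt q m"
    and cs: "ordered_basis cs (vs L :: ('v, 'a::field) mpol set)" and "M \<noteq> L"
  shows "pluecker cs M = 0"
proof -
  note len = wedgesD(1) [OF L] wedgesD(1) [OF M]
  have "pluecker (map monomial L :: ('v, 'a) mpol list) M = 0"
  proof (rule ccontr)
    assume "pluecker (map monomial L :: ('v, 'a) mpol list) M \<noteq> 0"
    then obtain \<pi> where \<pi>: "\<pi> permutes {0..<length M}"
      "\<And>i. i < length M \<Longrightarrow> M ! \<pi> i \<in> Poly_Mapping.keys ((map monomial L :: ('v, 'a) mpol list) ! i)"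
      using pluecker_nonzero_permutation by blast
    have "M ! \<pi> i = L ! i" if "i < q" for i
      using \<pi>(2) [of i] that len by simp
    with \<pi>(1) have "M = L"
      using wedge_eq_if_permuted [OF lt L M, of \<pi>] len by simp
    with \<open>M \<noteq> L\<close> show False ..
  qed
  moreover have bs: "ordered_basis (map monomial L) (vs L :: ('v, 'a) mpol set)"
    by (rule ordered_basis_vs [OF distinct_wedge [OF lt L]])
  moreover have "length M = mpv.dim (vs L :: ('v, 'a) mpol set)"
    using length_ordered_basis [OF bs] len by simp
  ultimately show ?thesis
    using pluecker_change_basis [OF bs cs] by (metis mult_zero_right)
qed

text \<open>Along the one-parameter subgroup with the given weights, the Pluecker coordinates of a space
  with initial wedge \<open>L\<close> are multiplied by powers of the parameter; if the weights separate all the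
  exponents that occur, then comparing coefficients shows that a form vanishing along the whole
  orbit cannot involve the monomial \<open>L\<^sup>d\<close>.\<close>

lemma form_vanishing_on_torus_orbit:
  fixes \<iota> :: "'k::field \<Rightarrow> 'f::field" and bs :: "('v::finite, 'f) mpol list"
    and P :: "('v mon list \<Rightarrow>\<^sub>0 nat) \<Rightarrow>\<^sub>0 'k"
  assumes inf: "infinite (UNIV :: 'k set)" and hom: "field_hom \<iota>" and lt: "term_order lt"
    and L: "L \<in> wedges lt q m" and len: "length bs = q"
    and bs: "\<And>i. i < q \<Longrightarrow> is_lm lt (bs ! i) (L ! i)"
    and P: "P \<in> forms d" "\<And>s. s \<in> Poly_Mapping.keys P \<Longrightarrow> Poly_Mapping.keys s \<subseteq> wedges lt q m"
    and vanish: "\<And>\<omega> c. c \<noteq> 0 \<Longrightarrow>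
      mpol_eval \<iota> (pluecker (map (gl_act \<iota> (torus \<omega> c)) bs)) P = 0"
  shows "Poly_Mapping.single L d \<notin> Poly_Mapping.keys P"
proof
  interpret field_hom \<iota> by (rule hom)
  let ?\<Delta> = "pluecker bs"
  let ?sL = "Poly_Mapping.single L d"
  assume sL: "?sL \<in> Poly_Mapping.keys P"
  \<comment> \<open>For a wedge, \<open>sum_list M\<close> has degree \<open>q * m\<close>, and a
    Pluecker monomial of degree \<open>d\<close> has \<open>d\<close> factors; \<open>Suc\<close>
    makes the bound strict.\<close>
  obtain \<omega> :: "'v \<Rightarrow> nat" where \<omega>: "\<And>s t. mon_deg s < Suc (d * (q * m)) \<Longrightarrow> mon_deg t < Suc (d * (q * m)) \<Longrightarrow>
      weight \<omega> s = weight \<omega> t \<Longrightarrow> s = t"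
    using injective_weight [of "Suc (d * (q * m))"] by blast
  define w where "w s = (\<Sum>M\<in>Poly_Mapping.keys s. weight \<omega> (sum_list M) * Poly_Mapping.lookup s M)"
    for s :: "'v mon list \<Rightarrow>\<^sub>0 nat"
  \<comment> \<open>The value of \<open>P\<close> along the torus orbit, as a polynomial in
    \<open>\<iota> c\<close>; \<open>w s\<close> is the power of \<open>\<iota> c\<close> by which
    the Pluecker monomial \<open>s\<close> is scaled.\<close>
  define Q where "Q = (\<Sum>s\<in>Poly_Mapping.keys P.
      Polynomial.monom (\<iota> (Poly_Mapping.lookup P s) * mon_eval ?\<Delta> s) (w s))"
  have lenM: "length M = q" if "s \<in> Poly_Mapping.keys P" "M \<in> Poly_Mapping.keys s" for s M
    using P(2) [OF that(1)] that(2) wedgesD(1) by blast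
  have zero: "poly Q (\<iota> c) = 0" if "c \<noteq> 0" for c
  proof -
    have "mon_eval (pluecker (map (gl_act \<iota> (torus \<omega> c)) bs)) s = \<iota> c ^ w s * mon_eval ?\<Delta> s"
      if s: "s \<in> Poly_Mapping.keys P" for s
    proof -
      have "mon_eval (pluecker (map (gl_act \<iota> (torus \<omega> c)) bs)) s =
          (\<Prod>M\<in>Poly_Mapping.keys s. (\<iota> c ^ weight \<omega> (sum_list M) * ?\<Delta> M) ^ Poly_Mapping.lookup s M)"
        unfolding mon_eval_def
        by (intro prod.cong refl) (simp add: pluecker_torus [OF hom] len lenM [OF s])
      also have "\<dots> = \<iota> c ^ w s * mon_eval ?\<Delta> s"
        by (simp add: power_mult_distrib prod.distrib w_def power_sum power_mult mon_eval_def)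
      finally show ?thesis .
    qed
    then have "mpol_eval \<iota> (pluecker (map (gl_act \<iota> (torus \<omega> c)) bs)) P =
        (\<Sum>s\<in>Poly_Mapping.keys P. \<iota> (Poly_Mapping.lookup P s) * (\<iota> c ^ w s * mon_eval ?\<Delta> s))"
      unfolding mpol_eval_def mon_eval_def [symmetric] by (intro sum.cong refl) simp
    also have "\<dots> = poly Q (\<iota> c)"
      by (simp add: Q_def poly_sum poly_monom mult_ac)
    finally show ?thesis
      using vanish [OF that] by simp
  qed
  \<comment> \<open>The infinitely many nonzero elements of \<open>'k\<close> give infinitely many
    zeros, \<open>\<iota>\<close> being injective.\<close>
  have "Q = 0"
  proof (rule ccontr)
    assume "Q \<noteq> 0"
    then have "finite {x. poly Q x = 0}"
      by (rule poly_roots_finite)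
    moreover have "\<iota> ` (UNIV - {0}) \<subseteq> {x. poly Q x = 0}"
      using zero by auto
    ultimately have "finite (\<iota> ` (UNIV - {0}))"
      by (rule rev_finite_subset)
    then have "finite (UNIV - {0 :: 'k})"
      by (rule finite_imageD) (rule inj_onI, simp)
    then show False
      using inf by simp
  qed
  have deg_sum_list: "mon_deg (sum_list M) = q * m" if "M \<in> wedges lt q m" for M :: "'v mon list"
  proof -
    have "(\<Sum>t\<leftarrow>M. mon_deg t) = (\<Sum>t\<leftarrow>M. m)"
      using wedgesD(2) [OF that] by (intro arg_cong [of _ _ sum_list] map_cong) auto
    then show ?thesis
      using wedgesD(1) [OF that] by (simp add: mon_deg_sum_list sum_list_triv)
  qed
  \<comment> \<open>Equal weights mean equal total exponents. Each factor contributes at most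
    \<open>sum_list L\<close>, so all of them attain it and are equal to \<open>L\<close>.\<close>
  have main: "s = ?sL" if s: "s \<in> Poly_Mapping.keys P" "mon_eval ?\<Delta> s \<noteq> 0" "w s = w ?sL" for s
  proof -
    \<comment> \<open>The factors of \<open>s\<close> listed with multiplicity, so that totals
      become sums over a set with \<open>d\<close> elements.\<close>
    let ?X = "Sigma (Poly_Mapping.keys s) (\<lambda>M. {..<Poly_Mapping.lookup s M})"
    have deg: "mon_deg s = d"
      using P(1) s(1) by (simp add: forms_def)
    have fin: "finite ?X"
      by (intro finite_SigmaI) simp_all
    have card: "card ?X = d"
      using deg by (simp add: mon_deg_def)
    have X: "fst x \<in> wedges lt q m" if "x \<in> ?X" for x
      using that P(2) [OF s(1)] by auto
    have leq: "sum_list (fst x) = sum_list L \<and> fst x = L \<or> lt (sum_list (fst x)) (sum_list L)"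
      if x: "x \<in> ?X" for x
    proof (cases "fst x = L")
      case False
      have "?\<Delta> (fst x) ^ Poly_Mapping.lookup s (fst x) \<noteq> 0"
        using s(2) x by (auto simp: mon_eval_def)
      then have "?\<Delta> (fst x) \<noteq> 0"
        using x by auto
      then obtain \<pi> where "\<pi> permutes {0..<q}"
        "\<And>i. i < q \<Longrightarrow> fst x ! \<pi> i = L ! i \<or> lt (fst x ! \<pi> i) (L ! i)"
        using pluecker_nonzero_dominated [OF lt X [OF x] bs] by blast
      then show ?thesis
        using permuted_sum_less [OF lt L X [OF x]] False by blast
    qed simp
    have "(\<Sum>x\<in>?X. weight \<omega> (sum_list (fst x))) =
        (\<Sum>M\<in>Poly_Mapping.keys s. \<Sum>k<Poly_Mapping.lookup s M. weight \<omega> (sum_list M))"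
      by (subst sum.Sigma) (simp_all add: split_def)
    then have "weight \<omega> (\<Sum>x\<in>?X. sum_list (fst x)) = w s"
      unfolding weight_sum w_def by (simp add: mult.commute)
    moreover have "weight \<omega> (\<Sum>x\<in>?X. sum_list L) = w ?sL"
      unfolding weight_sum w_def by (simp add: card mult.commute)
    ultimately have weq: "weight \<omega> (\<Sum>x\<in>?X. sum_list (fst x)) = weight \<omega> (\<Sum>x\<in>?X. sum_list L)"
      using s(3) by simp
    have "mon_deg (\<Sum>x\<in>?X. sum_list (fst x)) = d * (q * m)"
      unfolding mon_deg_sum using X by (simp add: deg_sum_list card)
    moreover have "mon_deg (\<Sum>x\<in>?X. sum_list L) = d * (q * m)"
      unfolding mon_deg_sum by (simp add: deg_sum_list [OF L] card)
    ultimately have eq: "(\<Sum>x\<in>?X. sum_list (fst x)) = (\<Sum>x\<in>?X. sum_list L)"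
      by (intro \<omega> weq) simp_all
    then have "\<forall>x\<in>?X. sum_list (fst x) = sum_list L"
      using term_order_sum [OF lt fin, of "\<lambda>x. sum_list (fst x)" "\<lambda>x. sum_list L"] leq
        term_order_irrefl [OF lt] by metis
    then have fstL: "fst x = L" if "x \<in> ?X" for x
      using leq [OF that] that term_order_irrefl [OF lt] by metis
    have keys: "M = L" if "M \<in> Poly_Mapping.keys s" for M
      using fstL [of "(M, 0)"] that by (simp add: in_keys_iff)
    then have "Poly_Mapping.keys s \<subseteq> {L}"
      by blast
    then have "Poly_Mapping.lookup s L = d"
      using deg by (simp add: mon_deg_superset [of "{L}" s])
    moreover have "Poly_Mapping.lookup s M = 0" if "M \<noteq> L" for M
      using keys that by (auto simp: in_keys_iff)
    ultimately have "Poly_Mapping.lookup s M = Poly_Mapping.lookup ?sL M" for M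
      by (cases "M = L") (simp_all add: lookup_single when_def)
    then show ?thesis
      by (rule poly_mapping_eqI)
  qed
  \<comment> \<open>In this coefficient only the term of \<open>?sL\<close> survives: a nonzero
    coefficient of \<open>P\<close> times a power of the nonzero coordinate
    \<open>L\<close>.\<close>
  have "0 = Polynomial.coeff Q (w ?sL)"
    by (simp add: \<open>Q = 0\<close>)
  also have "\<dots> = (\<Sum>s\<in>Poly_Mapping.keys P.
      if w s = w ?sL then \<iota> (Poly_Mapping.lookup P s) * mon_eval ?\<Delta> s else 0)"
    by (simp add: Q_def Polynomial.coeff_sum)
  also have "\<dots> = (\<Sum>s\<in>{?sL}. if w s = w ?sL then \<iota> (Poly_Mapping.lookup P s) * mon_eval ?\<Delta> s else 0)"
    using sL main by (intro sum.mono_neutral_right) auto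
  finally have "\<iota> (Poly_Mapping.lookup P ?sL) * mon_eval ?\<Delta> ?sL = 0"
    by simp
  moreover have "\<iota> (Poly_Mapping.lookup P ?sL) \<noteq> 0"
    using sL by (simp add: in_keys_iff)
  moreover have "mon_eval ?\<Delta> ?sL \<noteq> 0"
    using pluecker_lms_nonzero [OF lt L bs] by (simp add: mon_eval_def)
  ultimately show False
    by simp
qed

text \<open>At a coordinate point all coordinates other than \<open>L\<close> vanish, and every
  Pluecker monomial in \<open>P\<close> has such a factor once the pure power of \<open>L\<close> is
  absent.\<close>

lemma form_vanishing_at_vs:
  assumes hom: "field_hom \<iota>" and lt: "term_order lt" and L: "L \<in> wedges lt q m"
    and P: "P \<in> forms d" "\<And>s. s \<in> Poly_Mapping.keys P \<Longrightarrow> Poly_Mapping.keys s \<subseteq> wedges lt q m"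
    and sL: "Poly_Mapping.single L d \<notin> Poly_Mapping.keys P"
    and cs: "ordered_basis cs (vs L)"
  shows "mpol_eval \<iota> (pluecker cs) P = 0"
  unfolding mpol_eval_def
proof (rule sum.neutral, rule ballI)
  fix s assume s: "s \<in> Poly_Mapping.keys P"
  have deg: "mon_deg s = d"
    using P(1) s by (simp add: forms_def)
  have "\<exists>M\<in>Poly_Mapping.keys s. M \<noteq> L"
  proof (rule ccontr)
    assume "\<not> (\<exists>M\<in>Poly_Mapping.keys s. M \<noteq> L)"
    then have keys: "M = L" if "M \<in> Poly_Mapping.keys s" for M
      using that by blast
    then have "Poly_Mapping.keys s \<subseteq> {L}"
      by blast
    then have "Poly_Mapping.lookup s L = d"
      using deg by (simp add: mon_deg_superset [of "{L}" s])
    moreover have "Poly_Mapping.lookup s M = 0" if "M \<noteq> L" for M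
      using keys that by (auto simp: in_keys_iff)
    ultimately have "Poly_Mapping.lookup s M = Poly_Mapping.lookup (Poly_Mapping.single L d) M" for M
      by (cases "M = L") (simp_all add: lookup_single when_def)
    then have "s = Poly_Mapping.single L d"
      by (rule poly_mapping_eqI)
    with s sL show False
      by simp
  qed
  then obtain M where M: "M \<in> Poly_Mapping.keys s" "M \<noteq> L"
    by blast
  have "pluecker cs M = 0"
    using pluecker_vs_zero [OF lt L _ cs M(2)] P(2) [OF s] M(1) by blast
  then have "pluecker cs M ^ Poly_Mapping.lookup s M = 0"
    using M(1) by (simp add: in_keys_iff)
  then have "(\<Prod>M\<in>Poly_Mapping.keys s. pluecker cs M ^ Poly_Mapping.lookup s M) = 0"
    using M(1) by (intro prod_zero) auto
  then show "\<iota> (Poly_Mapping.lookup P s) *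
      (\<Prod>M\<in>Poly_Mapping.keys s. pluecker cs M ^ Poly_Mapping.lookup s M) = 0"
    by simp
qed

section \<open>Initial and generic initial points\<close>

lemma upset_Int_deg: "upset U \<Longrightarrow> upset (U \<inter> {t. m \<le> mon_deg t})"
  unfolding upset_def by auto

text \<open>What is retained of a point of the Hilbert scheme. Only exponents occur, so each
  consequence is available over every field: over \<open>'k\<close> for the Hilbert polynomials,
  over \<open>'f\<close> for membership in \<open>W\<close>.\<close>

locale saturated_upset =
  fixes U :: "'v::finite mon set" and p :: "rat poly" and m :: nat and L :: "'v mon list"
  assumes upset: "upset U" and satset: "satset U = U"
    and deg_m: "U \<inter> deg_mons m = set L"
    and generated: "\<And>s. s \<in> U \<Longrightarrow> m \<le> mon_deg s \<Longrightarrow> s \<in> upclosure (set L)"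
    and hilbert: "\<exists>N. \<forall>t\<ge>N.
      of_nat (card (deg_mons t :: 'v mon set) - card (U \<inter> deg_mons t)) = poly p (of_nat t)"
begin

text \<open>Generators in degree \<open>m\<close> reach exactly the part of \<open>U\<close> in
  degrees at least \<open>m\<close>; this truncation affects neither the Hilbert polynomial nor the
  saturation.\<close>

lemma gen_ideal_vs:
  "gen_ideal (vs L) = (supported (U \<inter> {t. m \<le> mon_deg t}) :: ('v, 'a::field) mpol set)"
proof -
  have L: "set L \<subseteq> U \<inter> deg_mons m"
    using deg_m by simp
  have "upclosure (set L) = U \<inter> {t. m \<le> mon_deg t}"
  proof
    show "upclosure (set L) \<subseteq> U \<inter> {t. m \<le> mon_deg t}"
      using L upset unfolding upclosure_def upset_def by auto
    show "U \<inter> {t. m \<le> mon_deg t} \<subseteq> upclosure (set L)"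
      using generated by blast
  qed
  then show ?thesis
    by (simp add: vs_def gen_ideal_span gen_ideal_monomials)
qed

lemma has_hilbert_polynomial_gen_ideal_vs:
  "has_hilbert_polynomial (gen_ideal (vs L) :: ('v, 'a::field) mpol set) p"
proof -
  obtain N where N: "\<And>t. t \<ge> N \<Longrightarrow>
      of_nat (card (deg_mons t :: 'v mon set) - card (U \<inter> deg_mons t)) = poly p (of_nat t)"
    using hilbert by blast
  have "U \<inter> {s. m \<le> mon_deg s} \<inter> deg_mons t = U \<inter> deg_mons t" if "t \<ge> m" for t
    using that by auto
  then show ?thesis
    unfolding has_hilbert_polynomial_def gen_ideal_vs hilbert_function_supported
    using N by (intro exI [of _ "max m N"]) simp
qed

lemma hilb_point_gen_ideal_vs:
  "hilb_point m (gen_ideal (vs L)) = (vs L :: ('v, 'a::field) mpol set)"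
  unfolding hilb_point_def gen_ideal_vs saturation_supported [OF upset_Int_deg [OF upset]]
    satset_upset_Int_deg [OF upset] satset forms_eq supported_Int deg_m
  by (rule vs_eq_supported [symmetric])

lemma saturated_supported: "(supported U :: ('v, 'a::field) mpol set) \<in> saturated_ideals p"
  using hilbert
  by (simp add: saturated_ideals_def homogeneous_ideal_supported upset saturation_supported satset
      has_hilbert_polynomial_def hilbert_function_supported)

lemma vs_in_hilb:
  assumes "card (set L) = q"
  shows "(vs L :: ('v, 'a::field) mpol set) \<in> hilb p q m"
proof -
  have "set L \<subseteq> deg_mons m"
    using deg_m by blast
  then have "(vs L :: ('v, 'a) mpol set) \<in> grassmannian q m"
    using assms by (simp add: grassmannian_def vs_eq_supported subspace_supported dim_supported
        forms_eq supported_mono)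
  moreover have "hilb_point m (supported U) = (vs L :: ('v, 'a) mpol set)"
    by (simp add: hilb_point_def saturation_supported upset satset forms_eq supported_Int deg_m
        vs_eq_supported)
  ultimately show ?thesis
    using saturated_supported unfolding hilb_def by blast
qed

end

text \<open>The union of the initial monomials in all degrees spans the initial ideal; its saturation
  has the same Hilbert polynomial, so by the choice of the Gotzmann number it is regular, and a
  dimension count shows that nothing is added in degree \<open>m\<close>.\<close>

lemma saturated_upset_lms:
  fixes lt :: "'v::finite mon \<Rightarrow> 'v mon \<Rightarrow> bool" and V :: "('v, 'f::field) mpol set"
  assumes card_v: "CARD('v) = n + 1" and lt: "term_order lt"
    and gotzmann: "is_gotzmann_number (saturated_ideals p :: ('v, 'k::field) mpol set set) r"
    and rm: "r \<le> m"
    and q: "(of_nat q :: rat) = of_nat ((n + m) choose n) - poly p (of_nat m)"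
    and V: "V \<in> hilb p q m" and L: "set L = lms lt V" "distinct L" "length L = q"
  obtains U where "saturated_upset U p m L"
proof -
  obtain I where I: "I \<in> saturated_ideals p" "V = hilb_point m I"
    using V unfolding hilb_def by blast
  have sat: "saturation I = I" and hp: "has_hilbert_polynomial I p" and homog: "homogeneous_ideal I"
    using I(1) by (simp_all add: saturated_ideals_def)
  have ideal: "idl.subspace I"
    using homog ideal_gen_ideal unfolding homogeneous_ideal_def by blast
  have V_eq: "V = I \<inter> forms m"
    using I(2) by (simp add: hilb_point_def sat)
  \<comment> \<open>Exponents of the initial ideal, collected degree by degree so that
    \<open>dim_eq_card_lms\<close> applies to finitely many monomials at a time.\<close>
  define E where "E = (\<Union>t. lms lt (I \<inter> forms t))"
  have lms_deg: "lms lt (I \<inter> forms t) \<subseteq> deg_mons t" for t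
    by (rule lms_subset) (simp add: forms_eq)
  then have E_deg: "E \<inter> deg_mons t = lms lt (I \<inter> forms t)" for t
    unfolding E_def by blast
  have card_E: "card (E \<inter> deg_mons t) = mpv.dim (I \<inter> forms t)" for t
  proof -
    have "mpv.subspace (I \<inter> forms t)"
      by (intro mpv.subspace_inter ideal_subspace ideal subspace_forms)
    moreover have "I \<inter> forms t \<subseteq> supported (deg_mons t)"
      by (simp add: forms_eq)
    ultimately show ?thesis
      unfolding E_deg by (rule dim_eq_card_lms [OF lt _ _ finite_deg_mons, symmetric])
  qed
  have up_E: "upset E"
    unfolding upset_def
  proof (intro ballI allI)
    fix s w assume "s \<in> E"
    then obtain t f where f: "f \<in> I" "f \<in> forms t" "is_lm lt f s"
      unfolding E_def lms_def by blast
    have "monomial w * f \<in> I"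
      by (rule idl.subspace_scale [OF ideal f(1)])
    moreover have "monomial w * f \<in> forms (mon_deg w + t)"
      using f(2) by (intro forms_mult) (simp add: forms_def)
    ultimately have "s + w \<in> lms lt (I \<inter> forms (mon_deg w + t))"
      using is_lm_monomial_mult [OF lt f(3), of w] unfolding lms_def by blast
    then show "s + w \<in> E"
      unfolding E_def by blast
  qed
  define U where "U = satset E"
  have up_U: "upset U"
    unfolding U_def by (rule upset_satset [OF up_E])
  have sat_U: "satset U = U"
    unfolding U_def by (rule satset_idem [OF up_E])
  obtain N where N: "\<And>t. t \<ge> N \<Longrightarrow> U \<inter> deg_mons t = E \<inter> deg_mons t"
    using satset_eventually [OF up_E] unfolding U_def by blast
  obtain N' where N': "\<And>t. t \<ge> N' \<Longrightarrow> of_nat (hilbert_function I t) = poly p (of_nat t)"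
    using hp unfolding has_hilbert_polynomial_def by blast
  have hilbert: "of_nat (card (deg_mons t :: 'v mon set) - card (U \<inter> deg_mons t)) = poly p (of_nat t)"
    if "t \<ge> max N N'" for t
    using N [of t] N' [of t] that by (simp add: card_E hilbert_function_def dim_forms)
  \<comment> \<open>Change of field: \<open>I\<close> has coefficients in \<open>'f\<close>, but the
    count just made depends on exponents alone, so the monomial ideal can be taken over
    \<open>'k\<close>, where \<open>gotzmann\<close> applies.\<close>
  have hp_U: "has_hilbert_polynomial (supported U :: ('v, 'k) mpol set) p"
    unfolding has_hilbert_polynomial_def hilbert_function_supported using hilbert by blast
  have "(supported U :: ('v, 'k) mpol set) \<in> saturated_ideals p"
    using hp_U
    by (simp add: saturated_ideals_def homogeneous_ideal_supported up_U saturation_supported sat_U)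
  then have reg: "regular r (supported U :: ('v, 'k) mpol set)"
    using gotzmann unfolding is_gotzmann_number_def by blast
  \<comment> \<open>Saturating could have added monomials in degree \<open>m\<close>. It did not,
    since \<open>set L\<close> is contained in the left-hand side and both have \<open>q\<close>
    elements; regularity gives the count on the left because \<open>r \<le> m\<close>.\<close>
  have deg_m: "U \<inter> deg_mons m = set L"
  proof -
    have "(of_nat (hilbert_function (supported U :: ('v, 'k) mpol set) m) :: rat) = poly p (of_nat m)"
      by (rule regular_hilbert_function [OF reg hp_U rm])
    moreover have "card (deg_mons m :: 'v mon set) = (n + m) choose n"
      using binomial_symmetric [of m "m + n"] by (simp add: card_deg_mons card_v add.commute)
    moreover have "card (U \<inter> deg_mons m) \<le> card (deg_mons m :: 'v mon set)"
      by (intro card_mono finite_deg_mons) simp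
    ultimately have "(of_nat (card (U \<inter> deg_mons m)) :: rat) = of_nat q"
      unfolding q hilbert_function_supported by (simp add: of_nat_diff)
    then have "card (U \<inter> deg_mons m) = q"
      by simp
    moreover have "card (set L) = q"
      using L(2,3) distinct_card by blast
    moreover have "set L \<subseteq> U \<inter> deg_mons m"
      using subset_satset [of E] E_deg [of m] unfolding U_def L(1) V_eq by blast
    ultimately show ?thesis
      using card_subset_eq [of "U \<inter> deg_mons m" "set L"] finite_subset [OF Int_lower2 finite_deg_mons]
      by metis
  qed
  have "s \<in> upclosure (set L)" if s: "s \<in> U" "m \<le> mon_deg s" for s
  proof -
    obtain u w where "u \<in> U" "mon_deg u = m" "s = u + w"
      using regular_supported_generated [OF reg up_U s(1) rm s(2)] by blast
    with deg_m show ?thesis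
      unfolding upclosure_def by blast
  qed
  with up_U sat_U deg_m hilbert have "saturated_upset U p m L"
    by unfold_locales blast+
  then show thesis
    by (rule that)
qed

text \<open>Both spaces are spanned by the same monomials, whose coefficients 0 and 1 are kept by
  \<open>\<iota>\<close>.\<close>

lemma base_change_vs:
  fixes \<iota> :: "'k::field \<Rightarrow> 'f::field" and L :: "'v mon list"
  assumes "field_hom \<iota>"
  shows "base_change \<iota> (vs L) = vs L"
proof
  interpret field_hom \<iota> by (rule assms)
  have lookup: "Poly_Mapping.lookup (Poly_Mapping.map \<iota> f) t = \<iota> (Poly_Mapping.lookup f t)"
    for f :: "('v, 'k) mpol" and t
    by (simp add: Poly_Mapping.map.rep_eq when_def)
  show "base_change \<iota> (vs L) \<subseteq> vs L"
    unfolding base_change_def vs_eq_supported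
  proof (intro mpv.span_minimal subspace_supported subsetI)
    fix h :: "('v, 'f) mpol" assume "h \<in> Poly_Mapping.map \<iota> ` supported (set L)"
    then obtain f :: "('v, 'k) mpol" where f: "f \<in> supported (set L)" "h = Poly_Mapping.map \<iota> f"
      by blast
    have "Poly_Mapping.keys h \<subseteq> Poly_Mapping.keys f"
      by (auto simp: f(2) in_keys_iff lookup)
    with f(1) show "h \<in> supported (set L)"
      by (auto simp: supported_def)
  qed
  have "Poly_Mapping.map \<iota> (monomial t) = monomial t" for t :: "'v mon"
    by (rule poly_mapping_eqI) (simp add: lookup)
  then have "monomial ` set L \<subseteq> Poly_Mapping.map \<iota> ` vs L"
    unfolding vs_def using mpv.span_superset by (metis (no_types) image_subset_iff imageI subsetD)
  then show "vs L \<subseteq> base_change \<iota> (vs L)"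
    unfolding base_change_def vs_def [where 'a = 'f] by (rule mpv.span_mono)
qed

lemma gl_orbit_nonempty:
  fixes \<iota> :: "'k::field \<Rightarrow> 'f::field" and W :: "('v::finite, 'f) mpol set set"
  assumes "W \<noteq> {}"
  shows "gl_orbit \<iota> W \<noteq> {}"
proof -
  have "invertible (Finite_Cartesian_Product.mat 1 :: 'k ^ 'v ^ 'v)"
    unfolding invertible_def by (intro exI [of _ "Finite_Cartesian_Product.mat 1"]) simp
  with assms show ?thesis
    unfolding gl_orbit_def by blast
qed

lemma gl_orbit_stable:
  fixes \<iota> :: "'k::field \<Rightarrow> 'f::field" and W :: "('v::finite, 'f) mpol set set"
  assumes "gl_stable \<iota> W"
  shows "gl_orbit \<iota> W = W"
proof -
  have stable: "(\<lambda>V. gl_act \<iota> g ` V) ` W = W" if "invertible g" for g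
    using assms that unfolding gl_stable_def by blast
  have "invertible (Finite_Cartesian_Product.mat 1 :: 'k ^ 'v ^ 'v)"
    unfolding invertible_def by (intro exI [of _ "Finite_Cartesian_Product.mat 1"]) simp
  then have "gl_orbit \<iota> W = (\<Union>g\<in>{g :: 'k ^ 'v ^ 'v. invertible g}. (\<lambda>V. gl_act \<iota> g ` V) ` W)"
    "{g :: 'k ^ 'v ^ 'v. invertible g} \<noteq> {}"
    unfolding gl_orbit_def by blast+
  moreover from this(2) have "\<exists>g :: 'k ^ 'v ^ 'v. invertible g"
    by blast
  ultimately show ?thesis
    using stable by auto
qed

text \<open>Each equation of \<open>W\<close> vanishes on the torus orbit of \<open>V\<close>, hence
  lacks the pure power of the coordinate \<open>L\<close>, hence vanishes at \<open>vs L\<close>.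
  Only the equations are treated; membership in the Hilbert scheme enters as
  \<open>hilb\<close>.\<close>

lemma vs_initial_in_closed_stable:
  fixes \<iota> :: "'k::field \<Rightarrow> 'f::field" and W :: "('v::finite, 'f) mpol set set"
  assumes inf: "infinite (UNIV :: 'k set)" and hom: "field_hom \<iota>" and lt: "term_order lt"
    and closed: "closed_in_hilb \<iota> lt p q m W" and stable: "gl_stable \<iota> W"
    and V: "V \<in> W" "ordered_basis bs V" and L: "L \<in> wedges lt q m"
    and bs: "\<And>i. i < q \<Longrightarrow> is_lm lt (bs ! i) (L ! i)"
    and hilb: "(vs L :: ('v, 'f) mpol set) \<in> hilb p q m"
  shows "vs L \<in> W"
proof -
  obtain Z :: "(('v mon list \<Rightarrow>\<^sub>0 nat) \<Rightarrow>\<^sub>0 'k) set" where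
    Z: "\<forall>P\<in>Z. (\<exists>d. P \<in> forms d) \<and> (\<forall>s\<in>Poly_Mapping.keys P. Poly_Mapping.keys s \<subseteq> wedges lt q m)"
    and W: "W = {V \<in> hilb p q m.
               \<forall>P\<in>Z. \<forall>bs. ordered_basis bs V \<longrightarrow> mpol_eval \<iota> (pluecker bs) P = 0}"
    using closed unfolding closed_in_hilb_def by blast
  have len: "length bs = q"
    using V W length_ordered_basis [OF V(2)] by (auto simp: hilb_def grassmannian_def)
  have vanish: "mpol_eval \<iota> (pluecker (map (gl_act \<iota> (torus \<omega> c)) bs)) P = 0"
    if P: "P \<in> Z" and c: "c \<noteq> 0" for P \<omega> c
  proof -
    have inv: "invertible (torus \<omega> c :: 'k ^ 'v ^ 'v)"
      by (rule invertible_torus [OF c])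
    then obtain h where "torus \<omega> c ** h = Finite_Cartesian_Product.mat 1"
      "h ** torus \<omega> c = Finite_Cartesian_Product.mat 1"
      unfolding invertible_def by blast
    then have "graded_automorphism (gl_act \<iota> (torus \<omega> c)) (gl_act \<iota> h)"
      by (rule graded_automorphism_gl_act [OF hom])
    then have "ordered_basis (map (gl_act \<iota> (torus \<omega> c)) bs) (gl_act \<iota> (torus \<omega> c) ` V)"
      using V(2) by (rule ordered_basis_image)
    moreover have "gl_act \<iota> (torus \<omega> c) ` V \<in> W"
      using stable V(1) inv unfolding gl_stable_def by blast
    ultimately show ?thesis
      using P W by blast
  qed
  have "mpol_eval \<iota> (pluecker cs) P = 0" if P: "P \<in> Z" and cs: "ordered_basis cs (vs L)" for P cs
  proof -
    obtain d where d: "P \<in> forms d"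
      using Z P by blast
    have keys: "Poly_Mapping.keys s \<subseteq> wedges lt q m" if "s \<in> Poly_Mapping.keys P" for s
      using Z P that by blast
    have "Poly_Mapping.single L d \<notin> Poly_Mapping.keys P"
      by (rule form_vanishing_on_torus_orbit [OF inf hom lt L len bs d keys vanish [OF P]])
    from form_vanishing_at_vs [OF hom lt L d keys this cs] show ?thesis .
  qed
  then show ?thesis
    using hilb by (subst W) blast
qed

theorem corollary4p3:
  fixes \<iota> :: "'k::field \<Rightarrow> 'f::field"
    and lt :: "'v::{finite,linorder} mon \<Rightarrow> 'v mon \<Rightarrow> bool"
    and p :: "rat poly"
    and n m q r :: nat
    and W :: "('v, 'f) mpol set set"
  assumes "infinite (UNIV :: 'k set)"
    and "field_hom \<iota>"
    and "CARD('v) = n + 1"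
    and "term_order lt"
    and "\<And>i j. i < j \<Longrightarrow> lt (var_mon i) (var_mon j)"
    and "is_gotzmann_number (saturated_ideals p :: ('v, 'k) mpol set set) r"
    and "r \<le> m"
    and "(of_nat q :: rat) = of_nat ((n + m) choose n) - poly p (of_nat m)"
    and "closed_in_hilb \<iota> lt p q m W"
    and "W \<noteq> {}"
  shows "has_hilbert_polynomial
           (gen_ideal (vs (initial lt q m W)) :: ('v, 'k) mpol set) p \<and>
         has_hilbert_polynomial
           (gen_ideal (vs (generic_initial \<iota> lt q m W)) :: ('v, 'k) mpol set) p \<and>
         (gl_stable \<iota> W \<longrightarrow>
           (gen_ideal (vs (initial lt q m W)) :: ('v, 'k) mpol set) =
             gen_ideal (vs (generic_initial \<iota> lt q m W)) \<and>
           base_change \<iota> (hilb_point m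
             (gen_ideal (vs (initial lt q m W)) :: ('v, 'k) mpol set)) \<in> W)"
proof -
  have W: "W \<subseteq> hilb p q m"
    using assms(9) unfolding closed_in_hilb_def by blast
  \<comment> \<open>Stated for any nonempty set of points of the Hilbert scheme, because it is also
    applied to the orbit of \<open>W\<close>, which need not be closed.\<close>
  have lead: "\<exists>V bs U. V \<in> X \<and> ordered_basis bs V \<and> initial lt q m X \<in> wedges lt q m \<and>
      (\<forall>i<q. is_lm lt (bs ! i) (initial lt q m X ! i)) \<and> saturated_upset U p m (initial lt q m X)"
    if X: "X \<subseteq> hilb p q m" "X \<noteq> {}" for X :: "('v, 'f) mpol set set"
  proof -
    have "X \<subseteq> grassmannian q m"
      using X(1) unfolding hilb_def by blast
    then obtain V bs where V: "V \<in> X" "ordered_basis bs V" "initial lt q m X \<in> wedges lt q m"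
      "set (initial lt q m X) = lms lt V" "\<And>i. i < q \<Longrightarrow> is_lm lt (bs ! i) (initial lt q m X ! i)"
      using initial_eq_lms [OF assms(4) _ X(2)] by blast
    have VH: "V \<in> hilb p q m"
      using X(1) V(1) by blast
    obtain U where "saturated_upset U p m (initial lt q m X)"
      by (rule saturated_upset_lms [OF assms(3,4,6,7,8) VH V(4)
            distinct_wedge [OF assms(4) V(3)] wedgesD(1) [OF V(3)]])
    with V show ?thesis
      by blast
  qed
  let ?L = "initial lt q m W"
  obtain V bs U where V: "V \<in> W" "ordered_basis bs V" "?L \<in> wedges lt q m"
    "\<And>i. i < q \<Longrightarrow> is_lm lt (bs ! i) (?L ! i)" and U: "saturated_upset U p m ?L"
    using lead [OF W assms(10)] by blast
  interpret saturated_upset U p m ?L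
    by (rule U)
  have "gl_orbit \<iota> W \<subseteq> hilb p q m"
    using W gl_act_hilb [OF assms(2)] unfolding gl_orbit_def by blast
  moreover have "gl_orbit \<iota> W \<noteq> {}"
    by (rule gl_orbit_nonempty [OF assms(10)])
  ultimately obtain U' where U': "saturated_upset U' p m (generic_initial \<iota> lt q m W)"
    using lead unfolding generic_initial_def by blast
  have "has_hilbert_polynomial (gen_ideal (vs ?L) :: ('v, 'k) mpol set) p"
    by (rule has_hilbert_polynomial_gen_ideal_vs)
  moreover have "has_hilbert_polynomial
      (gen_ideal (vs (generic_initial \<iota> lt q m W)) :: ('v, 'k) mpol set) p"
    by (rule saturated_upset.has_hilbert_polynomial_gen_ideal_vs [OF U'])
  moreover have "generic_initial \<iota> lt q m W = ?L" if "gl_stable \<iota> W"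
    unfolding generic_initial_def gl_orbit_stable [OF that] ..
  moreover have "vs ?L \<in> W" if "gl_stable \<iota> W"
  proof (rule vs_initial_in_closed_stable [OF assms(1,2,4,9) that V(1-3)])
    show "vs ?L \<in> hilb p q m"
      using distinct_card [OF distinct_wedge [OF assms(4) V(3)]] wedgesD(1) [OF V(3)]
      by (intro vs_in_hilb) simp
  qed (rule V(4))
  ultimately show ?thesis
    by (simp add: hilb_point_gen_ideal_vs base_change_vs [OF assms(2)])
qed

end
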